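(* Let $\alpha,\beta$ be rational numbers with $0\le\alpha<\beta\le1$ and put $I=(\alpha,\beta)$. Then $\chi_I\in\mathcal{C}$ if and only if $I$ is one of the ten intervals $$(0,1),(0,\tfrac12),(\tfrac12,1),(0,\tfrac23),(\tfrac13,\tfrac23),(\tfrac13,1),(\tfrac14,\tfrac34),(\tfrac15,\tfrac35),(\tfrac25,\tfrac45),(\tfrac16,\tfrac56).$$
   Context: $\chi_I$ is the characteristic function of $I$ on $(0,1)$. $L^2=L^2(0,1)$; each $\varphi\in L^2$ is identified with its odd $2$-periodic extension to $\mathbb{R}$. $\mathcal{C}$ is the set of $\varphi\in L^2$ such that the span of $\{\varphi(kx):k\in\mathbb{N}\}$ is dense in $L^2$. *)

theory Defs
  imports "HOL-Analysis.Analysis"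
begin

abbreviation unit_iv :: "real measure" where
  "unit_iv \<equiv> lebesgue_on {0<..<1}"

definition L2 :: "(real \<Rightarrow> real) set" where
  "L2 = {f. f \<in> borel_measurable unit_iv \<and> integrable unit_iv (\<lambda>x. (f x)\<^sup>2)}"

text \<open>Odd 2-periodic extension of a function given on (0,1)
  (values at integers are irrelevant, set to 0).\<close>
definition odd_ext :: "(real \<Rightarrow> real) \<Rightarrow> real \<Rightarrow> real" where
  "odd_ext \<phi> x = (let y = x - 2 * of_int \<lfloor>x / 2\<rfloor> in
      if 0 < y \<and> y < 1 then \<phi> y
      else if 1 < y \<and> y < 2 then - \<phi> (2 - y) else 0)"

definition C_class :: "(real \<Rightarrow> real) set" where
  "C_class = {\<phi> \<in> L2. \<forall>f \<in> L2. \<forall>\<epsilon>>0. \<exists>(n::nat) (c::nat \<Rightarrow> real).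
      integrable unit_iv (\<lambda>x. (f x - (\<Sum>k=1..n. c k * odd_ext \<phi> (real k * x)))\<^sup>2) \<and>
      (LINT x|unit_iv. (f x - (\<Sum>k=1..n. c k * odd_ext \<phi> (real k * x)))\<^sup>2) < \<epsilon>}"

end

theory Submission
  imports Defs "HOL-Complex_Analysis.Complex_Analysis" "HOL-Number_Theory.Number_Theory"
begin

text \<open>
  Write \<open>f n = cos (n\<pi>\<alpha>) - cos (n\<pi>\<beta>)\<close>. Up to a constant, the sine coefficients of the indicator of
  \<open>(\<alpha>, \<beta>)\<close> are \<open>f n / n\<close>, and the dilation by \<open>k\<close> moves the \<open>n\<close>-th coefficient to place \<open>k n\<close>.
  Every square-summable completely multiplicative \<open>\<Lambda>\<close> gives a bounded functional that multiplies by
  \<open>\<Lambda> k\<close> under this dilation, so membership in the class forces \<open>\<Sum>n. \<Lambda> n * f n / n \<noteq> 0\<close>.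

  Necessity. Let \<open>a\<close> be a residue class modulo a period \<open>N\<close> of \<open>f\<close> for which the sum of \<open>1/p\<close> over the
  primes in the class diverges. Put \<open>\<Lambda> p = t/T\<close> on a finite set of such primes with \<open>\<Sum>1/p = T\<close>, and
  \<open>\<Lambda> n = n\<^sup>-\<^sup>s\<close> away from them. As \<open>T\<close> grows, the functional tends to
  \<open>\<Sum>k. H (a\<^sup>k) * t\<^sup>k / k!\<close>, where \<open>H n = \<Sum>m. f (n m) / m\<^sup>s\<^sup>+\<^sup>1\<close>. By Hurwitz this entire
  function of exponential type has no zeros, hence it is a single exponential, hence \<open>H a = \<plusminus> H 1\<close>.
  Letting \<open>s\<close> tend to infinity gives \<open>f (a m) = \<plusminus> f m\<close> for all \<open>m\<close>. A sieve argument shows that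
  such classes generate all units modulo \<open>N\<close>. So each unit \<open>u\<close> permutes
  \<open>{cos (\<pi>\<alpha>), cos (\<pi>\<beta>)}\<close>, which leaves fourteen intervals, and four of these are excluded by explicit
  zeros supported on the primes 2 and 3.

  Sufficiency. In the ten remaining cases \<open>f n / n\<close> is the coefficient sequence of
  \<open>(1 - e p\<^sup>-\<^sup>s) \<Prod>q. (1 - \<xi> q * q\<^sup>-\<^sup>1\<^sup>-\<^sup>s)\<^sup>-\<^sup>1\<close> with a real character \<open>\<xi>\<close> and \<open>\<bar>e\<bar> \<le> 1\<close>. Sieving by
  the primes up to \<open>Y\<close> removes the Euler product in the limit, and averaging removes the factor
  \<open>1 - e p\<^sup>-\<^sup>s\<close>.
\<close>

section \<open>Sine series in \<open>L\<^sup>2(0,1)\<close>\<close>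

text \<open>Square-summability of \<Lambda> constrains finitely many primes only by |\<Lambda> p| <
  1, so t may fill the disc of radius T; these discs exhaust the plane, and this makes the limit
  entire. Spreading t thinly over many primes linearises the Euler factors 1 / (1 - t / (T p)):
  since the 1/p add up to T, the first-order terms add up to exactly t, while the second-order terms
  are O(1/T) in total.

  An Euler product requires f to react to every p in the class of a by a scalar. Hence f is split
  into eigenfunctions of n -> a n; their eigenvalues are roots of unity, because some power of a is
  1 modulo N. Each eigenfunction contributes one exponential to the limit, which gives the
  exponential type. A single exponential c exp (\<mu> t) means H (a^k) = c \<mu>^k; periodicity in k
  makes \<mu> a root of unity, and H is real, so only \<mu> = 1 and \<mu> = -1 remain.

  The parameter s runs through the natural numbers, and the Dirichlet series have exponent s + 2, so
  that everything converges absolutely with the common majorant 1/m^2.\<close>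

definition sine_coeff :: "(real \<Rightarrow> real) \<Rightarrow> nat \<Rightarrow> real" where
  "sine_coeff g n = sqrt 2 * (LINT x|unit_iv. g x * sin (real n * pi * x))"

lemma finite_measure_unit_iv: "finite_measure unit_iv"
  by (rule finite_measure_lebesgue_on) auto

lemma continuous_measurable_unit_iv:
  fixes g :: "real \<Rightarrow> real"
  assumes "continuous_on UNIV g"
  shows "g \<in> borel_measurable unit_iv"
  using borel_measurable_continuous_onI[OF assms]
  by (intro measurable_restrict_space1 measurable_completion) simp

lemma integrable_bounded_unit_iv:
  fixes g :: "real \<Rightarrow> real"
  assumes "g \<in> borel_measurable unit_iv" "\<And>x. x \<in> {0<..<1} \<Longrightarrow> \<bar>g x\<bar> \<le> B"
  shows "integrable unit_iv g"
proof -
  interpret finite_measure unit_iv by (rule finite_measure_unit_iv)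
  show ?thesis
    by (rule integrable_const_bound[where B = B]) (use assms in auto)
qed

lemma L2_bounded:
  assumes "g \<in> borel_measurable unit_iv" "\<And>x. x \<in> {0<..<1} \<Longrightarrow> \<bar>g x\<bar> \<le> B"
  shows "g \<in> L2"
proof -
  have "integrable unit_iv (\<lambda>x. (g x)\<^sup>2)"
  proof (rule integrable_bounded_unit_iv[where B = "B\<^sup>2"])
    show "(\<lambda>x. (g x)\<^sup>2) \<in> borel_measurable unit_iv"
      using assms(1) by measurable
    show "\<bar>(g x)\<^sup>2\<bar> \<le> B\<^sup>2" if "x \<in> {0<..<1}" for x
      using power_mono[OF assms(2)[OF that], of 2] by simp
  qed
  with assms(1) show ?thesis by (simp add: L2_def)
qed

lemma L2_integrable_mult:
  assumes "f \<in> L2" "g \<in> L2"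
  shows "integrable unit_iv (\<lambda>x. f x * g x)"
proof (rule Bochner_Integration.integrable_bound[where f = "\<lambda>x. (f x)\<^sup>2 + (g x)\<^sup>2"])
  show "integrable unit_iv (\<lambda>x. (f x)\<^sup>2 + (g x)\<^sup>2)"
    using assms by (auto simp: L2_def)
  show "(\<lambda>x. f x * g x) \<in> borel_measurable unit_iv"
    using assms by (auto simp: L2_def)
  have "\<bar>a * b\<bar> \<le> a\<^sup>2 + b\<^sup>2" for a b :: real
  proof -
    have "0 \<le> (\<bar>a\<bar> - \<bar>b\<bar>)\<^sup>2" by simp
    then have "2 * \<bar>a * b\<bar> \<le> a\<^sup>2 + b\<^sup>2"
      by (simp add: power2_diff abs_mult)
    then show ?thesis
      using abs_ge_zero[of "a * b"] by linarith
  qed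
  then show "AE x in unit_iv. norm (f x * g x) \<le> norm ((f x)\<^sup>2 + (g x)\<^sup>2)"
    by auto
qed

lemma L2_cmult: "f \<in> L2 \<Longrightarrow> (\<lambda>x. c * f x) \<in> L2"
  by (auto simp: L2_def power_mult_distrib)

lemma L2_add:
  assumes "f \<in> L2" "g \<in> L2"
  shows "(\<lambda>x. f x + g x) \<in> L2"
  using assms L2_integrable_mult[OF assms]
  by (auto simp: L2_def power2_sum mult.assoc)

lemma L2_diff: "f \<in> L2 \<Longrightarrow> g \<in> L2 \<Longrightarrow> (\<lambda>x. f x - g x) \<in> L2"
  using L2_add[of f "\<lambda>x. -1 * g x"] L2_cmult[of g "-1"] by simp

lemma L2_sum: "(\<And>i. i \<in> A \<Longrightarrow> f i \<in> L2) \<Longrightarrow> (\<lambda>x. \<Sum>i\<in>A. f i x) \<in> L2"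
  by (induction A rule: infinite_finite_induct)
     (auto intro!: L2_add simp: L2_bounded[where B = 0])

lemma L2_sin: "(\<lambda>x. sin (real n * pi * x)) \<in> L2"
  by (rule L2_bounded[where B = 1])
     (auto intro!: continuous_measurable_unit_iv continuous_intros)

lemma LINT_unit_iv_continuous:
  fixes g :: "real \<Rightarrow> real"
  assumes "continuous_on UNIV g"
  shows "(LINT x|unit_iv. g x) = integral {0..1} g"
proof -
  obtain B where B: "\<forall>x\<in>{0..1}. \<bar>g x\<bar> \<le> B"
    using compact_imp_bounded[OF compact_continuous_image[OF continuous_on_subset[OF assms], of "{0..1}"]]
    by (auto simp: bounded_iff)
  have "integrable unit_iv g"
    by (rule integrable_bounded_unit_iv[where B = B])
       (use B assms in \<open>auto intro: continuous_measurable_unit_iv\<close>)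
  then have "(LINT x|unit_iv. g x) = integral {0<..<1} g"
    by (rule lebesgue_integral_eq_integral) auto
  then show ?thesis
    by (simp add: integral_open_interval_real)
qed

lemma LINT_cos_int:
  "(LINT x|unit_iv. cos (of_int j * pi * x)) = (if j = 0 then 1 else 0)"
proof (cases "j = 0")
  case True
  then show ?thesis
    using LINT_unit_iv_continuous[of "\<lambda>_. 1"] by simp
next
  case False
  have "((\<lambda>x. cos (of_int j * pi * x)) has_integral
      (sin (of_int j * pi * 1) / (of_int j * pi) - sin (of_int j * pi * 0) / (of_int j * pi))) {0..1}"
  proof (rule fundamental_theorem_of_calculus)
    fix x :: real
    have "((\<lambda>x. sin (of_int j * pi * x) / (of_int j * pi)) has_real_derivative cos (of_int j * pi * x)) (at x within {0..1})"
      using False by (auto intro!: derivative_eq_intros)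
    then show "((\<lambda>x. sin (of_int j * pi * x) / (of_int j * pi)) has_vector_derivative cos (of_int j * pi * x)) (at x within {0..1})"
      by (simp add: has_real_derivative_iff_has_vector_derivative)
  qed simp
  moreover have "sin (of_int j * pi * 1) = 0"
    by (simp add: sin_zero_iff_int2)
  ultimately have "integral {0..1} (\<lambda>x. cos (of_int j * pi * x)) = 0"
    by (simp add: integral_unique)
  then show ?thesis
    using False by (subst LINT_unit_iv_continuous) (auto intro!: continuous_intros)
qed

lemma LINT_sin_sin:
  assumes "n \<ge> 1"
  shows "(LINT x|unit_iv. sin (real n * pi * x) * sin (real m * pi * x)) = (if n = m then 1/2 else 0)"
proof -
  have int: "integrable unit_iv (\<lambda>x. cos (of_int j * pi * x))" for j
    by (rule integrable_bounded_unit_iv[where B = 1])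
       (auto intro!: continuous_measurable_unit_iv continuous_intros)
  have "sin (real n * pi * x) * sin (real m * pi * x) =
      (cos (of_int (int n - int m) * pi * x) - cos (of_int (int n + int m) * pi * x)) / 2" for x
  proof -
    have *: "of_int (int n - int m) * pi * x = real n * pi * x - real m * pi * x"
      "of_int (int n + int m) * pi * x = real n * pi * x + real m * pi * x"
      by (simp_all add: algebra_simps)
    show ?thesis unfolding * by (simp add: cos_add cos_diff)
  qed
  then have "(LINT x|unit_iv. sin (real n * pi * x) * sin (real m * pi * x)) =
     ((LINT x|unit_iv. cos (of_int (int n - int m) * pi * x)) -
      (LINT x|unit_iv. cos (of_int (int n + int m) * pi * x))) / 2"
    by (simp only: integral_divide_zero Bochner_Integration.integral_diff[OF int int])
  then show ?thesis
    using assms by (simp only: LINT_cos_int) auto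
qed

lemma sine_coeff_0 [simp]: "sine_coeff g 0 = 0"
  by (simp add: sine_coeff_def)

lemma sine_coeff_cmult: "sine_coeff (\<lambda>x. c * g x) n = c * sine_coeff g n"
  by (simp add: sine_coeff_def mult.assoc)

lemma sine_coeff_add:
  assumes "f \<in> L2" "g \<in> L2"
  shows "sine_coeff (\<lambda>x. f x + g x) n = sine_coeff f n + sine_coeff g n"
  using L2_integrable_mult[OF assms(1) L2_sin[of n]] L2_integrable_mult[OF assms(2) L2_sin[of n]]
  by (simp add: sine_coeff_def distrib_right distrib_left)

lemma sine_coeff_sum:
  assumes "\<And>i. i \<in> A \<Longrightarrow> f i \<in> L2"
  shows "sine_coeff (\<lambda>x. \<Sum>i\<in>A. f i x) n = (\<Sum>i\<in>A. sine_coeff (f i) n)"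
  using assms
proof (induction A rule: infinite_finite_induct)
  case (insert a A)
  then show ?case
    by (simp add: sine_coeff_add L2_sum)
qed (auto simp: sine_coeff_def)

lemma sine_coeff_diff:
  assumes "f \<in> L2" "g \<in> L2"
  shows "sine_coeff (\<lambda>x. f x - g x) n = sine_coeff f n - sine_coeff g n"
  using sine_coeff_add[OF assms(1) L2_cmult[OF assms(2), of "-1"]] sine_coeff_cmult[of "-1" g]
  by simp

lemma sine_coeff_sin:
  assumes "m \<ge> 1"
  shows "sine_coeff (\<lambda>x. sqrt 2 * sin (real m * pi * x)) n = (if n = m then 1 else 0)"
  unfolding sine_coeff_cmult using LINT_sin_sin[OF assms, of n]
  by (simp add: sine_coeff_def flip: mult.assoc)

section \<open>Density of sine polynomials and Parseval's identity\<close>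

lemma sin_cos_power_expand:
  "\<exists>N c. \<forall>x::real. sin x * cos x ^ i = (\<Sum>n=1..N. c n * sin (real n * x))"
proof (induction i)
  case 0
  show ?case
    by (rule exI[of _ 1], rule exI[of _ "\<lambda>_. 1"]) simp
next
  case (Suc i)
  then obtain N c where c: "\<And>x::real. sin x * cos x ^ i = (\<Sum>n=1..N. c n * sin (real n * x))"
    by blast
  define d where "d n = (if n \<le> N then c n else 0)" for n
  define e where "e n = (if n \<ge> 2 then d (n - 1) else 0) / 2 + d (n + 1) / 2" for n
  have "sin x * cos x ^ Suc i = (\<Sum>n=1..Suc N. e n * sin (real n * x))" for x :: real
  proof -
    have "sin (real n * x) * cos x = (sin (real (Suc n) * x) + sin (real (n - 1) * x)) / 2" if "n \<ge> 1" for n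
    proof -
      have *: "real (Suc n) * x = real n * x + x" "real (n - 1) * x = real n * x - x"
        using that by (simp_all add: of_nat_diff algebra_simps)
      show ?thesis unfolding * by (simp add: sin_add sin_diff)
    qed
    note step = this
    have "sin x * cos x ^ Suc i = (sin x * cos x ^ i) * cos x"
      by simp
    also have "\<dots> = (\<Sum>n=1..N. c n * (sin (real n * x) * cos x))"
      unfolding c by (simp only: sum_distrib_right mult.assoc)
    also have "\<dots> = (\<Sum>n=1..N. c n * ((sin (real (Suc n) * x) + sin (real (n - 1) * x)) / 2))"
      by (intro sum.cong refl arg_cong2[of _ _ _ _ "(*)"] step) auto
    also have "\<dots> = (\<Sum>n=1..N. d n / 2 * sin (real (Suc n) * x)) + (\<Sum>n=1..N. d n / 2 * sin (real (n - 1) * x))"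
      unfolding sum.distrib[symmetric] by (intro sum.cong) (auto simp: d_def field_simps)
    also have "(\<Sum>n=1..N. d n / 2 * sin (real (Suc n) * x)) =
        (\<Sum>n=1..Suc N. (if n \<ge> 2 then d (n - 1) else 0) / 2 * sin (real n * x))"
    proof -
      have "(\<Sum>n=1..Suc N. (if n \<ge> 2 then d (n - 1) else 0) / 2 * sin (real n * x)) =
          (\<Sum>n=2..Suc N. d (n - 1) / 2 * sin (real n * x))"
        by (rule sum.mono_neutral_cong_right) auto
      also have "\<dots> = (\<Sum>n=1..N. d n / 2 * sin (real (Suc n) * x))"
        by (rule sum.reindex_bij_witness[of _ Suc "\<lambda>n. n - 1"]) auto
      finally show ?thesis by simp
    qed
    also have "(\<Sum>n=1..N. d n / 2 * sin (real (n - 1) * x)) = (\<Sum>n=1..Suc N. d (n + 1) / 2 * sin (real n * x))"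
    proof -
      have "(\<Sum>n=1..N. d n / 2 * sin (real (n - 1) * x)) = (\<Sum>n=0..<N. d (n + 1) / 2 * sin (real n * x))"
        by (rule sum.reindex_bij_witness[of _ Suc "\<lambda>n. n - 1"]) auto
      also have "\<dots> = (\<Sum>n=0..Suc N. d (n + 1) / 2 * sin (real n * x))"
        by (rule sum.mono_neutral_left) (auto simp: d_def)
      also have "\<dots> = (\<Sum>n=1..Suc N. d (n + 1) / 2 * sin (real n * x))"
        by (rule sum.mono_neutral_right) (auto simp: not_le)
      finally show ?thesis .
    qed
    finally show ?thesis
      by (simp add: e_def distrib_right flip: sum.distrib)
  qed
  then show ?case by blast
qed

lemma sin_poly_cos_expand:
  assumes "real_polynomial_function (p :: real \<Rightarrow> real)"
  shows "\<exists>N c. \<forall>x. sin x * p (cos x) = (\<Sum>n=1..N. c n * sin (real n * x))"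
proof -
  obtain a M where p: "p = (\<lambda>x. \<Sum>i\<le>M. a i * x ^ i)"
    using assms real_polynomial_function_iff_sum by blast
  obtain N c where c: "\<And>i x. sin x * cos x ^ i = (\<Sum>n=1..N i. c i n * sin (real n * x :: real))"
    using sin_cos_power_expand by metis
  define K where "K = (\<Sum>i\<le>M. N i)"
  have NK: "N i \<le> K" if "i \<le> M" for i
    unfolding K_def using that by (intro member_le_sum) auto
  define d where "d n = (\<Sum>i\<le>M. a i * (if n \<le> N i then c i n else 0))" for n
  have "sin x * p (cos x) = (\<Sum>n=1..K. d n * sin (real n * x))" for x
  proof -
    have "sin x * p (cos x) = (\<Sum>i\<le>M. a i * (\<Sum>n=1..N i. c i n * sin (real n * x)))"
      unfolding c[symmetric] p by (simp add: sum_distrib_left mult.left_commute)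
    also have "\<dots> = (\<Sum>i\<le>M. a i * (\<Sum>n=1..K. (if n \<le> N i then c i n else 0) * sin (real n * x)))"
    proof (rule sum.cong[OF refl])
      fix i assume "i \<in> {..M}"
      then have "(\<Sum>n=1..N i. c i n * sin (real n * x)) =
          (\<Sum>n=1..K. (if n \<le> N i then c i n else 0) * sin (real n * x))"
        using NK[of i] by (intro sum.mono_neutral_cong_left) auto
      then show "a i * (\<Sum>n=1..N i. c i n * sin (real n * x)) =
          a i * (\<Sum>n=1..K. (if n \<le> N i then c i n else 0) * sin (real n * x))" by simp
    qed
    also have "\<dots> = (\<Sum>n=1..K. \<Sum>i\<le>M. a i * (if n \<le> N i then c i n else 0) * sin (real n * x))"
      unfolding sum_distrib_left by (subst sum.swap) (simp add: mult.assoc)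
    finally show ?thesis
      by (simp add: d_def sum_distrib_right)
  qed
  then show ?thesis by blast
qed

text \<open>The substitution t = cos (pi x) turns q into a continuous function on [-1, 1], where
  Weierstrass supplies a polynomial p. The factor sin (pi x) does not enlarge the error and makes
  sin (pi x) * p (cos (pi x)) a finite sum of sines.\<close>

lemma sine_approx_continuous:
  fixes q :: "real \<Rightarrow> real"
  assumes "continuous_on UNIV q" "\<epsilon> > 0"
  obtains N c where "\<And>x. x \<in> {0<..<1} \<Longrightarrow>
    \<bar>sin (pi * x) * q x - (\<Sum>n=1..N. c n * sin (real n * pi * x))\<bar> < \<epsilon>"
proof -
  have "continuous_on {-1..1} (\<lambda>t. q (arccos t / pi))"
    by (intro continuous_on_compose2[OF assms(1)] continuous_intros) auto
  then obtain p where p: "real_polynomial_function p"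
      "\<And>t. t \<in> {-1..1} \<Longrightarrow> \<bar>q (arccos t / pi) - p t\<bar> < \<epsilon>"
    using Stone_Weierstrass_real_polynomial_function[of "{-1..1}" "\<lambda>t. q (arccos t / pi)" \<epsilon>] assms(2)
    by auto
  obtain N c where c: "\<And>x. sin x * p (cos x) = (\<Sum>n=1..N. c n * sin (real n * x))"
    using sin_poly_cos_expand[OF p(1)] by blast
  show thesis
  proof (rule that)
    fix x :: real assume x: "x \<in> {0<..<1}"
    have "arccos (cos (pi * x)) / pi = x"
      using x by (simp add: arccos_cos)
    then have *: "\<bar>q x - p (cos (pi * x))\<bar> < \<epsilon>"
      using p(2)[of "cos (pi * x)"] by simp
    have "\<bar>sin (pi * x) * q x - sin (pi * x) * p (cos (pi * x))\<bar> =
        \<bar>sin (pi * x)\<bar> * \<bar>q x - p (cos (pi * x))\<bar>"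
      by (simp add: abs_mult flip: right_diff_distrib)
    also have "\<dots> \<le> 1 * \<bar>q x - p (cos (pi * x))\<bar>"
      by (intro mult_right_mono) auto
    also have "\<dots> < \<epsilon>" using * by simp
    finally show "\<bar>sin (pi * x) * q x - (\<Sum>n=1..N. c n * sin (real n * pi * x))\<bar> < \<epsilon>"
      using c[of "pi * x"] by (simp add: mult.assoc)
  qed
qed

abbreviation (input) clamp_abs :: "real \<Rightarrow> real \<Rightarrow> real" where
  "clamp_abs k y \<equiv> max (- k) (min k y)"

lemma clamp_abs_le: "k \<ge> 0 \<Longrightarrow> \<bar>clamp_abs k y\<bar> \<le> \<bar>y\<bar>"
  by (auto simp: max_def min_def)

lemma clamp_abs_bound: "k \<ge> 0 \<Longrightarrow> \<bar>clamp_abs k y\<bar> \<le> k"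
  by (auto simp: max_def min_def)

lemma power2_le_4: "\<bar>a\<bar> \<le> B \<Longrightarrow> \<bar>b\<bar> \<le> B \<Longrightarrow> (a - b)\<^sup>2 \<le> (2 * B)\<^sup>2" for a b B :: real
  by (rule power2_le_iff_abs_le[THEN iffD2]) auto

text \<open>Dividing by \<open>sin (\<pi>x)\<close> before truncating makes a cut-off near the end points
  unnecessary.\<close>

lemma L2_approx_sine_times_bounded:
  assumes f: "f \<in> L2" and "\<epsilon> > 0"
  obtains k r where "r \<in> borel_measurable unit_iv" "k \<ge> 0" "\<And>x. \<bar>r x\<bar> \<le> k"
    "(LINT x|unit_iv. (f x - sin (pi * x) * r x)\<^sup>2) < \<epsilon>"
proof -
  define r where "r k x = clamp_abs (real k) (f x / sin (pi * x))" for k x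
  have sin_meas: "(\<lambda>x. sin (pi * x)) \<in> borel_measurable unit_iv"
    by (intro continuous_measurable_unit_iv continuous_intros)
  have f_meas: "f \<in> borel_measurable unit_iv" and f_int: "integrable unit_iv (\<lambda>x. (f x)\<^sup>2)"
    using f by (auto simp: L2_def)
  have r_meas: "r k \<in> borel_measurable unit_iv" for k
    unfolding r_def using sin_meas f_meas by measurable
  have "(\<lambda>k. LINT x|unit_iv. (f x - sin (pi * x) * r k x)\<^sup>2) \<longlonglongrightarrow> (LINT x|unit_iv. 0)"
  proof (rule integral_dominated_convergence[where w = "\<lambda>x. 4 * (f x)\<^sup>2"])
    show "(\<lambda>x. (f x - sin (pi * x) * r k x)\<^sup>2) \<in> borel_measurable unit_iv" for k
      using sin_meas f_meas r_meas[of k] by measurable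
    show "integrable unit_iv (\<lambda>x. 4 * (f x)\<^sup>2)"
      using f_int by simp
    show "AE x in unit_iv. (\<lambda>k. (f x - sin (pi * x) * r k x)\<^sup>2) \<longlonglongrightarrow> 0"
    proof (rule AE_I2)
      fix x assume "x \<in> space unit_iv"
      then have "sin (pi * x) > 0"
        by (intro sin_gt_zero) auto
      have "\<forall>\<^sub>F k in sequentially. \<bar>f x / sin (pi * x)\<bar> \<le> real k"
        using filterlim_real_sequentially unfolding filterlim_at_top by blast
      then have "\<forall>\<^sub>F k in sequentially. (f x - sin (pi * x) * r k x)\<^sup>2 = 0"
      proof eventually_elim
        case (elim k)
        then have "r k x = f x / sin (pi * x)"
          unfolding r_def by linarith
        with \<open>sin (pi * x) > 0\<close> show ?case by simp
      qed
      then show "(\<lambda>k. (f x - sin (pi * x) * r k x)\<^sup>2) \<longlonglongrightarrow> 0"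
        by (rule tendsto_eventually)
    qed
    show "AE x in unit_iv. norm ((f x - sin (pi * x) * r k x)\<^sup>2) \<le> 4 * (f x)\<^sup>2" for k
    proof (rule AE_I2)
      fix x assume "x \<in> space unit_iv"
      then have pos: "sin (pi * x) > 0"
        by (intro sin_gt_zero) auto
      have "\<bar>sin (pi * x) * r k x\<bar> = sin (pi * x) * \<bar>r k x\<bar>"
        using pos by (simp add: abs_mult)
      also have "\<dots> \<le> sin (pi * x) * \<bar>f x / sin (pi * x)\<bar>"
        unfolding r_def using pos by (intro mult_left_mono clamp_abs_le) auto
      also have "\<dots> = \<bar>f x\<bar>" using pos by (simp add: abs_divide)
      finally show "norm ((f x - sin (pi * x) * r k x)\<^sup>2) \<le> 4 * (f x)\<^sup>2"
        using power2_le_4[of "f x" "\<bar>f x\<bar>" "sin (pi * x) * r k x"] by (simp add: power_mult_distrib)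
    qed
  qed simp
  then have "\<forall>\<^sub>F k in sequentially. (LINT x|unit_iv. (f x - sin (pi * x) * r k x)\<^sup>2) < \<epsilon>"
    using \<open>\<epsilon> > 0\<close> by (simp add: order_tendstoD)
  then obtain k where k: "(LINT x|unit_iv. (f x - sin (pi * x) * r k x)\<^sup>2) < \<epsilon>"
    by (auto simp: eventually_sequentially)
  show thesis
    by (rule that[OF r_meas[of k] _ _ k, of "real k"]) (auto simp: r_def)
qed

lemma bounded_approx_continuous:
  assumes r: "r \<in> borel_measurable unit_iv" and k: "k \<ge> 0" "\<And>x. \<bar>r x\<bar> \<le> k" and "\<epsilon> > 0"
  obtains q where "continuous_on UNIV q"
    "(LINT x|unit_iv. (sin (pi * x) * r x - sin (pi * x) * q x)\<^sup>2) < \<epsilon>"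
proof -
  \<comment> \<open>\<open>measurable_on\<close> supplies continuous functions converging to r off a
    null set. Clamping them to [-k, k] keeps continuity and the limit, and provides the constant
    majorant for dominated convergence.\<close>
  have "r measurable_on {0<..<1}"
    using r by (subst measurable_on_iff_borel_measurable) auto
  then obtain Z g where Z: "negligible Z" and g: "\<And>n. continuous_on UNIV (g n)"
    and lim: "\<And>x. x \<notin> Z \<Longrightarrow> (\<lambda>n. g n x) \<longlonglongrightarrow> (if x \<in> {0<..<1} then r x else 0)"
    unfolding measurable_on_def by metis
  define q where "q n x = clamp_abs k (g n x)" for n x
  have q: "continuous_on UNIV (q n)" for n
    unfolding q_def by (intro continuous_intros g)
  have sin_meas: "(\<lambda>x. sin (pi * x)) \<in> borel_measurable unit_iv"
    by (intro continuous_measurable_unit_iv continuous_intros)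
  have "(\<lambda>n. LINT x|unit_iv. (sin (pi * x) * r x - sin (pi * x) * q n x)\<^sup>2) \<longlonglongrightarrow> (LINT x|unit_iv. 0)"
  proof (rule integral_dominated_convergence[where w = "\<lambda>x. (2 * k)\<^sup>2"])
    show "(\<lambda>x. (sin (pi * x) * r x - sin (pi * x) * q n x)\<^sup>2) \<in> borel_measurable unit_iv" for n
      using sin_meas r continuous_measurable_unit_iv[OF q[of n]] by measurable
    show "integrable unit_iv (\<lambda>x. (2 * k)\<^sup>2)"
      by (rule integrable_bounded_unit_iv[where B = "(2 * k)\<^sup>2"]) auto
    have "AE x in lebesgue. x \<notin> Z"
      using Z by (simp add: negligible_iff_null_sets AE_not_in)
    then have "AE x in unit_iv. x \<notin> Z"
      by (subst AE_restrict_space_iff) (auto elim: eventually_mono)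
    then show "AE x in unit_iv. (\<lambda>n. (sin (pi * x) * r x - sin (pi * x) * q n x)\<^sup>2) \<longlonglongrightarrow> 0"
    proof (rule AE_mp, intro AE_I2 impI)
      fix x assume x: "x \<in> space unit_iv" "x \<notin> Z"
      then have "(\<lambda>n. g n x) \<longlonglongrightarrow> r x"
        using lim[of x] by auto
      then have "(\<lambda>n. q n x) \<longlonglongrightarrow> clamp_abs k (r x)"
        unfolding q_def by (intro tendsto_intros)
      moreover have "clamp_abs k (r x) = r x"
        using k(2)[of x] by linarith
      ultimately have "(\<lambda>n. q n x) \<longlonglongrightarrow> r x" by simp
      then have "(\<lambda>n. (sin (pi * x) * r x - sin (pi * x) * q n x)\<^sup>2) \<longlonglongrightarrow>
          (sin (pi * x) * r x - sin (pi * x) * r x)\<^sup>2"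
        by (intro tendsto_intros)
      then show "(\<lambda>n. (sin (pi * x) * r x - sin (pi * x) * q n x)\<^sup>2) \<longlonglongrightarrow> 0" by simp
    qed
    show "AE x in unit_iv. norm ((sin (pi * x) * r x - sin (pi * x) * q n x)\<^sup>2) \<le> (2 * k)\<^sup>2" for n
    proof (rule AE_I2)
      fix x
      have *: "\<bar>sin (pi * x) * y\<bar> \<le> k" if "\<bar>y\<bar> \<le> k" for y
        using mult_mono[of "\<bar>sin (pi * x)\<bar>" 1 "\<bar>y\<bar>" k] that by (simp add: abs_mult)
      show "norm ((sin (pi * x) * r x - sin (pi * x) * q n x)\<^sup>2) \<le> (2 * k)\<^sup>2"
        using power2_le_4[OF *[OF k(2)] *[of "q n x"]] clamp_abs_bound[OF k(1)]
        by (simp add: q_def)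
    qed
  qed simp
  then have "\<forall>\<^sub>F n in sequentially. (LINT x|unit_iv. (sin (pi * x) * r x - sin (pi * x) * q n x)\<^sup>2) < \<epsilon>"
    using \<open>\<epsilon> > 0\<close> by (simp add: order_tendstoD)
  then obtain n where "(LINT x|unit_iv. (sin (pi * x) * r x - sin (pi * x) * q n x)\<^sup>2) < \<epsilon>"
    by (auto simp: eventually_sequentially)
  with q show thesis by (rule that)
qed

lemma L2_dist_triangle:
  assumes "f \<in> L2" "g \<in> L2" "h \<in> L2"
  shows "(LINT x|unit_iv. (f x - h x)\<^sup>2) \<le>
    2 * (LINT x|unit_iv. (f x - g x)\<^sup>2) + 2 * (LINT x|unit_iv. (g x - h x)\<^sup>2)"
proof -
  have int: "integrable unit_iv (\<lambda>x. (u x - v x)\<^sup>2)" if "u \<in> L2" "v \<in> L2" for u v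
    using L2_diff[OF that] by (simp add: L2_def)
  have "(LINT x|unit_iv. (f x - h x)\<^sup>2) \<le> (LINT x|unit_iv. 2 * (f x - g x)\<^sup>2 + 2 * (g x - h x)\<^sup>2)"
  proof (rule integral_mono)
    fix x
    have "0 \<le> ((f x - g x) - (g x - h x))\<^sup>2" by simp
    then show "(f x - h x)\<^sup>2 \<le> 2 * (f x - g x)\<^sup>2 + 2 * (g x - h x)\<^sup>2"
      by (simp add: power2_eq_square algebra_simps)
  qed (use int assms in auto)
  also have "\<dots> = 2 * (LINT x|unit_iv. (f x - g x)\<^sup>2) + 2 * (LINT x|unit_iv. (g x - h x)\<^sup>2)"
    using int assms by simp
  finally show ?thesis .
qed

lemma sine_polynomials_dense:
  assumes f: "f \<in> L2" and "\<epsilon> > 0"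
  obtains N c where "(LINT x|unit_iv. (f x - (\<Sum>n=1..N. c n * (sqrt 2 * sin (real n * pi * x))))\<^sup>2) < \<epsilon>"
proof -
  \<comment> \<open>Squared distances obey the triangle inequality with a factor 2. Used twice, it
    gives 2 * \<epsilon>/8 + 4 * \<epsilon>/16 + 4 * \<epsilon>/16 = 3\<epsilon>/4.\<close>
  have e8: "\<epsilon> / 8 > 0" and e16: "\<epsilon> / 16 > 0" and e16': "sqrt (\<epsilon> / 16) > 0"
    using \<open>\<epsilon> > 0\<close> by auto
  obtain k r where r: "r \<in> borel_measurable unit_iv" "k \<ge> 0" "\<And>x. \<bar>r x\<bar> \<le> k"
    "(LINT x|unit_iv. (f x - sin (pi * x) * r x)\<^sup>2) < \<epsilon> / 8"
    by (rule L2_approx_sine_times_bounded[OF f e8]) blast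
  obtain q where q: "continuous_on UNIV q"
    "(LINT x|unit_iv. (sin (pi * x) * r x - sin (pi * x) * q x)\<^sup>2) < \<epsilon> / 16"
    by (rule bounded_approx_continuous[OF r(1-3) e16])
  obtain N c where c: "\<And>x. x \<in> {0<..<1} \<Longrightarrow>
      \<bar>sin (pi * x) * q x - (\<Sum>n=1..N. c n * sin (real n * pi * x))\<bar> < sqrt (\<epsilon> / 16)"
    by (rule sine_approx_continuous[OF q(1) e16']) blast
  let ?p = "\<lambda>x. \<Sum>n=1..N. c n * sin (real n * pi * x)"
  have sin_meas: "(\<lambda>x. sin (pi * x)) \<in> borel_measurable unit_iv"
    by (intro continuous_measurable_unit_iv continuous_intros)
  have r_L2: "(\<lambda>x. sin (pi * x) * r x) \<in> L2"
  proof (rule L2_bounded[where B = k])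
    show "(\<lambda>x. sin (pi * x) * r x) \<in> borel_measurable unit_iv"
      using sin_meas r(1) by measurable
    show "\<bar>sin (pi * x) * r x\<bar> \<le> k" for x
      using mult_mono[of "\<bar>sin (pi * x)\<bar>" 1 "\<bar>r x\<bar>" k] r(3)[of x] by (simp add: abs_mult)
  qed
  have qs: "continuous_on UNIV (\<lambda>x. sin (pi * x) * q x)"
    by (intro continuous_intros q)
  obtain B where "\<forall>x\<in>{0..1}. \<bar>sin (pi * x) * q x\<bar> \<le> B"
    using compact_imp_bounded[OF compact_continuous_image[OF continuous_on_subset[OF qs], of "{0..1}"]]
    by (auto simp: bounded_iff)
  then have q_L2: "(\<lambda>x. sin (pi * x) * q x) \<in> L2"
    by (intro L2_bounded[where B = B] continuous_measurable_unit_iv qs) auto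
  have p_L2: "?p \<in> L2"
    by (intro L2_sum L2_cmult L2_sin)
  have "(LINT x|unit_iv. (sin (pi * x) * q x - ?p x)\<^sup>2) \<le> (LINT x|unit_iv. \<epsilon> / 16)"
  proof (rule integral_mono)
    show "integrable unit_iv (\<lambda>x. (sin (pi * x) * q x - ?p x)\<^sup>2)"
      using L2_diff[OF q_L2 p_L2] by (simp add: L2_def)
    show "integrable unit_iv (\<lambda>x. \<epsilon> / 16)"
      by (rule integrable_bounded_unit_iv[where B = "\<epsilon> / 16"]) (use \<open>\<epsilon> > 0\<close> in auto)
    show "(sin (pi * x) * q x - ?p x)\<^sup>2 \<le> \<epsilon> / 16" if "x \<in> space unit_iv" for x
    proof -
      have "x \<in> {0<..<1}" using that by simp
      then have "\<bar>sin (pi * x) * q x - ?p x\<bar> \<le> sqrt (\<epsilon> / 16)"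
        using c by (simp add: less_imp_le)
      then have "\<bar>sin (pi * x) * q x - ?p x\<bar>\<^sup>2 \<le> sqrt (\<epsilon> / 16) ^ 2"
        by (intro power_mono) auto
      then show ?thesis using \<open>\<epsilon> > 0\<close> by simp
    qed
  qed
  also have "(LINT x|unit_iv. \<epsilon> / 16) = \<epsilon> / 16"
    using LINT_unit_iv_continuous[of "\<lambda>_. \<epsilon> / 16"] by simp
  finally have "(LINT x|unit_iv. (sin (pi * x) * q x - ?p x)\<^sup>2) \<le> \<epsilon> / 16" .
  then have "(LINT x|unit_iv. (f x - ?p x)\<^sup>2) < \<epsilon>"
  proof -
    assume p: "(LINT x|unit_iv. (sin (pi * x) * q x - ?p x)\<^sup>2) \<le> \<epsilon> / 16"
    define d where "d u v = (LINT x|unit_iv. (u x - v x)\<^sup>2)" for u v :: "real \<Rightarrow> real"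
    have "d f (\<lambda>x. sin (pi * x) * r x) < \<epsilon> / 8"
      "d (\<lambda>x. sin (pi * x) * r x) (\<lambda>x. sin (pi * x) * q x) < \<epsilon> / 16"
      "d (\<lambda>x. sin (pi * x) * q x) ?p \<le> \<epsilon> / 16"
      unfolding d_def using r(4) q(2) p by auto
    moreover have "d f ?p \<le> 2 * d f (\<lambda>x. sin (pi * x) * r x) + 2 * d (\<lambda>x. sin (pi * x) * r x) ?p"
      "d (\<lambda>x. sin (pi * x) * r x) ?p \<le> 2 * d (\<lambda>x. sin (pi * x) * r x) (\<lambda>x. sin (pi * x) * q x) +
        2 * d (\<lambda>x. sin (pi * x) * q x) ?p"
      unfolding d_def
      by (rule L2_dist_triangle[OF f r_L2 p_L2], rule L2_dist_triangle[OF r_L2 q_L2 p_L2])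
    ultimately have "d f ?p < \<epsilon>"
      using \<open>\<epsilon> > 0\<close> by linarith
    then show ?thesis by (simp add: d_def)
  qed
  then show thesis
    by (intro that[of "\<lambda>n. c n / sqrt 2" N]) simp
qed

text \<open>By orthonormality, the squared distance of f to a sine polynomial is I - P N plus the
  squared errors of its coefficients. With the exact coefficients this gives Bessel's inequality;
  for an approximating polynomial it bounds I - P N by the approximation error.\<close>

lemma sine_parseval:
  assumes f: "f \<in> L2"
  shows "(\<lambda>n. (sine_coeff f n)\<^sup>2) sums (LINT x|unit_iv. (f x)\<^sup>2)"
proof -
  define e where "e n x = sqrt 2 * sin (real n * pi * x)" for n x
  have e_L2: "e n \<in> L2" for n
    unfolding e_def by (intro L2_cmult L2_sin)
  define I where "I = (LINT x|unit_iv. (f x)\<^sup>2)"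
  define P where "P N = (\<Sum>n=1..N. (sine_coeff f n)\<^sup>2)" for N
  have fe: "(LINT x|unit_iv. f x * e n x) = sine_coeff f n" for n
  proof -
    have "(LINT x|unit_iv. f x * e n x) = (LINT x|unit_iv. sqrt 2 * (f x * sin (real n * pi * x)))"
      by (simp add: e_def mult.left_commute)
    then show ?thesis by (simp add: sine_coeff_def)
  qed
  have ee: "(LINT x|unit_iv. e m x * e n x) = (if n = m then 1 else 0)" if "m \<ge> 1" for m n
  proof -
    have "(LINT x|unit_iv. e m x * e n x) =
        (LINT x|unit_iv. sqrt 2 * (sqrt 2 * sin (real m * pi * x) * sin (real n * pi * x)))"
      by (simp add: e_def algebra_simps)
    also have "\<dots> = sine_coeff (\<lambda>x. sqrt 2 * sin (real m * pi * x)) n"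
      unfolding sine_coeff_def by (rule integral_mult_right_zero)
    finally show ?thesis by (simp only: sine_coeff_sin[OF that])
  qed
  have expand: "(LINT x|unit_iv. (f x - (\<Sum>n=1..N. c n * e n x))\<^sup>2) =
      I - P N + (\<Sum>n=1..N. (c n - sine_coeff f n)\<^sup>2)" for N c
  proof -
    let ?p = "\<lambda>x. \<Sum>n=1..N. c n * e n x"
    have p_L2: "?p \<in> L2" by (intro L2_sum L2_cmult e_L2)
    have "(LINT x|unit_iv. (f x - ?p x)\<^sup>2) =
        (LINT x|unit_iv. (f x)\<^sup>2 - 2 * (f x * ?p x) + ?p x * ?p x)"
      by (simp add: power2_eq_square algebra_simps)
    also have "\<dots> = I - 2 * (LINT x|unit_iv. f x * ?p x) + (LINT x|unit_iv. ?p x * ?p x)"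
      unfolding I_def
      using f L2_integrable_mult[OF f p_L2] L2_integrable_mult[OF p_L2 p_L2] by (simp add: L2_def)
    also have "(LINT x|unit_iv. f x * ?p x) = (\<Sum>n=1..N. c n * sine_coeff f n)"
      using L2_integrable_mult[OF f e_L2]
      by (simp add: sum_distrib_left mult.left_commute Bochner_Integration.integral_sum fe)
    also have "(LINT x|unit_iv. ?p x * ?p x) = (\<Sum>n=1..N. (c n)\<^sup>2)"
    proof -
      have "(LINT x|unit_iv. ?p x * ?p x) =
          (LINT x|unit_iv. (\<Sum>m=1..N. \<Sum>n=1..N. c m * c n * (e m x * e n x)))"
        by (simp add: sum_product algebra_simps)
      also have "\<dots> = (\<Sum>m=1..N. \<Sum>n=1..N. c m * c n * (LINT x|unit_iv. e m x * e n x))"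
        by (simp add: Bochner_Integration.integral_sum L2_integrable_mult e_L2)
      also have "\<dots> = (\<Sum>m=1..N. \<Sum>n=1..N. if n = m then c m * c n else 0)"
        using ee by (intro sum.cong) auto
      also have "\<dots> = (\<Sum>n=1..N. (c n)\<^sup>2)"
        by (auto simp: sum.delta power2_eq_square intro!: sum.cong)
      finally show ?thesis .
    qed
    finally show ?thesis
      unfolding P_def by (simp add: power2_diff sum.distrib sum_subtractf sum_distrib_left algebra_simps)
  qed
  have upper: "P N \<le> I" for N
  proof -
    have "0 \<le> (LINT x|unit_iv. (f x - (\<Sum>n=1..N. sine_coeff f n * e n x))\<^sup>2)"
      by simp
    also have "\<dots> = I - P N"
      unfolding expand by simp
    finally show ?thesis by simp
  qed
  have mono: "P M \<le> P N" if "M \<le> N" for M N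
    unfolding P_def using that by (intro sum_mono2) auto
  have "P \<longlonglongrightarrow> I"
  proof (rule LIMSEQ_I)
    fix \<epsilon> :: real assume "\<epsilon> > 0"
    then obtain N c where *: "(LINT x|unit_iv. (f x - (\<Sum>n=1..N. c n * e n x))\<^sup>2) < \<epsilon>"
      unfolding e_def using sine_polynomials_dense[OF f] by blast
    have "I - P N < \<epsilon>"
      using * expand[where N = N and c = c] sum_nonneg[of "{1..N}" "\<lambda>n. (c n - sine_coeff f n)\<^sup>2"] by simp
    then have "\<forall>n\<ge>N. norm (P n - I) < \<epsilon>"
    proof (intro allI impI)
      fix n assume "N \<le> n"
      then have "P N \<le> P n" by (rule mono)
      with \<open>I - P N < \<epsilon>\<close> upper[of n] show "norm (P n - I) < \<epsilon>" by simp
    qed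
    then show "\<exists>N. \<forall>n\<ge>N. norm (P n - I) < \<epsilon>" by blast
  qed
  moreover have "(\<Sum>n\<le>N. (sine_coeff f n)\<^sup>2) = P N" for N
    unfolding P_def by (rule sum.mono_neutral_right) (auto simp: not_le)
  ultimately show ?thesis
    by (simp add: sums_def_le I_def)
qed

section \<open>Dilations and sine coefficients\<close>

lemma odd_ext_unit: "x \<in> {0<..<1} \<Longrightarrow> odd_ext \<phi> x = \<phi> x"
proof -
  assume "x \<in> {0<..<1}"
  moreover from this have "\<lfloor>x / 2\<rfloor> = 0" by (simp add: floor_eq_iff)
  ultimately show ?thesis by (simp add: odd_ext_def)
qed

lemma odd_ext_periodic: "odd_ext \<phi> (x + 2 * real n) = odd_ext \<phi> x"
proof -
  have "\<lfloor>(x + 2 * real n) / 2\<rfloor> = \<lfloor>x / 2\<rfloor> + int n"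
    by (simp add: floor_eq_iff field_simps) linarith
  then show ?thesis by (simp add: odd_ext_def)
qed

lemma odd_ext_odd: "odd_ext \<phi> (- x) = - odd_ext \<phi> x"
proof (cases "x / 2 \<in> \<int>")
  case True
  then obtain j where "x = 2 * of_int j"
    by (metis Ints_cases nonzero_eq_divide_eq mult.commute zero_neq_numeral)
  then have "x / 2 = of_int j" "- x / 2 = of_int (- j)" by simp_all
  then show ?thesis
    by (simp only: odd_ext_def floor_of_int) (use \<open>x = _\<close> in simp)
next
  case False
  have "\<lfloor>- (x / 2)\<rfloor> = - \<lfloor>x / 2\<rfloor> - 1"
  proof -
    have "x / 2 \<noteq> of_int \<lfloor>x / 2\<rfloor>"
      using False Ints_of_int by metis
    then have "\<lceil>x / 2\<rceil> = \<lfloor>x / 2\<rfloor> + 1"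
      by (metis ceiling_altdef)
    then show ?thesis by (simp add: ceiling_def)
  qed
  then have *: "\<lfloor>- x / 2\<rfloor> = - \<lfloor>x / 2\<rfloor> - 1" by simp
  define y where "y = x - 2 * of_int \<lfloor>x / 2\<rfloor>"
  have y': "- x - 2 * of_int \<lfloor>- x / 2\<rfloor> = 2 - y"
    unfolding * y_def by simp
  show ?thesis
    unfolding odd_ext_def y' y_def[symmetric] Let_def by auto
qed

lemma odd_ext_measurable:
  assumes [measurable]: "\<phi> \<in> borel_measurable borel"
  shows "odd_ext \<phi> \<in> borel_measurable borel"
  unfolding odd_ext_def Let_def by measurable

lemma odd_ext_bounded:
  assumes "\<And>x. \<bar>\<phi> x\<bar> \<le> B"
  shows "\<bar>odd_ext \<phi> x\<bar> \<le> B"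
  using assms order_trans[OF abs_ge_zero assms] by (auto simp: odd_ext_def Let_def)

text \<open>A geometric sum over a k-th root of unity, which is 1 exactly if k divides m. The shifts
  are those of the argument m pi y / k when y moves through k periods of length 2.\<close>

lemma sum_sin_shift:
  assumes "k \<ge> 1"
  shows "(\<Sum>j<k. sin (\<theta> + 2 * pi * real m * real j / real k)) = (if k dvd m then real k * sin \<theta> else 0)"
proof -
  define z where "z = cis (2 * pi * real m / real k)"
  have zk: "z ^ k = 1"
  proof -
    have "z ^ k = cis (2 * pi * real m)"
    proof -
      have "real k * (2 * pi * real m / real k) = 2 * pi * real m"
        using assms by simp
      then show ?thesis by (simp only: z_def Complex.DeMoivre)
    qed
    also have "\<dots> = 1" by (metis cis_multiple_2pi Ints_of_nat)
    finally show ?thesis .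
  qed
  have sum: "(\<Sum>j<k. sin (\<theta> + 2 * pi * real m * real j / real k)) = Im (cis \<theta> * (\<Sum>j<k. z ^ j))"
  proof -
    have "sin (\<theta> + 2 * pi * real m * real j / real k) = Im (cis \<theta> * z ^ j)" for j
      by (simp add: z_def Complex.DeMoivre cis_mult algebra_simps)
    then show ?thesis by (simp add: sum_distrib_left)
  qed
  show ?thesis
  proof (cases "k dvd m")
    case True
    then obtain d where "m = k * d" by blast
    then have "z = 1"
      using assms cis_multiple_2pi[of "real d"] by (simp add: z_def mult.assoc)
    then show ?thesis using sum True by simp
  next
    case False
    have "z \<noteq> 1"
    proof
      assume "z = 1"
      then have "cos (2 * pi * real m / real k) = 1"
        unfolding z_def by (metis cis.simps(1) one_complex.simps(1))
      then obtain i :: int where "2 * pi * real m / real k = of_int i * 2 * pi"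
        using cos_one_2pi_int by blast
      then have "real m = of_int i * real k" using assms by (simp add: field_simps)
      then have "int m = i * int k" by (metis of_int_eq_iff of_int_mult of_int_of_nat_eq)
      then have "int k dvd int m" by simp
      then show False using False by simp
    qed
    then have "(\<Sum>j<k. z ^ j) = 0" using zk by (simp add: sum_gp_strict)
    then show ?thesis using sum False by simp
  qed
qed

section \<open>Integrals over several periods and the coefficients of a dilation\<close>

lemma LINT_unit_iv_lborel:
  fixes g :: "real \<Rightarrow> real"
  assumes [measurable]: "g \<in> borel_measurable borel"
  shows "(LINT x|unit_iv. g x) = (LINT x|lborel. indicator {0..<1} x * g x)"
proof -
  have "(LINT x|unit_iv. g x) = (LINT x|lebesgue. indicator {0<..<1} x * g x)"
    by (subst integral_restrict_space) auto
  also have "\<dots> = (LINT x|lborel. indicator {0<..<1} x * g x)"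
    by (rule integral_completion) measurable
  also have "\<dots> = (LINT x|lborel. indicator {0..<1} x * g x)"
  proof (rule integral_cong_AE)
    have "AE x in lborel. x \<noteq> (0::real)" by (rule AE_lborel_singleton)
    then show "AE x in lborel. indicator {0<..<1} x * g x = indicator {0..<1} x * g x"
      by (rule AE_mp) (auto simp: indicator_def)
  qed measurable
  finally show ?thesis .
qed

lemma integrable_lborel_bounded:
  fixes g :: "real \<Rightarrow> real"
  assumes [measurable]: "g \<in> borel_measurable borel" and B: "\<And>x. \<bar>g x\<bar> \<le> B"
  shows "integrable lborel (\<lambda>x. indicator {a..<b} x * g x)"
proof (rule Bochner_Integration.integrable_bound[where f = "\<lambda>x. B * indicator {a..<b} x"])
  show "integrable lborel (\<lambda>x. B * indicator {a..<b} x)"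
    by (cases "a \<le> b") auto
  show "AE x in lborel. norm (indicator {a..<b} x * g x) \<le> norm (B * indicator {a..<b} x)"
    using B by (auto simp: indicator_def intro!: order_trans[OF B])
qed measurable

lemma LINT_reflect_half:
  fixes g :: "real \<Rightarrow> real"
  assumes [measurable]: "g \<in> borel_measurable borel" and B: "\<And>x. \<bar>g x\<bar> \<le> B"
    and sym: "\<And>x. g (2 - x) = g x"
  shows "(LINT x|lborel. indicator {0..<2} x * g x) = 2 * (LINT x|lborel. indicator {0..<1} x * g x)"
proof -
  have "(LINT x|lborel. indicator {0..<2} x * g x) =
      (LINT x|lborel. indicator {0..<1} x * g x + indicator {1..<2} x * g x)"
    by (rule Bochner_Integration.integral_cong) (auto simp: indicator_def)
  also have "\<dots> = (LINT x|lborel. indicator {0..<1} x * g x) + (LINT x|lborel. indicator {1..<2} x * g x)"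
    by (intro Bochner_Integration.integral_add integrable_lborel_bounded[OF assms(1) B])
  also have "(LINT x|lborel. indicator {1..<2} x * g x) =
      (LINT x|lborel. indicator {1..<2} (2 + (-1) * x) * g (2 + (-1) * x))"
    by (subst lborel_integral_real_affine[where c = "-1" and t = 2]) auto
  also have "\<dots> = (LINT x|lborel. indicator {0..<1} x * g x)"
  proof (rule integral_cong_AE)
    have "AE x in lborel. x \<noteq> (0::real) \<and> x \<noteq> 1"
      using AE_lborel_singleton[of "0::real"] AE_lborel_singleton[of "1::real"] by eventually_elim auto
    then show "AE x in lborel. indicator {1..<2} (2 + (-1) * x) * g (2 + (-1) * x) = indicator {0..<1} x * g x"
      by (rule AE_mp) (auto simp: indicator_def sym)
  qed measurable
  finally show ?thesis by simp
qed

lemma LINT_period_split: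
  fixes g :: "real \<Rightarrow> real"
  assumes [measurable]: "g \<in> borel_measurable borel" and B: "\<And>x. \<bar>g x\<bar> \<le> B"
  shows "(LINT x|lborel. indicator {0..<2 * real k} x * g x) =
    (\<Sum>j<k. LINT x|lborel. indicator {0..<2} x * g (x + 2 * real j))"
proof (induction k)
  case (Suc k)
  have "(LINT x|lborel. indicator {0..<2 * real (Suc k)} x * g x) =
      (LINT x|lborel. indicator {0..<2 * real k} x * g x + indicator {2 * real k..<2 * real (Suc k)} x * g x)"
    by (rule Bochner_Integration.integral_cong) (auto simp: indicator_def)
  also have "\<dots> = (LINT x|lborel. indicator {0..<2 * real k} x * g x) +
      (LINT x|lborel. indicator {2 * real k..<2 * real (Suc k)} x * g x)"
    by (intro Bochner_Integration.integral_add integrable_lborel_bounded[OF assms(1) B])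
  also have "(LINT x|lborel. indicator {2 * real k..<2 * real (Suc k)} x * g x) =
     (LINT x|lborel. indicator {2 * real k..<2 * real (Suc k)} (2 * real k + 1 * x) * g (2 * real k + 1 * x))"
    by (subst lborel_integral_real_affine[where c = 1 and t = "2 * real k"]) auto
  also have "\<dots> = (LINT x|lborel. indicator {0..<2} x * g (x + 2 * real k))"
    by (rule Bochner_Integration.integral_cong) (auto simp: indicator_def add.commute)
  finally show ?case using Suc by simp
qed simp

text \<open>On formal Dirichlet series with coefficients a, this is multiplication by k^-s.\<close>

definition dil :: "nat \<Rightarrow> (nat \<Rightarrow> 'a::zero) \<Rightarrow> nat \<Rightarrow> 'a" where
  "dil k a m = (if k dvd m then a (m div k) else 0)"

text \<open>The integrand is symmetric about 1, so the integral over (0, 1) is half of that over a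
  full period. The substitution y = k x spreads it over k periods; folding them back onto one leaves
  the sum of shifted sines, which vanishes unless k divides m.\<close>

lemma sine_coeff_dilation:
  assumes [measurable]: "\<phi> \<in> borel_measurable borel" and B: "\<And>x. \<bar>\<phi> x\<bar> \<le> B" and k: "k \<ge> 1"
  shows "sine_coeff (\<lambda>x. odd_ext \<phi> (real k * x)) m = dil k (sine_coeff \<phi>) m"
proof -
  let ?\<psi> = "odd_ext \<phi>"
  have [measurable]: "?\<psi> \<in> borel_measurable borel"
    by (rule odd_ext_measurable) measurable
  have bound: "\<bar>?\<psi> y * sin z\<bar> \<le> B" for y z
  proof -
    have "B \<ge> 0" using B[of 0] by linarith
    then show ?thesis
      using mult_mono[OF odd_ext_bounded[where \<phi> = \<phi>, OF B, of y] abs_sin_le_one[of z]] by (simp add: abs_mult)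
  qed
  have \<psi>2: "?\<psi> (2 * real n - y) = - ?\<psi> y" for n y
    using odd_ext_periodic[of \<phi> "- y" n] odd_ext_odd[of \<phi> y] by (simp add: algebra_simps)
  have sin2: "sin (real n * pi * (2 - x)) = - sin (real n * pi * x)" for n x
  proof -
    have "real n * pi * (2 - x) = 2 * real n * pi - real n * pi * x"
      by (simp add: algebra_simps)
    then show ?thesis
      by (simp add: sin_diff)
  qed
  have half: "(LINT x|unit_iv. ?\<psi> (real l * x) * sin (real n * pi * x)) =
      (LINT x|lborel. indicator {0..<2} x * (?\<psi> (real l * x) * sin (real n * pi * x))) / 2" for l n
  proof -
    have "?\<psi> (real l * (2 - x)) * sin (real n * pi * (2 - x)) = ?\<psi> (real l * x) * sin (real n * pi * x)" for x
      unfolding sin2 using \<psi>2[of l "real l * x"] by (simp add: algebra_simps)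
    then have "(LINT x|lborel. indicator {0..<2} x * (?\<psi> (real l * x) * sin (real n * pi * x))) =
        2 * (LINT x|lborel. indicator {0..<1} x * (?\<psi> (real l * x) * sin (real n * pi * x)))"
      by (intro LINT_reflect_half[where B = B] bound) measurable
    then show ?thesis by (subst LINT_unit_iv_lborel) auto
  qed
  have "(LINT x|lborel. indicator {0..<2} x * (?\<psi> (real k * x) * sin (real m * pi * x))) =
      (LINT y|lborel. indicator {0..<2 * real k} y * (?\<psi> y * sin (real m * pi * y / real k))) / real k"
  proof -
    have "(LINT y|lborel. indicator {0..<2 * real k} y * (?\<psi> y * sin (real m * pi * y / real k))) =
       real k * (LINT x|lborel. indicator {0..<2 * real k} (0 + real k * x) *
          (?\<psi> (0 + real k * x) * sin (real m * pi * (0 + real k * x) / real k)))"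
      using k by (subst lborel_integral_real_affine[where c = "real k" and t = 0]) auto
    also have "\<dots> = real k * (LINT x|lborel. indicator {0..<2} x * (?\<psi> (real k * x) * sin (real m * pi * x)))"
      using k by (intro arg_cong2[of _ _ _ _ "(*)"] refl Bochner_Integration.integral_cong)
                 (auto simp: indicator_def mult.commute zero_le_mult_iff)
    finally show ?thesis using k by simp
  qed
  also have "(LINT y|lborel. indicator {0..<2 * real k} y * (?\<psi> y * sin (real m * pi * y / real k))) =
      (\<Sum>j<k. LINT y|lborel. indicator {0..<2} y *
        (?\<psi> (y + 2 * real j) * sin (real m * pi * (y + 2 * real j) / real k)))"
    by (rule LINT_period_split[where B = B]) (auto intro: bound)
  also have "\<dots> = (LINT y|lborel. (\<Sum>j<k. indicator {0..<2} y *
        (?\<psi> (y + 2 * real j) * sin (real m * pi * (y + 2 * real j) / real k))))"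
    by (intro Bochner_Integration.integral_sum[symmetric] integrable_lborel_bounded[where B = B] bound)
       measurable
  also have "\<dots> = (LINT y|lborel. real k * (if k dvd m then
      indicator {0..<2} y * (?\<psi> (real 1 * y) * sin (real (m div k) * pi * y)) else 0))"
  proof (rule Bochner_Integration.integral_cong[OF refl])
    fix y :: real
    have "(\<Sum>j<k. indicator {0..<2} y * (?\<psi> (y + 2 * real j) * sin (real m * pi * (y + 2 * real j) / real k))) =
        indicator {0..<2} y * ?\<psi> y * (\<Sum>j<k. sin (real m * pi * y / real k + 2 * pi * real m * real j / real k))"
    proof -
      have "real m * pi * (y + 2 * real j) / real k = real m * pi * y / real k + 2 * pi * real m * real j / real k" for j
        by (simp add: add_divide_distrib algebra_simps)
      then show ?thesis
        unfolding sum_distrib_left odd_ext_periodic by (intro sum.cong refl) (simp only: mult.assoc)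
    qed
    also have "\<dots> = indicator {0..<2} y * ?\<psi> y *
        (if k dvd m then real k * sin (real m * pi * y / real k) else 0)"
      by (simp only: sum_sin_shift[OF k])
    also have "\<dots> = real k * (if k dvd m then
      indicator {0..<2} y * (?\<psi> (real 1 * y) * sin (real (m div k) * pi * y)) else 0)"
      using k by (auto simp: real_of_nat_div)
    finally show "(\<Sum>j<k. indicator {0..<2} y * (?\<psi> (y + 2 * real j) * sin (real m * pi * (y + 2 * real j) / real k))) = \<dots>" .
  qed
  finally have main: "(LINT x|unit_iv. ?\<psi> (real k * x) * sin (real m * pi * x)) =
      (if k dvd m then LINT x|unit_iv. ?\<psi> (real 1 * x) * sin (real (m div k) * pi * x) else 0)"
    unfolding half using k by simp
  also have "(LINT x|unit_iv. ?\<psi> (real 1 * x) * sin (real (m div k) * pi * x)) =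
      (LINT x|unit_iv. \<phi> x * sin (real (m div k) * pi * x))"
    by (rule Bochner_Integration.integral_cong) (auto simp: odd_ext_unit)
  finally show ?thesis
    by (simp add: sine_coeff_def dil_def)
qed

lemma measurable_unit_iv_borel:
  fixes g :: "real \<Rightarrow> real"
  shows "g \<in> borel_measurable borel \<Longrightarrow> g \<in> borel_measurable unit_iv"
  by (intro measurable_restrict_space1 measurable_completion) simp

lemma L2_dilation:
  assumes [measurable]: "\<phi> \<in> borel_measurable borel" and B: "\<And>x. \<bar>\<phi> x\<bar> \<le> B"
  shows "(\<lambda>x. odd_ext \<phi> (real k * x)) \<in> L2"
proof (rule L2_bounded[where B = B])
  have [measurable]: "odd_ext \<phi> \<in> borel_measurable borel"
    by (rule odd_ext_measurable) measurable
  show "(\<lambda>x. odd_ext \<phi> (real k * x)) \<in> borel_measurable unit_iv"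
    by (rule measurable_unit_iv_borel) measurable
qed (rule odd_ext_bounded[OF B])

definition dil_approx :: "(nat \<Rightarrow> real) \<Rightarrow> (nat \<Rightarrow> real) \<Rightarrow> bool" where
  "dil_approx a x \<longleftrightarrow> (\<forall>\<epsilon>>0. \<exists>n c. summable (\<lambda>m. (x m - (\<Sum>k=1..n. c k * dil k a m))\<^sup>2) \<and>
     (\<Sum>m. (x m - (\<Sum>k=1..n. c k * dil k a m))\<^sup>2) < \<epsilon>)"

text \<open>Parseval turns the squared distance in L^2 into the squared distance of coefficient
  sequences, where dilations act by \<open>dil\<close>.\<close>

lemma C_class_iff_dil_approx:
  assumes \<phi>: "\<phi> \<in> borel_measurable borel" and B: "\<And>x. \<bar>\<phi> x\<bar> \<le> B"
  shows "\<phi> \<in> C_class \<longleftrightarrow> (\<forall>f\<in>L2. dil_approx (sine_coeff \<phi>) (sine_coeff f))"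
proof -
  have \<phi>_L2: "\<phi> \<in> L2"
    by (rule L2_bounded[OF measurable_unit_iv_borel[OF \<phi>] B])
  have key: "integrable unit_iv (\<lambda>x. (f x - (\<Sum>k=1..n. c k * odd_ext \<phi> (real k * x)))\<^sup>2) \<and>
      (\<lambda>m. (sine_coeff f m - (\<Sum>k=1..n. c k * dil k (sine_coeff \<phi>) m))\<^sup>2) sums
      (LINT x|unit_iv. (f x - (\<Sum>k=1..n. c k * odd_ext \<phi> (real k * x)))\<^sup>2)"
    if f: "f \<in> L2" for f n and c :: "nat \<Rightarrow> real"
  proof -
    let ?s = "\<lambda>x. \<Sum>k=1..n. c k * odd_ext \<phi> (real k * x)"
    have D: "(\<lambda>x. c k * odd_ext \<phi> (real k * x)) \<in> L2" for k
      by (intro L2_cmult L2_dilation[OF \<phi> B])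
    have s: "?s \<in> L2" by (intro L2_sum D)
    have "sine_coeff (\<lambda>x. f x - ?s x) m = sine_coeff f m - (\<Sum>k=1..n. c k * dil k (sine_coeff \<phi>) m)" for m
    proof -
      have "sine_coeff ?s m = (\<Sum>k=1..n. sine_coeff (\<lambda>x. c k * odd_ext \<phi> (real k * x)) m)"
        by (rule sine_coeff_sum) (rule D)
      also have "\<dots> = (\<Sum>k=1..n. c k * dil k (sine_coeff \<phi>) m)"
        by (intro sum.cong refl) (simp add: sine_coeff_cmult sine_coeff_dilation[OF \<phi> B])
      finally show ?thesis using sine_coeff_diff[OF f s] by simp
    qed
    then show ?thesis
      using sine_parseval[OF L2_diff[OF f s]] L2_diff[OF f s] by (simp add: L2_def)
  qed
  show ?thesis
    unfolding C_class_def dil_approx_def using key \<phi>_L2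
    unfolding sums_iff by simp
qed

lemma C_class_imp_approx_unit:
  assumes "\<phi> \<in> borel_measurable borel" "\<And>x. \<bar>\<phi> x\<bar> \<le> B" "\<phi> \<in> C_class"
  shows "dil_approx (sine_coeff \<phi>) (\<lambda>n. if n = 1 then 1 else 0)"
proof -
  have "sine_coeff (\<lambda>x. sqrt 2 * sin (real 1 * pi * x)) = (\<lambda>n. if n = 1 then 1 else 0)"
    by (rule ext, rule sine_coeff_sin) simp
  moreover have "(\<lambda>x. sqrt 2 * sin (real 1 * pi * x)) \<in> L2"
    by (intro L2_cmult L2_sin)
  ultimately show ?thesis
    using assms C_class_iff_dil_approx[of \<phi> B] by metis
qed

lemma sine_coeff_indicator:
  assumes "0 \<le> \<alpha>" "\<alpha> < \<beta>" "\<beta> \<le> 1" "n \<ge> 1"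
  shows "sine_coeff (indicator {\<alpha><..<\<beta>}) n =
    sqrt 2 / pi * (cos (real n * pi * \<alpha>) - cos (real n * pi * \<beta>)) / real n"
proof -
  let ?s = "\<lambda>x. sin (real n * pi * x)"
  have "((\<lambda>x. ?s x) has_integral
      (- cos (real n * pi * \<beta>) / (real n * pi) - (- cos (real n * pi * \<alpha>) / (real n * pi)))) {\<alpha>..\<beta>}"
  proof (rule fundamental_theorem_of_calculus)
    show "\<alpha> \<le> \<beta>" using assms by simp
    fix x :: real
    have "((\<lambda>x. - cos (real n * pi * x) / (real n * pi)) has_real_derivative ?s x) (at x within {\<alpha>..\<beta>})"
      using assms by (auto intro!: derivative_eq_intros)
    then show "((\<lambda>x. - cos (real n * pi * x) / (real n * pi)) has_vector_derivative ?s x) (at x within {\<alpha>..\<beta>})"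
      by (simp add: has_real_derivative_iff_has_vector_derivative)
  qed
  then have I: "integral {\<alpha>..\<beta>} ?s = (cos (real n * pi * \<alpha>) - cos (real n * pi * \<beta>)) / (real n * pi)"
    by (simp add: integral_unique diff_divide_distrib)
  have "(LINT x|unit_iv. indicator {\<alpha><..<\<beta>} x * ?s x) =
      (LINT x|lebesgue. indicator {0<..<1} x * (indicator {\<alpha><..<\<beta>} x * ?s x))"
    by (subst integral_restrict_space) auto
  also have "\<dots> = (LINT x|lebesgue. indicator {\<alpha><..<\<beta>} x * ?s x)"
    using assms by (intro Bochner_Integration.integral_cong) (auto simp: indicator_def)
  also have "\<dots> = (LINT x|lebesgue_on {\<alpha><..<\<beta>}. ?s x)"
    by (subst integral_restrict_space) auto
  also have "\<dots> = integral {\<alpha><..<\<beta>} ?s"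
  proof (rule lebesgue_integral_eq_integral)
    interpret finite_measure "lebesgue_on {\<alpha><..<\<beta>}"
      by (rule finite_measure_lebesgue_on) auto
    have "continuous_on UNIV ?s" by (intro continuous_intros)
    then have "?s \<in> borel_measurable (lebesgue_on {\<alpha><..<\<beta>})"
      using borel_measurable_continuous_onI
      by (intro measurable_restrict_space1 measurable_completion) simp
    then show "integrable (lebesgue_on {\<alpha><..<\<beta>}) ?s"
      by (intro integrable_const_bound[where B = 1]) auto
  qed auto
  also have "\<dots> = integral {\<alpha>..\<beta>} ?s" by (simp add: integral_open_interval_real)
  finally show ?thesis
    using I by (simp add: sine_coeff_def field_simps)
qed

section \<open>Approximation by dilates in \<open>\<ell>\<^sup>2\<close>\<close>

text \<open>The bound is on the squared distance, hence the factors 2 in the triangle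
  inequality.\<close>

definition l2_near :: "real \<Rightarrow> (nat \<Rightarrow> real) \<Rightarrow> (nat \<Rightarrow> real) \<Rightarrow> bool" where
  "l2_near \<epsilon> x y \<longleftrightarrow> summable (\<lambda>m. (x m - y m)\<^sup>2) \<and> (\<Sum>m. (x m - y m)\<^sup>2) < \<epsilon>"

lemma l2_near_add:
  assumes "l2_near \<epsilon> x y" "l2_near \<delta> u v"
  shows "l2_near (2 * \<epsilon> + 2 * \<delta>) (\<lambda>m. x m + u m) (\<lambda>m. y m + v m)"
proof -
  let ?g = "\<lambda>m. 2 * (x m - y m)\<^sup>2 + 2 * (u m - v m)\<^sup>2"
  have le: "((x m + u m) - (y m + v m))\<^sup>2 \<le> ?g m" for m
  proof -
    have "0 \<le> ((x m - y m) - (u m - v m))\<^sup>2" by simp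
    then show ?thesis by (simp add: power2_eq_square algebra_simps)
  qed
  have g: "summable ?g" "suminf ?g = 2 * (\<Sum>m. (x m - y m)\<^sup>2) + 2 * (\<Sum>m. (u m - v m)\<^sup>2)"
    using assms
    by (auto simp: l2_near_def suminf_mult summable_mult simp flip: suminf_add intro!: summable_add)
  have s: "summable (\<lambda>m. ((x m + u m) - (y m + v m))\<^sup>2)"
    by (rule summable_comparison_test[OF _ g(1)]) (use le in auto)
  moreover have "(\<Sum>m. ((x m + u m) - (y m + v m))\<^sup>2) \<le> suminf ?g"
    by (rule suminf_le[OF le s g(1)])
  ultimately show ?thesis
    using assms g(2) by (auto simp: l2_near_def)
qed

lemma l2_near_trans:
  assumes "l2_near \<epsilon> x y" "l2_near \<delta> y z"
  shows "l2_near (2 * \<epsilon> + 2 * \<delta>) x z"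
  using l2_near_add[OF assms] by (simp add: l2_near_def)

lemma l2_near_pos: "l2_near \<epsilon> x y \<Longrightarrow> \<epsilon> > 0"
  unfolding l2_near_def using suminf_nonneg[of "\<lambda>m. (x m - y m)\<^sup>2"] by auto

text \<open>The factor \<open>c\<^sup>2 + 1\<close>, in place of the square of c alone, keeps the
  bound strict for c = 0.\<close>

lemma l2_near_scale:
  assumes "l2_near \<epsilon> x y"
  shows "l2_near ((c\<^sup>2 + 1) * \<epsilon>) (\<lambda>m. c * x m) (\<lambda>m. c * y m)"
proof -
  have eq: "(c * x m - c * y m)\<^sup>2 = c\<^sup>2 * (x m - y m)\<^sup>2" for m
    by (simp add: power_mult_distrib flip: right_diff_distrib)
  have "c\<^sup>2 * (\<Sum>m. (x m - y m)\<^sup>2) \<le> c\<^sup>2 * \<epsilon>"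
    using assms by (intro mult_left_mono) (auto simp: l2_near_def)
  then show ?thesis
    using assms l2_near_pos[OF assms]
    by (simp add: l2_near_def eq suminf_mult summable_mult algebra_simps)
qed

lemma dil_sums_iff:
  fixes u :: "nat \<Rightarrow> 'a::real_normed_vector"
  assumes "k \<ge> 1"
  shows "dil k u sums s \<longleftrightarrow> u sums s"
proof -
  have "strict_mono (\<lambda>n. k * n)"
    using assms by (auto intro: strict_monoI)
  moreover have "dil k u n = 0" if "n \<notin> range (\<lambda>n. k * n)" for n
    using that by (auto simp: dil_def)
  ultimately have "(\<lambda>n. dil k u (k * n)) sums s \<longleftrightarrow> dil k u sums s"
    by (rule sums_mono_reindex)
  moreover have "(\<lambda>n. dil k u (k * n)) = u"
    using assms by (auto simp: dil_def)
  ultimately show ?thesis by simp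
qed

lemma l2_near_dil:
  assumes "k \<ge> 1" "l2_near \<epsilon> x y"
  shows "l2_near \<epsilon> (dil k x) (dil k y)"
proof -
  have eq: "(\<lambda>m. (dil k x m - dil k y m)\<^sup>2) = dil k (\<lambda>m. (x m - y m)\<^sup>2)"
    by (auto simp: dil_def)
  have "dil k (\<lambda>m. (x m - y m)\<^sup>2) sums (\<Sum>m. (x m - y m)\<^sup>2)"
    using assms by (subst dil_sums_iff) (auto simp: l2_near_def)
  then show ?thesis
    using assms(2) unfolding l2_near_def eq by (simp add: sums_iff)
qed

lemma dil_dil: "j \<ge> 1 \<Longrightarrow> dil j (dil k a) = dil (j * k) a"
proof (rule ext)
  fix m assume j: "j \<ge> 1"
  show "dil j (dil k a) m = dil (j * k) a m"
  proof (cases "j dvd m")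
    case True
    then obtain i where "m = j * i" by blast
    then show ?thesis using j by (simp add: dil_def)
  next
    case False
    then have "\<not> j * k dvd m" by (meson dvd_mult_left)
    with False show ?thesis by (simp add: dil_def)
  qed
qed

lemma dil_diff_scale: "dil k (\<lambda>n. u n - c * v n) n = dil k u n - c * dil k v n" for c :: real
  by (simp add: dil_def)

definition dil_comb :: "(nat \<Rightarrow> real) \<Rightarrow> (nat \<Rightarrow> real) \<Rightarrow> bool" where
  "dil_comb a y \<longleftrightarrow> (\<exists>n c. y = (\<lambda>m. \<Sum>k=1..n. c k * dil k a m))"

lemma dil_approx_iff: "dil_approx a x \<longleftrightarrow> (\<forall>\<epsilon>>0. \<exists>y. dil_comb a y \<and> l2_near \<epsilon> x y)"
proof -
  have "(\<exists>n c. Q (\<lambda>m. \<Sum>k=1..n. c k * dil k a m)) \<longleftrightarrow> (\<exists>y. dil_comb a y \<and> Q y)" for Q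
    unfolding dil_comb_def by blast
  from this[of "l2_near _ x"] show ?thesis
    unfolding dil_approx_def l2_near_def by (simp only:)
qed

lemma dil_comb_pad: "(\<Sum>k=1..n. c k * dil k a m) = (\<Sum>k=1..n+l. (if k \<le> n then c k else 0) * dil k a m)"
  for a :: "nat \<Rightarrow> real"
  by (rule sum.mono_neutral_cong_left) auto

lemma dil_comb_add:
  assumes "dil_comb a y" "dil_comb a z"
  shows "dil_comb a (\<lambda>m. y m + z m)"
proof -
  obtain n c l d where "y = (\<lambda>m. \<Sum>k=1..n. c k * dil k a m)" "z = (\<lambda>m. \<Sum>k=1..l. d k * dil k a m)"
    using assms unfolding dil_comb_def by blast
  then have "(\<lambda>m. y m + z m) = (\<lambda>m. \<Sum>k=1..n+l.
      ((if k \<le> n then c k else 0) + (if k \<le> l then d k else 0)) * dil k a m)"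
    using dil_comb_pad[of c a _ n l] dil_comb_pad[of d a _ l n]
    by (simp add: distrib_right sum.distrib add.commute)
  then show ?thesis unfolding dil_comb_def
    by (intro exI[of _ "n + l"] exI[of _ "\<lambda>k. (if k \<le> n then c k else 0) + (if k \<le> l then d k else 0)"])
qed

lemma dil_comb_scale:
  assumes "dil_comb a y"
  shows "dil_comb a (\<lambda>m. b * y m)"
proof -
  obtain n c where "y = (\<lambda>m. \<Sum>k=1..n. c k * dil k a m)"
    using assms unfolding dil_comb_def by blast
  then have "(\<lambda>m. b * y m) = (\<lambda>m. \<Sum>k=1..n. (b * c k) * dil k a m)"
    by (simp add: sum_distrib_left mult.assoc)
  then show ?thesis unfolding dil_comb_def by (intro exI[of _ n] exI[of _ "\<lambda>k. b * c k"])
qed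

lemma dil_comb_dil:
  assumes "dil_comb a y" "j \<ge> 1"
  shows "dil_comb a (dil j y)"
proof -
  obtain n c where y: "y = (\<lambda>m. \<Sum>k=1..n. c k * dil k a m)"
    using assms unfolding dil_comb_def by blast
  have "dil j y m = (\<Sum>k=1..j*n. (if j dvd k then c (k div j) else 0) * dil k a m)" for m
  proof -
    have "dil j y m = (\<Sum>k=1..n. c k * dil j (dil k a) m)"
      by (simp add: y dil_def)
    also have "\<dots> = (\<Sum>k=1..n. c k * dil (j * k) a m)"
      using assms(2) by (simp add: dil_dil)
    also have "\<dots> = (\<Sum>k\<in>(*) j ` {1..n}. (if j dvd k then c (k div j) else 0) * dil k a m)"
      using assms(2) by (subst sum.reindex) (auto intro: inj_onI)
    also have "\<dots> = (\<Sum>k=1..j*n. (if j dvd k then c (k div j) else 0) * dil k a m)"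
    proof (rule sum.mono_neutral_left)
      show "(*) j ` {1..n} \<subseteq> {1..j*n}"
        using assms(2) by auto
      show "\<forall>i\<in>{1..j*n} - (*) j ` {1..n}. (if j dvd i then c (i div j) else 0) * dil i a m = 0"
      proof
        fix i assume i: "i \<in> {1..j*n} - (*) j ` {1..n}"
        have "\<not> j dvd i"
        proof
          assume "j dvd i"
          then obtain l where l: "i = j * l" by blast
          with i assms(2) have "l \<in> {1..n}" by (auto simp: Suc_le_eq)
          with l i show False by auto
        qed
        then show "(if j dvd i then c (i div j) else 0) * dil i a m = 0" by simp
      qed
    qed simp
    finally show ?thesis .
  qed
  then show ?thesis unfolding dil_comb_def
    by (intro exI[of _ "j * n"] exI[of _ "\<lambda>k. if j dvd k then c (k div j) else 0"]) (rule ext)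
qed

lemma dil_approx_self: "dil_approx a a"
  unfolding dil_approx_iff
proof (intro allI impI)
  fix \<epsilon> :: real assume "\<epsilon> > 0"
  have "dil_comb a a"
    unfolding dil_comb_def by (intro exI[of _ 1] exI[of _ "\<lambda>_. 1"]) (auto simp: dil_def)
  with \<open>\<epsilon> > 0\<close> show "\<exists>y. dil_comb a y \<and> l2_near \<epsilon> a y"
    by (intro exI[of _ a]) (auto simp: l2_near_def)
qed

lemma dil_approx_add:
  assumes "dil_approx a x" "dil_approx a u"
  shows "dil_approx a (\<lambda>m. x m + u m)"
  unfolding dil_approx_iff
proof (intro allI impI)
  fix \<epsilon> :: real assume "\<epsilon> > 0"
  then have "\<epsilon> / 4 > 0" by simp
  then obtain y v where "dil_comb a y" "l2_near (\<epsilon> / 4) x y" "dil_comb a v" "l2_near (\<epsilon> / 4) u v"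
    using assms unfolding dil_approx_iff by blast
  then show "\<exists>y. dil_comb a y \<and> l2_near \<epsilon> (\<lambda>m. x m + u m) y"
    using l2_near_add[of "\<epsilon> / 4" x y "\<epsilon> / 4" u v] dil_comb_add[of a y v] by auto
qed

lemma dil_approx_scale:
  assumes "dil_approx a x"
  shows "dil_approx a (\<lambda>m. c * x m)"
  unfolding dil_approx_iff
proof (intro allI impI)
  fix \<epsilon> :: real assume "\<epsilon> > 0"
  have c: "c\<^sup>2 + 1 > 0" by (simp add: add_nonneg_pos)
  with \<open>\<epsilon> > 0\<close> have "\<epsilon> / (c\<^sup>2 + 1) > 0" by simp
  then obtain y where "dil_comb a y" "l2_near (\<epsilon> / (c\<^sup>2 + 1)) x y"
    using assms unfolding dil_approx_iff by blast
  then show "\<exists>y. dil_comb a y \<and> l2_near \<epsilon> (\<lambda>m. c * x m) y"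
    using l2_near_scale[of "\<epsilon> / (c\<^sup>2 + 1)" x y c] dil_comb_scale[of a y c] c by auto
qed

lemma dil_approx_diff:
  "dil_approx a x \<Longrightarrow> dil_approx a u \<Longrightarrow> dil_approx a (\<lambda>m. x m - u m)"
  using dil_approx_add[of a x "\<lambda>m. -1 * u m"] dil_approx_scale[of a u "-1"] by simp

lemma dil_approx_dil:
  assumes "dil_approx a x" "k \<ge> 1"
  shows "dil_approx a (dil k x)"
  using assms l2_near_dil dil_comb_dil unfolding dil_approx_iff by metis

lemma dil_approx_zero: "dil_approx a (\<lambda>_. 0)"
  using dil_approx_scale[OF dil_approx_self, of a 0] by simp

lemma dil_approx_sum:
  assumes "\<And>i. i \<in> A \<Longrightarrow> dil_approx a (f i)"
  shows "dil_approx a (\<lambda>m. \<Sum>i\<in>A. f i m)"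
  using assms
  by (induction A rule: infinite_finite_induct) (auto intro: dil_approx_add dil_approx_zero)

lemma dil_approx_closed:
  assumes "\<And>\<epsilon>. \<epsilon> > 0 \<Longrightarrow> \<exists>y. dil_approx a y \<and> l2_near \<epsilon> x y"
  shows "dil_approx a x"
  unfolding dil_approx_iff
proof (intro allI impI)
  fix \<epsilon> :: real assume "\<epsilon> > 0"
  then have e: "\<epsilon> / 4 > 0" by simp
  then obtain y where y: "dil_approx a y" "l2_near (\<epsilon> / 4) x y"
    using assms by blast
  then obtain z where "dil_comb a z" "l2_near (\<epsilon> / 4) y z"
    using e unfolding dil_approx_iff by blast
  with y show "\<exists>y. dil_comb a y \<and> l2_near \<epsilon> x y"
    using l2_near_trans[of "\<epsilon> / 4" x y "\<epsilon> / 4" z] by auto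
qed

text \<open>One cut-off Y serves all pairs with squared difference below g, so Y can be fixed before
  the sequences are constructed from it.\<close>

lemma l2_near_tail:
  assumes g: "summable g" "\<And>n. g n \<ge> (0::real)" and "\<epsilon> > 0"
  obtains Y where "\<And>x y. (\<And>n. n \<le> Y \<Longrightarrow> x n = y n) \<Longrightarrow> (\<And>n. (x n - y n)\<^sup>2 \<le> g n) \<Longrightarrow> l2_near \<epsilon> x y"
proof -
  obtain Y where "\<And>n. n \<ge> Y \<Longrightarrow> norm (\<Sum>i. g (i + n)) < \<epsilon>"
    using suminf_exist_split[OF \<open>\<epsilon> > 0\<close> g(1)] by blast
  then have Y: "norm (\<Sum>i. g (i + Suc Y)) < \<epsilon>" by (meson le_SucI le_refl)
  show thesis
  proof (rule that[of Y])
    fix x y :: "nat \<Rightarrow> real"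
    assume eq: "\<And>n. n \<le> Y \<Longrightarrow> x n = y n" and le: "\<And>n. (x n - y n)\<^sup>2 \<le> g n"
    have s: "summable (\<lambda>n. (x n - y n)\<^sup>2)"
      by (rule summable_comparison_test[OF _ g(1)]) (use le in auto)
    have "(\<Sum>n. (x n - y n)\<^sup>2) = (\<Sum>n. (x (n + Suc Y) - y (n + Suc Y))\<^sup>2) + (\<Sum>n<Suc Y. (x n - y n)\<^sup>2)"
      by (rule suminf_split_initial_segment[OF s])
    also have "(\<Sum>n<Suc Y. (x n - y n)\<^sup>2) = 0"
      by (rule sum.neutral) (use eq in auto)
    also have "(\<Sum>n. (x (n + Suc Y) - y (n + Suc Y))\<^sup>2) \<le> (\<Sum>n. g (n + Suc Y))"
    proof (rule suminf_le)
      show "summable (\<lambda>n. (x (n + Suc Y) - y (n + Suc Y))\<^sup>2)"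
        using s by (rule summable_ignore_initial_segment)
      show "summable (\<lambda>n. g (n + Suc Y))"
        using g(1) by (rule summable_ignore_initial_segment)
    qed (rule le)
    finally have "(\<Sum>n. (x n - y n)\<^sup>2) < \<epsilon>" using Y by simp
    with s show "l2_near \<epsilon> x y" by (simp add: l2_near_def)
  qed
qed

section \<open>Recovering the unit sequence from the dilates\<close>

abbreviation unit_seq :: "nat \<Rightarrow> nat \<Rightarrow> real" where
  "unit_seq k \<equiv> \<lambda>n. if n = k then 1 else 0"

lemma dil_unit_seq: "j \<ge> 1 \<Longrightarrow> dil j (unit_seq k) = unit_seq (j * k)"
  by (auto simp: dil_def fun_eq_iff)

lemma summable_inverse_squares: "summable (\<lambda>n. 1 / (real n)\<^sup>2)"
  using inverse_power_summable[of 2, where 'a = real] by (simp add: inverse_eq_divide)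

lemma dil_approx_all_of_unit:
  assumes "dil_approx a (unit_seq 1)" "summable (\<lambda>n. (x n)\<^sup>2)" "x 0 = 0"
  shows "dil_approx a x"
proof (rule dil_approx_closed)
  fix \<epsilon> :: real assume "\<epsilon> > 0"
  obtain Y where Y: "\<And>x' y. (\<And>n. n \<le> Y \<Longrightarrow> x' n = y n) \<Longrightarrow> (\<And>n. (x' n - y n)\<^sup>2 \<le> (x n)\<^sup>2) \<Longrightarrow> l2_near \<epsilon> x' y"
    using l2_near_tail[OF assms(2) _ \<open>\<epsilon> > 0\<close>] by auto
  let ?y = "\<lambda>n. \<Sum>k=1..Y. x k * unit_seq k n"
  have y: "?y n = (if 1 \<le> n \<and> n \<le> Y then x n else 0)" for n
  proof -
    have "?y n = (\<Sum>k=1..Y. if n = k then x k else 0)"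
      by (intro sum.cong) auto
    then show ?thesis by (simp add: sum.delta')
  qed
  have "dil_approx a (unit_seq k)" if "k \<ge> 1" for k
    using dil_approx_dil[OF assms(1) that] dil_unit_seq[OF that, of 1] by simp
  then have "dil_approx a ?y"
    by (intro dil_approx_sum dil_approx_scale) auto
  moreover have "l2_near \<epsilon> x ?y"
    unfolding y by (rule Y) (use assms(3) in \<open>auto simp: not_le\<close>)
  ultimately show "\<exists>y. dil_approx a y \<and> l2_near \<epsilon> x y" by blast
qed

text \<open>The factor \<open>1 - e p\<^sup>-\<^sup>s\<close> with \<open>\<bar>e\<bar> \<le> 1\<close> is removed by averaging
  \<open>\<delta>\<^sub>1 - e\<^sup>j \<delta>\<^bsub>p\<^sup>j\<^esub>\<close> over \<open>j\<close>.\<close>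

lemma dil_approx_unit_of_binomial:
  assumes a: "dil_approx a (\<lambda>m. unit_seq 1 m - e * unit_seq p m)" and p: "p \<ge> 2" and e: "\<bar>e\<bar> \<le> 1"
  shows "dil_approx a (unit_seq 1)"
proof (rule dil_approx_closed)
  fix \<epsilon> :: real assume "\<epsilon> > 0"
  have pow: "dil_approx a (\<lambda>m. unit_seq 1 m - e ^ j * unit_seq (p ^ j) m)" for j
  proof (induction j)
    case 0
    then show ?case using dil_approx_zero[of a] by simp
  next
    case (Suc j)
    have pj: "p ^ j \<ge> 1" using p by simp
    have "dil_approx a (dil (p ^ j) (\<lambda>m. unit_seq 1 m - e * unit_seq p m))"
      by (rule dil_approx_dil[OF a pj])
    moreover have "dil (p ^ j) (\<lambda>m. unit_seq 1 m - e * unit_seq p m) =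
        (\<lambda>m. unit_seq (p ^ j) m - e * unit_seq (p ^ Suc j) m)"
      unfolding dil_diff_scale dil_unit_seq[OF pj] by (simp add: mult.commute)
    \<comment> \<open>Telescoping: the relation dilated by p^j and scaled by e^j replaces the term
      at p^j by the one at p^(j+1).\<close>
    ultimately have "dil_approx a (\<lambda>m. (unit_seq 1 m - e ^ j * unit_seq (p ^ j) m) +
        e ^ j * (unit_seq (p ^ j) m - e * unit_seq (p ^ Suc j) m))"
      using Suc by (intro dil_approx_add dil_approx_scale) auto
    then show ?case by (simp add: algebra_simps)
  qed
  obtain J :: nat where J: "1 / real (Suc J) < \<epsilon>"
    using \<open>\<epsilon> > 0\<close> nat_approx_posE by blast
  define K where "K = Suc J"
  let ?y = "\<lambda>m. 1 / real K * (\<Sum>j=1..K. unit_seq 1 m - e ^ j * unit_seq (p ^ j) m)"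
  let ?d = "\<lambda>m. (\<Sum>j=1..K. e ^ j * unit_seq (p ^ j) m)"
  have "dil_approx a ?y"
    by (intro dil_approx_scale dil_approx_sum pow)
  \<comment> \<open>The error is the average of K terms at distinct places, each of modulus at most
    1, so its squared norm is at most K / K^2 = 1/K.\<close>
  moreover have "l2_near \<epsilon> (unit_seq 1) ?y"
  proof -
    have diff: "unit_seq 1 m - ?y m = ?d m / real K" for m
      by (simp add: sum_subtractf K_def field_simps)
    have d0: "?d m = 0" if "m \<notin> (\<lambda>j. p ^ j) ` {1..K}" for m
      using that by (intro sum.neutral) auto
    have inj: "inj_on (\<lambda>j. p ^ j) {1..K}"
      using p by (intro inj_onI) (auto dest: power_inject_exp[THEN iffD1, rotated])
    have d1: "?d (p ^ i) = e ^ i" if "i \<in> {1..K}" for i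
    proof -
      have "?d (p ^ i) = (\<Sum>j=1..K. if i = j then e ^ j else 0)"
        using p by (intro sum.cong) (auto dest: power_inject_exp[THEN iffD1, rotated])
      then show ?thesis using that by (simp add: sum.delta')
    qed
    have sums: "(\<lambda>m. (?d m / real K)\<^sup>2) sums (\<Sum>m\<in>(\<lambda>j. p ^ j) ` {1..K}. (?d m / real K)\<^sup>2)"
    proof (rule sums_finite)
      show "(?d m / real K)\<^sup>2 = 0" if "m \<notin> (\<lambda>j. p ^ j) ` {1..K}" for m
        using d0[OF that] by (simp only:) simp
    qed simp
    have "(\<Sum>m\<in>(\<lambda>j. p ^ j) ` {1..K}. (?d m / real K)\<^sup>2) = (\<Sum>j=1..K. (?d (p ^ j) / real K)\<^sup>2)"
      by (subst sum.reindex[OF inj]) simp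
    also have "\<dots> = (\<Sum>j=1..K. (e ^ j / real K)\<^sup>2)"
      by (intro sum.cong refl) (simp only: d1)
    also have "\<dots> \<le> (\<Sum>j=1..K. (1 / real K)\<^sup>2)"
    proof (intro sum_mono)
      fix j
      have "\<bar>e\<bar> ^ j \<le> 1" using e by (simp add: power_le_one)
      then have "\<bar>e ^ j\<bar> \<le> 1" by (simp add: power_abs)
      then show "(e ^ j / real K)\<^sup>2 \<le> (1 / real K)\<^sup>2"
        by (simp add: power_divide divide_right_mono abs_square_le_1)
    qed
    also have "\<dots> = 1 / real K"
      by (simp add: power2_eq_square K_def)
    also have "\<dots> < \<epsilon>" using J by (simp add: K_def)
    finally show ?thesis
      unfolding l2_near_def diff using sums by (simp add: sums_iff)
  qed
  ultimately show "\<exists>y. dil_approx a y \<and> l2_near \<epsilon> (unit_seq 1) y" by blast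
qed

text \<open>\<open>b R\<close> is the coefficient sequence of the Euler product without the factors
  at the primes in R, and \<open>A R\<close> is the same modification of a. Removing one more prime
  q subtracts a multiple of the dilate by q, so every \<open>A R\<close> stays approximable by the
  dilates of a.\<close>

lemma dil_approx_sieved_character:
  fixes \<xi> :: "nat \<Rightarrow> real"
  assumes \<xi>1: "\<xi> 1 = 1" and \<xi>m: "\<And>m n. \<xi> (m * n) = \<xi> m * \<xi> n" and \<xi>b: "\<And>n. \<bar>\<xi> n\<bar> \<le> 1"
    and p: "p \<ge> 2" and e: "\<bar>e\<bar> \<le> 1" and \<kappa>: "\<kappa> \<noteq> 0"
    and a: "\<And>n. a n = \<kappa> * (\<xi> n / real n - e * dil p (\<lambda>n. \<xi> n / real n) n)"
    and x: "summable (\<lambda>n. (x n)\<^sup>2)" "x 0 = 0"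
  shows "dil_approx a x"
proof -
  define b where "b R n = (if \<forall>q\<in>R. \<not> q dvd n then \<xi> n / real n else 0)" for R :: "nat set" and n :: nat
  define A where "A R n = \<kappa> * (b R n - e * dil p (b R) n)" for R n
  have b_insert: "b (insert q R) n = b R n - \<xi> q / real q * dil q (b R) n"
    if R: "\<forall>r\<in>R. prime r" and q: "prime q" "q \<notin> R" for q R n
  proof (cases "q dvd n")
    case False
    then show ?thesis by (auto simp: b_def dil_def)
  next
    case True
    then obtain m where m: "n = q * m" by blast
    have "r dvd q * m \<longleftrightarrow> r dvd m" if "r \<in> R" for r
      using R q that by (metis prime_dvd_mult_iff primes_dvd_imp_eq)
    then have "(\<forall>r\<in>R. \<not> r dvd q * m) \<longleftrightarrow> (\<forall>r\<in>R. \<not> r dvd m)" by blast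
    then show ?thesis
      using m q prime_gt_0_nat[OF q(1)] by (auto simp: b_def dil_def \<xi>m)
  qed
  have A_insert: "A (insert q R) n = A R n - \<xi> q / real q * dil q (A R) n"
    if R: "\<forall>r\<in>R. prime r" and q: "prime q" "q \<notin> R" for q R n
  proof -
    have bq: "b (insert q R) = (\<lambda>n. b R n - \<xi> q / real q * dil q (b R) n)"
      using b_insert[OF that] by blast
    have pq: "p \<ge> 1" "q \<ge> 1" using p prime_ge_1_nat q by auto
    have "dil p (dil q (b R)) = dil q (dil p (b R))"
      using pq by (simp add: dil_dil mult.commute)
    moreover have "dil q (A R) n = \<kappa> * (dil q (b R) n - e * dil q (dil p (b R)) n)"
      by (simp add: A_def dil_def)
    moreover have "A (insert q R) n = \<kappa> * ((b R n - \<xi> q / real q * dil q (b R) n) -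
        e * (dil p (b R) n - \<xi> q / real q * dil p (dil q (b R)) n))"
      by (simp only: A_def bq dil_diff_scale)
    moreover have "A R n = \<kappa> * (b R n - e * dil p (b R) n)"
      by (simp only: A_def)
    ultimately show ?thesis by (simp only:) (simp add: algebra_simps)
  qed
  have approx: "dil_approx a (A R)" if "finite R" "\<forall>r\<in>R. prime r" for R
    using that
  proof (induction R)
    case empty
    have "A {} = a" by (auto simp: A_def b_def[abs_def] a fun_eq_iff)
    then show ?case by (simp add: dil_approx_self)
  next
    case (insert q R)
    then have "A (insert q R) = (\<lambda>n. A R n - \<xi> q / real q * dil q (A R) n)"
      using A_insert[of R q] by auto
    moreover have "dil_approx a (A R)" "q \<ge> 1"
      using insert prime_ge_1_nat[of q] by auto
    ultimately show ?case
      by (simp only:) (intro dil_approx_diff dil_approx_scale dil_approx_dil)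
  qed
  have "dil_approx a (\<lambda>m. \<kappa> * (unit_seq 1 m - e * unit_seq p m))"
  proof (rule dil_approx_closed)
    fix \<epsilon> :: real assume "\<epsilon> > 0"
    \<comment> \<open>Chosen so that adding the dilate by p with factor -e and scaling by \<kappa>
      enlarges the error to exactly \<epsilon>.\<close>
    define \<delta> where "\<delta> = \<epsilon> / ((\<kappa>\<^sup>2 + 1) * (2 + 2 * ((-e)\<^sup>2 + 1)))"
    have pos: "(\<kappa>\<^sup>2 + 1) * (2 + 2 * ((-e)\<^sup>2 + 1)) > 0"
      by (intro mult_pos_pos add_nonneg_pos add_pos_nonneg) auto
    then have "\<delta> > 0" using \<open>\<epsilon> > 0\<close> by (simp add: \<delta>_def)
    obtain Y where Y: "\<And>x y. (\<And>n. n \<le> Y \<Longrightarrow> x n = y n) \<Longrightarrow> (\<And>n. (x n - y n)\<^sup>2 \<le> 1 / (real n)\<^sup>2) \<Longrightarrow> l2_near \<delta> x y"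
      using l2_near_tail[OF summable_inverse_squares _ \<open>\<delta> > 0\<close>] by auto
    define R where "R = {q. prime q \<and> q \<le> Y}"
    have R: "finite R" "\<forall>r\<in>R. prime r" by (auto simp: R_def)
    have b0: "b R 0 = 0" and b1: "b R 1 = 1"
      using R(2) \<xi>1 by (auto simp: b_def)
    \<comment> \<open>Every n with 2 \<le> n \<le> Y has a prime factor in R, so the two sequences
      agree up to Y; beyond Y, 1/n^2 is a majorant.\<close>
    have near: "l2_near \<delta> (unit_seq 1) (b R)"
    proof (rule Y)
      fix n assume "n \<le> Y"
      show "unit_seq 1 n = b R n"
      proof (cases "n \<le> 1")
        case True
        then have "n = 0 \<or> n = 1" by auto
        then show ?thesis using b0 b1 by auto
      next
        case False
        then obtain q where "prime q" "q dvd n"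
          using prime_factor_nat[of n] by auto
        moreover from this have "q \<le> Y" using False \<open>n \<le> Y\<close> dvd_imp_le[of q n] by auto
        ultimately have "b R n = 0" by (auto simp: b_def R_def)
        then show ?thesis using False by simp
      qed
    next
      fix n
      show "(unit_seq 1 n - b R n)\<^sup>2 \<le> 1 / (real n)\<^sup>2"
      proof (cases "n = 1")
        case True
        then show ?thesis using b1 by simp
      next
        case False
        have "(\<xi> n)\<^sup>2 \<le> 1" using \<xi>b by (simp add: abs_square_le_1)
        then show ?thesis
          using False by (auto simp: b_def power_divide divide_right_mono)
      qed
    qed
    have near2: "l2_near (2 * \<delta> + 2 * (((-e)\<^sup>2 + 1) * \<delta>)) (\<lambda>m. unit_seq 1 m + (- e) * dil p (unit_seq 1) m)
        (\<lambda>m. b R m + (- e) * dil p (b R) m)"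
      using p by (intro l2_near_add l2_near_scale l2_near_dil near) auto
    have "l2_near \<epsilon> (\<lambda>m. \<kappa> * (unit_seq 1 m + (- e) * dil p (unit_seq 1) m))
        (\<lambda>m. \<kappa> * (b R m + (- e) * dil p (b R) m))"
    proof -
      have "(\<kappa>\<^sup>2 + 1) * (2 * \<delta> + 2 * (((-e)\<^sup>2 + 1) * \<delta>)) = ((\<kappa>\<^sup>2 + 1) * (2 + 2 * ((-e)\<^sup>2 + 1))) * \<delta>"
        by (simp only: algebra_simps)
      also have "\<dots> = \<epsilon>" unfolding \<delta>_def
        using less_imp_neq[OF pos] by (simp only: times_divide_eq_right nonzero_mult_div_cancel_left not_sym)
      finally show ?thesis using l2_near_scale[OF near2, of \<kappa>] by (simp only:)
    qed
    then have "l2_near \<epsilon> (\<lambda>m. \<kappa> * (unit_seq 1 m - e * unit_seq p m)) (A R)"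
      using p by (simp add: A_def[abs_def] dil_unit_seq)
    with approx[OF R] show "\<exists>y. dil_approx a y \<and> l2_near \<epsilon> (\<lambda>m. \<kappa> * (unit_seq 1 m - e * unit_seq p m)) y"
      by blast
  qed
  from dil_approx_scale[OF this, of "1 / \<kappa>"]
  have "dil_approx a (\<lambda>m. unit_seq 1 m - e * unit_seq p m)" using \<kappa> by simp
  then have "dil_approx a (unit_seq 1)"
    by (rule dil_approx_unit_of_binomial[OF _ p e])
  then show ?thesis by (rule dil_approx_all_of_unit[OF _ x])
qed

lemma dil_approx_evaluation_nonzero:
  fixes a :: "nat \<Rightarrow> real" and \<Lambda> :: "nat \<Rightarrow> complex"
  assumes a: "dil_approx a (unit_seq 1)" "a 0 = 0" "summable (\<lambda>n. (a n)\<^sup>2)"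
    and \<Lambda>1: "\<Lambda> 1 = 1" and \<Lambda>m: "\<And>m n. m \<ge> 1 \<Longrightarrow> n \<ge> 1 \<Longrightarrow> \<Lambda> (m * n) = \<Lambda> m * \<Lambda> n"
    and \<Lambda>2: "summable (\<lambda>n. (norm (\<Lambda> n))\<^sup>2)"
  shows "(\<Sum>n. \<Lambda> n * of_real (a n)) \<noteq> 0"
proof
  assume zero: "(\<Sum>n. \<Lambda> n * of_real (a n)) = 0"
  define L where "L = (\<Sum>n. (norm (\<Lambda> n))\<^sup>2)"
  have "L \<ge> 1"
    unfolding L_def using sum_le_suminf[OF \<Lambda>2, of "{1}"] \<Lambda>1 by simp
  \<comment> \<open>A weighted substitute for the Cauchy-Schwarz inequality. With weight L, the
    squares of \<Lambda> contribute 1/2 in total, and a squared distance below 1/L contributes less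
    than 1/2. The functional would vanish at the approximating combination and equal 1 at
    \<open>unit_seq 1\<close>, whence 1 < 1.\<close>
  have amgm: "norm (\<Lambda> n * of_real y) \<le> ((norm (\<Lambda> n))\<^sup>2 / L + L * y\<^sup>2) / 2" for n and y :: real
  proof -
    have "0 \<le> (norm (\<Lambda> n) / sqrt L - sqrt L * \<bar>y\<bar>)\<^sup>2" by simp
    also have "\<dots> = (norm (\<Lambda> n))\<^sup>2 / L + L * y\<^sup>2 - 2 * (norm (\<Lambda> n) * \<bar>y\<bar>)"
      using \<open>L \<ge> 1\<close> by (simp add: power2_diff power_divide power_mult_distrib)
    finally show ?thesis by (simp add: norm_mult)
  qed
  have summ: "summable (\<lambda>n. norm (\<Lambda> n * of_real (y n)))" if "summable (\<lambda>n. (y n)\<^sup>2)" for y :: "nat \<Rightarrow> real"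
  proof (rule summable_comparison_test)
    show "\<exists>N. \<forall>n\<ge>N. norm (norm (\<Lambda> n * of_real (y n))) \<le> ((norm (\<Lambda> n))\<^sup>2 / L + L * (y n)\<^sup>2) / 2"
      using amgm by auto
    show "summable (\<lambda>n. ((norm (\<Lambda> n))\<^sup>2 / L + L * (y n)\<^sup>2) / 2)"
      using \<Lambda>2 that by (intro summable_divide summable_add summable_mult)
  qed
  have sums0: "(\<lambda>n. \<Lambda> n * of_real (a n)) sums 0"
    using summable_norm_cancel[OF summ[OF a(3)]] zero by (simp add: sums_iff)
  have dil0: "(\<lambda>m. \<Lambda> m * of_real (dil k a m)) sums 0" if k: "k \<ge> 1" for k
  proof -
    have eq: "\<Lambda> (k * n) * of_real (a n) = \<Lambda> k * (\<Lambda> n * of_real (a n))" for n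
      using \<Lambda>m[OF k, of n] a(2) by (cases "n = 0") auto
    have "(\<lambda>n. \<Lambda> (k * n) * of_real (a n)) sums 0"
      unfolding eq using sums_mult[OF sums0, of "\<Lambda> k"] by simp
    then have "dil k (\<lambda>n. \<Lambda> (k * n) * of_real (a n)) sums 0"
      using k by (simp add: dil_sums_iff)
    moreover have "dil k (\<lambda>n. \<Lambda> (k * n) * of_real (a n)) = (\<lambda>m. \<Lambda> m * of_real (dil k a m))"
      by (auto simp: dil_def fun_eq_iff)
    ultimately show ?thesis by simp
  qed
  have "1 / L > 0" using \<open>L \<ge> 1\<close> by simp
  then obtain y where "dil_comb a y" and near: "l2_near (1 / L) (unit_seq 1) y"
    using a(1) unfolding dil_approx_iff by blast
  then obtain n c where y: "y = (\<lambda>m. \<Sum>k=1..n. c k * dil k a m)"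
    unfolding dil_comb_def by blast
  have "(\<lambda>m. \<Sum>k=1..n. of_real (c k) * (\<Lambda> m * of_real (dil k a m))) sums (\<Sum>k=1..n. of_real (c k) * 0)"
    by (intro sums_sum sums_mult dil0) auto
  then have y0: "(\<lambda>m. \<Lambda> m * of_real (y m)) sums 0"
    by (simp add: y sum_distrib_left mult.left_commute)
  have "(\<lambda>m. if m = 1 then \<Lambda> m else 0) sums \<Lambda> 1"
    by (rule sums_single)
  from sums_diff[OF this y0]
  have "(\<lambda>m. \<Lambda> m * of_real (unit_seq 1 m - y m)) sums 1"
  proof -
    have "\<Lambda> m * of_real (unit_seq 1 m - y m) = (if m = 1 then \<Lambda> m else 0) - \<Lambda> m * of_real (y m)" for m
      by (cases "m = 1") (auto simp: algebra_simps)
    then show ?thesis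
      using \<open>(\<lambda>m. (if m = 1 then \<Lambda> m else 0) - \<Lambda> m * of_real (y m)) sums (\<Lambda> 1 - 0)\<close> \<Lambda>1 by simp
  qed
  then have "1 = norm (\<Sum>m. \<Lambda> m * of_real (unit_seq 1 m - y m))"
    by (simp only: sums_iff) simp
  also have "\<dots> \<le> (\<Sum>m. norm (\<Lambda> m * of_real (unit_seq 1 m - y m)))"
    using near by (intro summable_norm summ) (auto simp: l2_near_def)
  also have "\<dots> \<le> (\<Sum>m. ((norm (\<Lambda> m))\<^sup>2 / L + L * (unit_seq 1 m - y m)\<^sup>2) / 2)"
    using near \<Lambda>2 by (intro suminf_le amgm summ summable_divide summable_add summable_mult) (auto simp: l2_near_def)
  also have "\<dots> = (L / L + L * (\<Sum>m. (unit_seq 1 m - y m)\<^sup>2)) / 2"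
  proof -
    have s: "summable (\<lambda>m. (unit_seq 1 m - y m)\<^sup>2)"
      using near by (simp add: l2_near_def)
    have "(\<lambda>m. ((norm (\<Lambda> m))\<^sup>2 / L + L * (unit_seq 1 m - y m)\<^sup>2) / 2) sums
        ((L / L + L * (\<Sum>m. (unit_seq 1 m - y m)\<^sup>2)) / 2)"
      unfolding L_def by (intro sums_divide sums_add sums_mult summable_sums s \<Lambda>2)
    then show ?thesis by (simp add: sums_iff)
  qed
  also have "\<dots> < (1 + L * (1 / L)) / 2"
  proof -
    have "L * (\<Sum>m. (unit_seq 1 m - y m)\<^sup>2) < L * (1 / L)"
      using near \<open>L \<ge> 1\<close> by (intro mult_strict_left_mono) (auto simp: l2_near_def)
    then show ?thesis using \<open>L \<ge> 1\<close> by simp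
  qed
  also have "\<dots> = 1" using \<open>L \<ge> 1\<close> by simp
  finally show False by simp
qed

section \<open>Zero-free limits of Euler products\<close>

text \<open>A case of Hadamard factorisation. A zero-free G has an entire logarithm h, and the
  growth bound makes Re h grow at most linearly. A Borel-Caratheodory argument carries this over to
  |h|, and Liouville's theorem makes h affine.\<close>

lemma entire_nonvanishing_exponential_type:
  assumes G: "G holomorphic_on UNIV" and nz: "\<And>z. G z \<noteq> 0"
    and growth: "\<And>z. norm (G z) \<le> C * exp (norm z)"
  shows "\<exists>c \<mu>. \<forall>z. G z = c * exp (\<mu> * z)"
proof -
  obtain h where h: "h holomorphic_on UNIV" "\<And>z. G z = exp (h z)"
    using contractible_imp_holomorphic_log[OF G contractible_UNIV] nz by auto
  define u where "u z = h z - h 0" for z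
  have u: "u holomorphic_on UNIV" "u 0 = 0"
    unfolding u_def by (auto intro!: holomorphic_intros h)
  have "C > 0"
    using growth[of 0] nz[of 0] by (smt (verit) exp_gt_zero zero_less_norm_iff mult_nonpos_nonneg)
  define K where "K = \<bar>ln C\<bar> + \<bar>Re (h 0)\<bar> + 1"
  have Re_u: "Re (u z) < K + norm z" for z
  proof -
    have "exp (Re (h z)) \<le> exp (ln C + norm z)"
      using growth[of z] \<open>C > 0\<close> by (simp add: h exp_add)
    then have "Re (h z) \<le> ln C + norm z" by simp
    then show ?thesis unfolding u_def K_def minus_complex.sel by linarith
  qed
  have bound: "norm (u z) \<le> 2 * (K + 2 * norm z)" if "z \<noteq> 0" for z
  proof -
    define R where "R = norm z"
    have "R > 0" using that by (simp add: R_def)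
    define A where "A = K + 2 * R"
    have "A > 0" using \<open>R > 0\<close> by (auto simp: A_def K_def)
    \<comment> \<open>v -> v / (2A - v) maps the half-plane Re v < A into the unit disc and fixes 0.
      The Schwarz lemma at |w| = 1/2 then bounds |u| at radius R by the bound 2A belonging to radius
      2R.\<close>
    define g where "g w = u (of_real (2 * R) * w) / (of_real (2 * A) - u (of_real (2 * R) * w))" for w
    have Re_lt: "Re (u (of_real (2 * R) * w)) < A" if "norm w < 1" for w
    proof -
      have "norm (of_real (2 * R) * w) \<le> 2 * R"
        using that \<open>R > 0\<close> by (simp add: norm_mult)
      then show ?thesis using Re_u[of "of_real (2 * R) * w"] by (simp add: A_def)
    qed
    have lt: "norm v < norm (of_real (2 * A) - v)" if "Re v < A" for v :: complex
    proof -
      have "(norm v)\<^sup>2 < (norm (of_real (2 * A) - v))\<^sup>2"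
      proof -
        have "(norm (of_real (2 * A) - v))\<^sup>2 - (norm v)\<^sup>2 = 4 * A * (A - Re v)"
          by (simp only: cmod_power2) (simp add: power2_eq_square algebra_simps)
        moreover have "4 * A * (A - Re v) > 0" using that \<open>A > 0\<close> by simp
        ultimately show ?thesis by linarith
      qed
      then show ?thesis by (rule power2_less_imp_less) simp
    qed
    have g_lt: "norm (g w) < 1" if "norm w < 1" for w
    proof -
      have "norm (u (of_real (2 * R) * w)) < norm (of_real (2 * A) - u (of_real (2 * R) * w))"
        by (rule lt[OF Re_lt[OF that]])
      moreover from this have "norm (of_real (2 * A) - u (of_real (2 * R) * w)) > 0"
        using norm_ge_zero order.strict_trans1 by blast
      ultimately show ?thesis unfolding g_def norm_divide by (simp only: divide_less_eq_1_pos)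
    qed
    have "g holomorphic_on ball 0 1"
      unfolding g_def
    proof (intro holomorphic_intros)
      show "(\<lambda>w. u (of_real (2 * R) * w)) holomorphic_on ball 0 1"
        by (rule holomorphic_on_compose_gen[OF _ u(1), unfolded o_def]) (auto intro!: holomorphic_intros)
      then show "(\<lambda>w. u (of_real (2 * R) * w)) holomorphic_on ball 0 1" .
      fix w :: complex assume "w \<in> ball 0 1"
      then show "of_real (2 * A) - u (of_real (2 * R) * w) \<noteq> 0"
        using lt[OF Re_lt[of w]] by auto
    qed
    moreover have "g 0 = 0" by (simp add: g_def u)
    moreover define w where "w = z / of_real (2 * R)"
    have w: "norm w = 1 / 2" "of_real (2 * R) * w = z"
      using \<open>R > 0\<close> by (auto simp: w_def norm_divide R_def)
    ultimately have gw: "norm (g w) \<le> 1 / 2"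
      using Schwarz_Lemma(1)[of g w] g_lt by simp
    have den: "of_real (2 * A) - u z \<noteq> 0"
      using lt[OF Re_lt[of w]] w by auto
    have "u z = g w * (of_real (2 * A) - u z)"
      unfolding g_def w(2) using den by simp
    then have "norm (u z) \<le> 1 / 2 * norm (of_real (2 * A) - u z)"
      using gw by (metis norm_mult mult_right_mono norm_ge_zero)
    also have "norm (of_real (2 * A) - u z) \<le> 2 * A + norm (u z)"
      using norm_triangle_ineq4[of "of_real (2 * A)" "u z"] \<open>A > 0\<close> by simp
    finally show ?thesis by (simp add: A_def R_def)
  qed
  have "u z = (\<Sum>k\<le>1. (deriv ^^ k) u 0 / fact k * z ^ k)" for z
  proof (rule Liouville_polynomial[OF u(1)])
    fix z :: complex assume z: "1 \<le> norm z"
    then have "norm (u z) \<le> 2 * (K + 2 * norm z)" by (intro bound) auto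
    also have "\<dots> \<le> (2 * K + 4) * norm z"
    proof -
      have "K * 1 \<le> K * norm z" using z by (intro mult_left_mono) (auto simp: K_def)
      then show ?thesis by (simp add: algebra_simps)
    qed
    finally show "norm (u z) \<le> (2 * K + 4) * norm z ^ 1" by simp
  qed
  then have lin: "u z = deriv u 0 * z" for z
    using u(2) by simp
  have "G z = exp (h 0) * exp (deriv u 0 * z)" for z
  proof -
    have "h z = h 0 + deriv u 0 * z"
      using lin[of z] by (simp add: u_def[of z] algebra_simps)
    then show ?thesis by (simp only: h exp_add)
  qed
  then show ?thesis by blast
qed

lemma norm_exp_minus_1_le: "norm (exp z - 1 :: complex) \<le> exp (norm z) * norm z"
proof -
  have "norm (exp z - 1) \<le> exp \<bar>Re z\<bar> * norm z"
    using Taylor_exp[of z 0] by simp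
  also have "\<dots> \<le> exp (norm z) * norm z"
    using abs_Re_le_cmod[of z] by (intro mult_right_mono) auto
  finally show ?thesis .
qed

text \<open>Put x p = z / (T p). The x p add up to z because T is the sum of the 1/p, and T \<ge> 2R
  gives |x p| \<le> 1/2. So the logarithm of the product differs from z by at most the sum of 2 |x
  p|^2, which is at most (2 R^2 / T^2) T.\<close>

lemma euler_product_near_exp:
  fixes z :: complex
  assumes S: "finite S" "\<And>p. p \<in> S \<Longrightarrow> p \<ge> (1::nat)" and T: "T = (\<Sum>p\<in>S. 1 / real p)"
    and z: "norm z \<le> R" and TR: "T > 0" "T \<ge> 2 * R"
  shows "norm ((\<Prod>p\<in>S. 1 / (1 - z / of_real (T * real p))) - exp z) \<le>
    exp R * (exp (2 * R\<^sup>2 / T) * (2 * R\<^sup>2 / T))"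
proof -
  have "R \<ge> 0" using z norm_ge_zero order_trans by blast
  define x where "x p = z / of_real (T * real p)" for p
  define E where "E = (\<Sum>p\<in>S. - (Ln (1 - x p) + x p))"
  have norm_x: "norm (x p) \<le> R / (T * real p)" if "p \<in> S" for p
    using z TR S(2)[OF that] by (auto simp: x_def norm_divide norm_mult divide_right_mono)
  have x_half: "norm (x p) \<le> 1 / 2" if "p \<in> S" for p
  proof -
    have "2 * R \<le> T * real p"
      using TR S(2)[OF that] mult_mono[of "2 * R" T 1 "real p"] \<open>R \<ge> 0\<close> by simp
    then have "R / (T * real p) \<le> 1 / 2"
      using TR S(2)[OF that] by (simp add: field_simps)
    then show ?thesis using norm_x[OF that] by linarith
  qed
  have sum_x: "(\<Sum>p\<in>S. x p) = z"
  proof -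
    have "(\<Sum>p\<in>S. x p) = z / of_real T * of_real (\<Sum>p\<in>S. 1 / real p)"
      by (simp add: x_def sum_distrib_left)
    then show ?thesis using TR by (simp flip: T)
  qed
  have "(\<Prod>p\<in>S. 1 / (1 - z / of_real (T * real p))) = (\<Prod>p\<in>S. exp (- Ln (1 - x p)))"
  proof (rule prod.cong[OF refl])
    fix p assume "p \<in> S"
    then have "1 - x p \<noteq> 0" using x_half[of p] by auto
    then show "1 / (1 - z / of_real (T * real p)) = exp (- Ln (1 - x p))"
      by (simp add: exp_minus x_def inverse_eq_divide)
  qed
  also have "\<dots> = exp (\<Sum>p\<in>S. - Ln (1 - x p))"
    by (simp add: exp_sum S)
  also have "(\<Sum>p\<in>S. - Ln (1 - x p)) = z + E"
    unfolding E_def by (subst sum_x[symmetric], subst sum.distrib[symmetric]) simp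
  finally have prod: "(\<Prod>p\<in>S. 1 / (1 - z / of_real (T * real p))) = exp (z + E)" .
  have "norm E \<le> (\<Sum>p\<in>S. 2 * R\<^sup>2 / T\<^sup>2 * (1 / real p))"
    unfolding E_def
  proof (rule sum_norm_le)
    fix p assume p: "p \<in> S"
    have "norm (- (Ln (1 - x p) + x p)) = norm (ln (1 + (- x p)) - (- x p))"
      by (simp only: norm_minus_cancel diff_minus_eq_add add_uminus_conv_diff)
    also have "\<dots> \<le> norm (- x p) ^ 2 / (1 - norm (- x p))"
      using x_half[OF p] by (intro Ln_approx_linear) simp
    also have "\<dots> \<le> norm (- x p) ^ 2 / (1 / 2)"
      using x_half[OF p] by (intro divide_left_mono) auto
    also have "\<dots> \<le> 2 * (R / (T * real p))\<^sup>2"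
      using norm_x[OF p] power_mono[of "norm (x p)" "R / (T * real p)" 2] by simp
    also have "\<dots> = 2 * R\<^sup>2 / T\<^sup>2 * (1 / (real p)\<^sup>2)"
      by (simp add: power_divide power_mult_distrib)
    also have "\<dots> \<le> 2 * R\<^sup>2 / T\<^sup>2 * (1 / real p)"
    proof (rule mult_left_mono)
      have "real p \<le> real p * real p" using S(2)[OF p] by (metis mult.commute mult_le_mono1 mult_1 of_nat_le_iff of_nat_mult)
      then show "1 / (real p)\<^sup>2 \<le> 1 / real p"
        using S(2)[OF p] by (simp add: power2_eq_square frac_le)
    qed simp
    finally show "norm (- (Ln (1 - x p) + x p)) \<le> 2 * R\<^sup>2 / T\<^sup>2 * (1 / real p)" .
  qed
  also have "\<dots> = 2 * R\<^sup>2 / T\<^sup>2 * T"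
    by (simp add: T sum_distrib_left)
  also have "\<dots> = 2 * R\<^sup>2 / T" using TR by (simp add: power2_eq_square)
  finally have E: "norm E \<le> 2 * R\<^sup>2 / T" .
  have "norm (exp (z + E) - exp z) = norm (exp z) * norm (exp E - 1)"
  proof -
    have "exp (z + E) - exp z = exp z * (exp E - 1)" by (simp add: exp_add algebra_simps)
    then show ?thesis by (simp only: norm_mult)
  qed
  also have "\<dots> \<le> exp R * (exp (2 * R\<^sup>2 / T) * (2 * R\<^sup>2 / T))"
  proof (rule mult_mono)
    have "norm (exp z) \<le> exp (norm z)" by (rule norm_exp)
    also have "\<dots> \<le> exp R" using z by simp
    finally show "norm (exp z) \<le> exp R" .
    have "norm (exp E - 1) \<le> exp (norm E) * norm E" by (rule norm_exp_minus_1_le)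
    also have "\<dots> \<le> exp (2 * R\<^sup>2 / T) * (2 * R\<^sup>2 / T)"
      using E by (intro mult_mono) auto
    finally show "norm (exp E - 1) \<le> exp (2 * R\<^sup>2 / T) * (2 * R\<^sup>2 / T)" .
  qed auto
  finally show ?thesis unfolding prod .
qed

lemma euler_product_uniform_limit:
  fixes S :: "nat \<Rightarrow> nat set" and T :: "nat \<Rightarrow> real" and \<omega> :: complex
  assumes S: "\<And>n. finite (S n)" "\<And>n p. p \<in> S n \<Longrightarrow> p \<ge> 1"
    and T: "\<And>n. T n = (\<Sum>p\<in>S n. 1 / real p)" "filterlim T at_top sequentially"
    and \<omega>: "norm \<omega> = 1" and K: "K \<subseteq> cball 0 R" "R > 0"
  shows "uniform_limit K (\<lambda>n z. \<Prod>p\<in>S n. 1 / (1 - \<omega> * z / of_real (T n * real p))) (\<lambda>z. exp (\<omega> * z)) sequentially"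
proof (rule uniform_limitI)
  fix \<epsilon> :: real assume "\<epsilon> > 0"
  have inv: "(\<lambda>n. 2 * R\<^sup>2 / T n) \<longlonglongrightarrow> 0"
    by (rule tendsto_divide_0[OF tendsto_const filterlim_at_top_imp_at_infinity[OF T(2)]])
  have "(\<lambda>n. exp R * (exp (2 * R\<^sup>2 / T n) * (2 * R\<^sup>2 / T n))) \<longlonglongrightarrow> exp R * (exp 0 * 0)"
    by (intro tendsto_intros inv)
  then have "\<forall>\<^sub>F n in sequentially. exp R * (exp (2 * R\<^sup>2 / T n) * (2 * R\<^sup>2 / T n)) < \<epsilon>"
    using \<open>\<epsilon> > 0\<close> by (simp add: order_tendstoD)
  moreover have "\<forall>\<^sub>F n in sequentially. T n \<ge> 2 * R"
    using T(2) by (simp add: filterlim_at_top)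
  ultimately show "\<forall>\<^sub>F n in sequentially. \<forall>z\<in>K.
      dist (\<Prod>p\<in>S n. 1 / (1 - \<omega> * z / of_real (T n * real p))) (exp (\<omega> * z)) < \<epsilon>"
  proof eventually_elim
    case (elim n)
    show ?case
    proof
      fix z assume "z \<in> K"
      then have "norm (\<omega> * z) \<le> R" using K \<omega> by (auto simp: norm_mult)
      moreover have "T n > 0" using elim K(2) by linarith
      ultimately show "dist (\<Prod>p\<in>S n. 1 / (1 - \<omega> * z / of_real (T n * real p))) (exp (\<omega> * z)) < \<epsilon>"
        using euler_product_near_exp[OF S(1)[of n] S(2)[of _ n] T(1)[of n], of "\<omega> * z" R] elim
        by (auto simp: dist_norm intro: order.strict_trans1)
    qed
  qed
qed

lemma deriv_exp_sum:
  fixes C \<omega> :: "'j \<Rightarrow> complex"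
  shows "(deriv ^^ k) (\<lambda>z. \<Sum>j\<in>J. C j * exp (\<omega> j * z)) = (\<lambda>z. \<Sum>j\<in>J. C j * \<omega> j ^ k * exp (\<omega> j * z))"
proof (induction k)
  case (Suc k)
  have "deriv (\<lambda>z. \<Sum>j\<in>J. C j * \<omega> j ^ k * exp (\<omega> j * z)) z = (\<Sum>j\<in>J. C j * \<omega> j ^ Suc k * exp (\<omega> j * z))" for z
    by (rule DERIV_imp_deriv) (auto intro!: derivative_eq_intros sum.cong simp: algebra_simps)
  then show ?case using Suc by simp
qed simp

lemma uniform_limit_sum:
  fixes f :: "'j \<Rightarrow> 'n \<Rightarrow> 'a \<Rightarrow> 'b::real_normed_vector"
  assumes "\<And>j. j \<in> J \<Longrightarrow> uniform_limit K (f j) (g j) F"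
  shows "uniform_limit K (\<lambda>n z. \<Sum>j\<in>J. f j n z) (\<lambda>z. \<Sum>j\<in>J. g j z) F"
  using assms
  by (induction J rule: infinite_finite_induct) (auto intro!: uniform_limit_intros)

text \<open>The products tend to exp (\<omega> j z) locally uniformly, so Hurwitz's theorem keeps
  the limit G zero-free. A constant G falls outside Hurwitz's theorem, but its value is G 0, the
  nonzero sum of the C j. The conclusion compares the derivatives of G and of c exp (\<mu> z) at
  0.\<close>

lemma exponential_sum_zero_free_limit:
  fixes J :: "'j set" and C \<omega> :: "'j \<Rightarrow> complex" and D :: "nat \<Rightarrow> 'j \<Rightarrow> complex"
    and S :: "nat \<Rightarrow> nat set" and T :: "nat \<Rightarrow> real"
  assumes S: "\<And>n. finite (S n)" "\<And>n p. p \<in> S n \<Longrightarrow> p \<ge> 1"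
    and T: "\<And>n. T n = (\<Sum>p\<in>S n. 1 / real p)" "\<And>n. T n \<ge> real n"
    and \<omega>: "\<And>j. j \<in> J \<Longrightarrow> norm (\<omega> j) = 1"
    and D: "\<And>j. j \<in> J \<Longrightarrow> (\<lambda>n. D n j) \<longlonglongrightarrow> C j" and C: "(\<Sum>j\<in>J. C j) \<noteq> 0"
    and nz: "\<And>n z. norm z < T n \<Longrightarrow>
      (\<Sum>j\<in>J. D n j * (\<Prod>p\<in>S n. 1 / (1 - \<omega> j * z / of_real (T n * real p)))) \<noteq> 0"
  shows "\<exists>c \<mu>. \<forall>k. (\<Sum>j\<in>J. C j * \<omega> j ^ k) = c * \<mu> ^ k"
proof -
  define G where "G z = (\<Sum>j\<in>J. C j * exp (\<omega> j * z))" for z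
  define F where "F n z = (\<Sum>j\<in>J. D n j * (\<Prod>p\<in>S n. 1 / (1 - \<omega> j * z / of_real (T n * real p))))" for n z
  have T_lim: "filterlim T at_top sequentially"
    by (rule filterlim_at_top_mono[OF filterlim_real_sequentially]) (use T in auto)
  have G_nz: "G z0 \<noteq> 0" for z0
  proof (cases "G constant_on ball 0 (norm z0 + 1)")
    case True
    then obtain c where "\<And>z. z \<in> ball 0 (norm z0 + 1) \<Longrightarrow> G z = c" by (auto simp: constant_on_def)
    from this[of z0] this[of 0] have "G z0 = G 0" by (simp add: add_nonneg_pos)
    then show ?thesis using C by (simp add: G_def)
  next
    case False
    define R where "R = norm z0 + 1"
    have "R > 0" by (simp add: R_def add_nonneg_pos)
    \<comment> \<open>T n \<ge> n, so after a shift by k every function of the sequence is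
      holomorphic and zero-free on the whole ball of radius R.\<close>
    define k where "k = nat \<lceil>R\<rceil>"
    have k: "T (n + k) \<ge> R" for n
    proof -
      have "R \<le> real k" unfolding k_def by linarith
      also have "\<dots> \<le> real (n + k)" by simp
      also have "\<dots> \<le> T (n + k)" by (rule T)
      finally show ?thesis .
    qed
    show ?thesis
    proof (rule Hurwitz_no_zeros[of "ball 0 R" "\<lambda>n. F (n + k)" G])
      show "F (n + k) holomorphic_on ball 0 R" for n
        unfolding F_def
      proof (intro holomorphic_intros)
        fix j and z :: complex and p assume j: "j \<in> J" and p: "p \<in> S (n + k)" and z: "z \<in> ball 0 R"
        have Tp: "T (n + k) * real p \<ge> T (n + k) * 1"
          using S(2)[OF p] k[of n] \<open>R > 0\<close> by (intro mult_left_mono) auto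
        then have pos: "T (n + k) * real p > 0" using k[of n] \<open>R > 0\<close> by linarith
        then show "complex_of_real (T (n + k) * real p) \<noteq> 0"
          by (metis less_irrefl of_real_eq_0_iff)
        have "norm (\<omega> j * z / of_real (T (n + k) * real p)) < 1"
        proof -
          have "norm (\<omega> j * z / of_real (T (n + k) * real p)) = norm z / (T (n + k) * real p)"
            unfolding norm_divide norm_mult norm_of_real using \<omega>[OF j] pos by simp
          moreover have "norm z < T (n + k) * real p" using z Tp k[of n] by simp
          ultimately show ?thesis using pos by (simp only: divide_less_eq_1_pos)
        qed
        then show "1 - \<omega> j * z / of_real (T (n + k) * real p) \<noteq> 0" by auto
      qed
      show "G holomorphic_on ball 0 R"
        unfolding G_def by (intro holomorphic_intros)
      show "uniform_limit K (\<lambda>n. F (n + k)) G sequentially" if K: "compact K" "K \<subseteq> ball 0 R" for K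
      proof -
        have K': "K \<subseteq> cball 0 R" using K(2) ball_subset_cball by blast
        have "uniform_limit K F G sequentially"
          unfolding F_def G_def
        proof (rule uniform_limit_sum)
          fix j assume j: "j \<in> J"
          have D': "uniform_limit K (\<lambda>n z. D n j) (\<lambda>z. C j) sequentially"
            using D[OF j] unfolding uniform_limit_iff tendsto_iff by (auto elim!: eventually_mono)
          have E': "uniform_limit K (\<lambda>n z. \<Prod>p\<in>S n. 1 / (1 - \<omega> j * z / of_real (T n * real p)))
              (\<lambda>z. exp (\<omega> j * z)) sequentially"
            by (rule euler_product_uniform_limit[OF S T(1) T_lim \<omega>[OF j] K' \<open>R > 0\<close>])
          have b1: "bounded ((\<lambda>z. exp (\<omega> j * z)) ` K)"
            by (intro compact_imp_bounded compact_continuous_image K continuous_intros)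
          have b2: "bounded ((\<lambda>z. C j) ` K)"
            by (rule bounded_subset[of "{C j}"]) auto
          show "uniform_limit K (\<lambda>n z. D n j * (\<Prod>p\<in>S n. 1 / (1 - \<omega> j * z / of_real (T n * real p))))
              (\<lambda>z. C j * exp (\<omega> j * z)) sequentially"
            by (rule uniform_lim_mult[OF D' E' b2 b1])
        qed
        then show ?thesis
          by (rule filterlim_compose[OF _ filterlim_add_const_nat_at_top])
      qed
      show "\<not> G constant_on ball 0 R" using False by (simp add: R_def)
      show "F (n + k) z \<noteq> 0" if "z \<in> ball 0 R" for n z
        unfolding F_def using that k[of n] by (intro nz) simp
      show "z0 \<in> ball 0 R" by (simp add: R_def)
    qed auto
  qed
  have "norm (G z) \<le> (\<Sum>j\<in>J. norm (C j)) * exp (norm z)" for z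
    unfolding G_def sum_distrib_right
  proof (rule sum_norm_le)
    fix j assume "j \<in> J"
    then have "norm (exp (\<omega> j * z)) \<le> exp (norm z)"
      using norm_exp[of "\<omega> j * z"] \<omega> by (simp add: norm_mult)
    then show "norm (C j * exp (\<omega> j * z)) \<le> norm (C j) * exp (norm z)"
      by (simp add: norm_mult mult_left_mono)
  qed
  moreover have "G holomorphic_on UNIV"
    unfolding G_def by (intro holomorphic_intros)
  ultimately obtain c \<mu> where c: "\<And>z. G z = c * exp (\<mu> * z)"
    using entire_nonvanishing_exponential_type G_nz by blast
  have "(\<Sum>j\<in>J. C j * \<omega> j ^ k) = c * \<mu> ^ k" for k
  proof -
    have "(deriv ^^ k) G 0 = (\<Sum>j\<in>J. C j * \<omega> j ^ k)"
      unfolding G_def[abs_def] deriv_exp_sum by simp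
    moreover have "G = (\<lambda>z. \<Sum>j\<in>{()}. c * exp (\<mu> * z))" using c by auto
    then have "(deriv ^^ k) G 0 = c * \<mu> ^ k"
      by (simp only: deriv_exp_sum) simp
    ultimately show ?thesis by simp
  qed
  then show ?thesis by blast
qed

section \<open>Completely multiplicative functions and sieving\<close>

text \<open>The value at 0 is 1, the empty product; multiplicativity therefore holds for positive
  arguments only, and the terms at 0 in later series vanish through division by 0.\<close>

definition compl_mult :: "(nat \<Rightarrow> complex) \<Rightarrow> nat \<Rightarrow> complex" where
  "compl_mult z n = (\<Prod>p\<in>#prime_factorization n. z p)"

lemma compl_mult_1 [simp]: "compl_mult z (Suc 0) = 1"
  by (simp add: compl_mult_def)

lemma compl_mult_mult: "m \<ge> 1 \<Longrightarrow> n \<ge> 1 \<Longrightarrow> compl_mult z (m * n) = compl_mult z m * compl_mult z n"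
  by (simp add: compl_mult_def prime_factorization_mult)

lemma compl_mult_prime: "prime p \<Longrightarrow> compl_mult z p = z p"
  by (simp add: compl_mult_def prime_factorization_prime)

lemma compl_mult_eq_power:
  assumes "n \<ge> 1" "\<And>p. prime p \<Longrightarrow> p dvd n \<Longrightarrow> z p = 1 / of_nat p ^ s"
  shows "compl_mult z n = 1 / of_nat n ^ s"
proof -
  have "(\<Prod>p\<in>#M. z p) = 1 / of_nat (\<Prod>\<^sub># M) ^ s" if "\<And>p. p \<in># M \<Longrightarrow> z p = 1 / of_nat p ^ s" for M
    using that by (induction M) (auto simp: power_mult_distrib)
  from this[of "prime_factorization n"] show ?thesis
    using assms by (simp add: compl_mult_def in_prime_factors_iff)
qed

lemma norm_compl_mult_le:
  assumes "n \<ge> 1" "\<And>p. prime p \<Longrightarrow> p dvd n \<Longrightarrow> norm (z p) \<le> 1 / real p"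
  shows "norm (compl_mult z n) \<le> 1 / real n"
proof -
  have "norm (\<Prod>p\<in>#M. z p) \<le> 1 / real (\<Prod>\<^sub># M)" if "\<And>p. p \<in># M \<Longrightarrow> norm (z p) \<le> 1 / real p" for M
    using that
  proof (induction M)
    case (add x M)
    then have "norm (z x) * norm (\<Prod>p\<in>#M. z p) \<le> 1 / real x * (1 / real (\<Prod>\<^sub># M))"
      by (intro mult_mono) auto
    then show ?case by (simp add: norm_mult)
  qed simp
  from this[of "prime_factorization n"] show ?thesis
    using assms by (simp add: compl_mult_def in_prime_factors_iff)
qed

text \<open>The multiples of p below M are p times numbers below M, so a partial sum P satisfies P
  \<le> K + \<kappa> P, where K is the sum over the non-multiples.\<close>

lemma summable_of_summable_not_dvd:
  fixes v :: "nat \<Rightarrow> real"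
  assumes v: "\<And>n. v n \<ge> 0" and p: "p \<ge> 1" and \<kappa>: "0 \<le> \<kappa>" "\<kappa> < 1"
    and vp: "\<And>n. v (p * n) = \<kappa> * v n"
    and s: "summable (\<lambda>n. if p dvd n then 0 else v n)"
  shows "summable v"
proof (rule summableI_nonneg_bounded[OF v])
  fix M :: nat
  define K where "K = (\<Sum>n. if p dvd n then 0 else v n)"
  define P where "P = (\<Sum>n<M. v n)"
  have "P = (\<Sum>n<M. if p dvd n then 0 else v n) + (\<Sum>n<M. if p dvd n then v n else 0)"
    unfolding P_def by (subst sum.distrib[symmetric]) (auto intro: sum.cong)
  also have "(\<Sum>n<M. if p dvd n then 0 else v n) \<le> K"
    unfolding K_def by (rule sum_le_suminf[OF s]) (use v in auto)
  also have "(\<Sum>n<M. if p dvd n then v n else 0) \<le> \<kappa> * P"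
  proof -
    have "(\<Sum>n<M. if p dvd n then v n else 0) = (\<Sum>n\<in>{n. n < M \<and> p dvd n}. v n)"
      by (subst sum.inter_filter[symmetric]) (auto simp: lessThan_def intro: sum.cong)
    also have "\<dots> \<le> (\<Sum>n\<in>(*) p ` {..<M}. v n)"
    proof (rule sum_mono2)
      show "{n. n < M \<and> p dvd n} \<subseteq> (*) p ` {..<M}"
      proof
        fix n assume "n \<in> {n. n < M \<and> p dvd n}"
        then obtain m where m: "n = p * m" "n < M" by auto
        then have "m < M" using p by (cases p) auto
        with m show "n \<in> (*) p ` {..<M}" by auto
      qed
    qed (use v in auto)
    also have "\<dots> = (\<Sum>n<M. v (p * n))"
      using p by (subst sum.reindex) (auto intro: inj_onI)
    also have "\<dots> = \<kappa> * P" by (simp add: vp P_def sum_distrib_left)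
    finally show ?thesis .
  qed
  finally have "(1 - \<kappa>) * P \<le> K" by (simp add: algebra_simps)
  then show "P \<le> K / (1 - \<kappa>)"
    using \<kappa> by (simp add: field_simps)
qed

lemma summable_of_summable_coprime:
  fixes v :: "nat \<Rightarrow> real"
  assumes "finite S" "\<forall>p\<in>S. prime p" "\<And>n. v n \<ge> 0"
    and "\<And>p. p \<in> S \<Longrightarrow> 0 \<le> \<kappa> p \<and> \<kappa> p < 1 \<and> (\<forall>n. v (p * n) = \<kappa> p * v n)"
    and "summable (\<lambda>n. if \<exists>p\<in>S. p dvd n then 0 else v n)"
  shows "summable v"
  using assms
proof (induction S arbitrary: v)
  case (insert p S)
  let ?v = "\<lambda>n. if p dvd n then 0 else v n"
  have p: "prime p" using insert by auto
  have "summable ?v"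
  proof (rule insert.IH)
    show "summable (\<lambda>n. if \<exists>p\<in>S. p dvd n then 0 else ?v n)"
      using insert.prems(4) by (rule summable_cong[THEN iffD1, rotated]) auto
    fix q assume q: "q \<in> S"
    then have "p dvd q * n \<longleftrightarrow> p dvd n" for n
      using insert p by (metis prime_dvd_mult_iff primes_dvd_imp_eq insertCI)
    then show "0 \<le> \<kappa> q \<and> \<kappa> q < 1 \<and> (\<forall>n. ?v (q * n) = \<kappa> q * ?v n)"
      using insert.prems(3)[of q] q by auto
  qed (use insert in auto)
  then show ?case
    using insert.prems(3)[of p] p prime_ge_1_nat insert.prems(2)
    by (intro summable_of_summable_not_dvd[of v p "\<kappa> p"]) auto
qed simp

lemma summable_compl_mult_square:
  assumes S: "finite S" "\<forall>p\<in>S. prime p" "\<And>p. p \<in> S \<Longrightarrow> norm (z p) < 1"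
    and z: "\<And>p. prime p \<Longrightarrow> p \<notin> S \<Longrightarrow> norm (z p) \<le> 1 / real p"
  shows "summable (\<lambda>n. (norm (compl_mult z n))\<^sup>2)"
proof -
  \<comment> \<open>The term at 0 is reset to 0, since the homogeneity v (p n) = \<kappa> v n with
    \<kappa> < 1 fails for the value 1 at n = 0.\<close>
  let ?v = "\<lambda>n. if n = 0 then 0 else (norm (compl_mult z n))\<^sup>2"
  have "summable ?v"
  proof (rule summable_of_summable_coprime[OF S(1,2), where \<kappa> = "\<lambda>p. (norm (z p))\<^sup>2"])
    fix p assume p: "p \<in> S"
    then have "prime p" using S by auto
    then have "?v (p * n) = (norm (z p))\<^sup>2 * ?v n" for n
      using compl_mult_mult[of p n z] compl_mult_prime[of p z] prime_ge_1_nat[of p]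
      by (auto simp: norm_mult power_mult_distrib)
    moreover have "(norm (z p))\<^sup>2 < 1"
      using S(3)[OF p] by (simp add: power_less_one_iff)
    ultimately show "0 \<le> (norm (z p))\<^sup>2 \<and> (norm (z p))\<^sup>2 < 1 \<and> (\<forall>n. ?v (p * n) = (norm (z p))\<^sup>2 * ?v n)"
      by auto
  next
    show "summable (\<lambda>n. if \<exists>p\<in>S. p dvd n then 0 else ?v n)"
    proof (rule summable_comparison_test[OF _ summable_inverse_squares], intro exI allI impI)
      fix n :: nat
      show "norm (if \<exists>p\<in>S. p dvd n then 0 else ?v n) \<le> 1 / (real n)\<^sup>2"
      proof (cases "(\<exists>p\<in>S. p dvd n) \<or> n = 0")
        case False
        then have "norm (compl_mult z n) \<le> 1 / real n"
          using z by (intro norm_compl_mult_le) auto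
        then have "(norm (compl_mult z n))\<^sup>2 \<le> (1 / real n)\<^sup>2"
          by (intro power_mono) auto
        then show ?thesis using False by (auto simp: power_divide)
      qed auto
    qed
  qed auto
  then show ?thesis
    by (rule summable_cong[THEN iffD1, rotated]) (auto simp: eventually_sequentially intro!: exI[of _ 1])
qed

lemma suminf_not_dvd:
  fixes v :: "nat \<Rightarrow> complex"
  assumes s: "summable v" and p: "p \<ge> 1" and vp: "\<And>n. v (p * n) = \<kappa> * v n"
  shows "(\<Sum>n. if p dvd n then 0 else v n) = (1 - \<kappa>) * (\<Sum>n. v n)"
proof -
  have "(\<lambda>n. \<kappa> * v n) sums (\<kappa> * (\<Sum>n. v n))"
    using s by (intro sums_mult summable_sums)
  then have "dil p (\<lambda>n. \<kappa> * v n) sums (\<kappa> * (\<Sum>n. v n))"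
    using p by (simp add: dil_sums_iff)
  then have "(\<lambda>n. v n - dil p (\<lambda>n. \<kappa> * v n) n) sums ((\<Sum>n. v n) - \<kappa> * (\<Sum>n. v n))"
    using s by (intro sums_diff summable_sums)
  moreover have "(\<lambda>n. v n - dil p (\<lambda>n. \<kappa> * v n) n) = (\<lambda>n. if p dvd n then 0 else v n)"
    using vp p by (auto simp: dil_def fun_eq_iff simp flip: vp)
  ultimately show ?thesis by (simp add: sums_iff algebra_simps)
qed

text \<open>The multiples of p carry the share \<kappa> p of the sum, so each sieving prime
  contributes its inverse Euler factor. Divisibility by one prime is unaffected by multiplication by
  another, so the primes can be sieved one at a time.\<close>

lemma suminf_coprime_sieve:
  fixes u :: "nat \<Rightarrow> complex"
  assumes "finite S" "\<forall>p\<in>S. prime p" "summable (\<lambda>n. norm (u n))"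
    and "\<And>p n. p \<in> S \<Longrightarrow> u (p * n) = \<kappa> p * u n"
  shows "(\<Sum>n. if \<exists>p\<in>S. p dvd n then 0 else u n) = (\<Prod>p\<in>S. 1 - \<kappa> p) * (\<Sum>n. u n)"
  using assms
proof (induction S)
  case (insert p S)
  let ?v = "\<lambda>n. if \<exists>q\<in>S. q dvd n then 0 else u n"
  have p: "prime p" using insert by auto
  have "q dvd p * n \<longleftrightarrow> q dvd n" if "q \<in> S" for q n
    using insert p that by (metis prime_dvd_mult_iff primes_dvd_imp_eq insertCI)
  then have vp: "?v (p * n) = \<kappa> p * ?v n" for n
    using insert.prems(3)[of p n] by auto
  have "summable ?v"
    by (rule summable_comparison_test[OF _ insert.prems(2)]) auto
  from suminf_not_dvd[OF this prime_ge_1_nat[OF p] vp]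
  have "(\<Sum>n. if p dvd n then 0 else ?v n) = (1 - \<kappa> p) * (\<Sum>n. ?v n)" .
  moreover have "(\<lambda>n. if p dvd n then 0 else ?v n) = (\<lambda>n. if \<exists>q\<in>insert p S. q dvd n then 0 else u n)"
    by auto
  ultimately show ?case using insert by simp
qed simp

lemma summable_mult_compl_mult:
  fixes g \<Lambda> :: "nat \<Rightarrow> complex"
  assumes \<Lambda>: "summable (\<lambda>n. (norm (\<Lambda> n))\<^sup>2)" and g: "\<And>n. norm (g n) \<le> B"
  shows "summable (\<lambda>n. norm (\<Lambda> n * g n / of_nat n))"
proof (rule summable_comparison_test)
  show "summable (\<lambda>n. B * ((norm (\<Lambda> n))\<^sup>2 + 1 / (real n)\<^sup>2))"
    using \<Lambda> summable_inverse_squares by (intro summable_mult summable_add)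
  have "norm (norm (\<Lambda> n * g n / of_nat n)) \<le> B * ((norm (\<Lambda> n))\<^sup>2 + 1 / (real n)\<^sup>2)" for n
  proof -
    have "0 \<le> (norm (\<Lambda> n) - 1 / real n)\<^sup>2" by simp
    then have "2 * (norm (\<Lambda> n) * (1 / real n)) \<le> (norm (\<Lambda> n))\<^sup>2 + 1 / (real n)\<^sup>2"
      unfolding power2_diff by (simp add: power_divide)
    moreover have "0 \<le> norm (\<Lambda> n) * (1 / real n)" by simp
    ultimately have le: "norm (\<Lambda> n) * (1 / real n) \<le> (norm (\<Lambda> n))\<^sup>2 + 1 / (real n)\<^sup>2" by linarith
    have "norm (norm (\<Lambda> n * g n / of_nat n)) = norm (g n) * (norm (\<Lambda> n) * (1 / real n))"
      by (simp add: norm_mult norm_divide)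
    also have "\<dots> \<le> B * ((norm (\<Lambda> n))\<^sup>2 + 1 / (real n)\<^sup>2)"
      using g[of n] order_trans[OF norm_ge_zero g] by (intro mult_mono le) auto
    finally show ?thesis .
  qed
  then show "\<exists>N. \<forall>n\<ge>N. norm (norm (\<Lambda> n * g n / of_nat n)) \<le> B * ((norm (\<Lambda> n))\<^sup>2 + 1 / (real n)\<^sup>2)"
    by blast
qed

section \<open>Dirichlet series of bounded sequences\<close>

lemma inverse_power_le_inverse_square:
  assumes "m \<ge> 1"
  shows "1 / real m ^ (s + 2) \<le> 1 / (real m)\<^sup>2"
  using assms by (intro frac_le power_increasing) auto

lemma norm_dirichlet_term_le:
  fixes g :: "nat \<Rightarrow> 'a::real_normed_field"
  assumes "\<And>n. norm (g n) \<le> B"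
  shows "norm (g m / of_nat m ^ (s + 2)) \<le> B * (1 / (real m)\<^sup>2)"
proof (cases "m = 0")
  case False
  then have "norm (g m) * (1 / real m ^ (s + 2)) \<le> B * (1 / (real m)\<^sup>2)"
    using assms order_trans[OF norm_ge_zero assms]
    by (intro mult_mono inverse_power_le_inverse_square) auto
  then show ?thesis by (simp only: norm_divide norm_power norm_of_nat) simp
qed simp

lemma summable_dirichlet:
  fixes g :: "nat \<Rightarrow> 'a::{real_normed_field, banach}"
  assumes "\<And>n. norm (g n) \<le> B"
  shows "summable (\<lambda>m. g m / of_nat m ^ (s + 2))"
  by (rule summable_comparison_test[OF _ summable_mult[OF summable_inverse_squares, of B]])
     (intro exI allI impI norm_dirichlet_term_le[OF assms])

text \<open>After scaling, the factors (m0/m)^(s+2) with m > m0 tend to 0 and are at most (m0/m)^2,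
  so Tannery's theorem leaves only the term at m0.\<close>

lemma dirichlet_leading_coeff:
  fixes g :: "nat \<Rightarrow> real"
  assumes B: "\<And>n. \<bar>g n\<bar> \<le> B" and m0: "m0 \<ge> 1" and vanish: "\<And>m. 1 \<le> m \<Longrightarrow> m < m0 \<Longrightarrow> g m = 0"
  shows "(\<lambda>s. real m0 ^ (s + 2) * (\<Sum>m. g m / real m ^ (s + 2))) \<longlonglongrightarrow> g m0"
proof -
  define t where "t m s = g m * (real m0 / real m) ^ (s + 2)" for m s
  have "(\<lambda>s. \<Sum>m. t m s) \<longlonglongrightarrow> (\<Sum>m. if m = m0 then g m0 else 0)"
  proof (rule tannerys_theorem[THEN conjunct2, THEN conjunct2])
    fix m
    consider "m = 0" | "1 \<le> m" "m < m0" | "m = m0" | "m > m0" by linarith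
    then show "t m \<longlonglongrightarrow> (if m = m0 then g m0 else 0)"
    proof cases
      case 4
      then have "(\<lambda>s. g m * (real m0 / real m) ^ (s + 2)) \<longlonglongrightarrow> g m * 0"
        by (intro tendsto_mult tendsto_const LIMSEQ_ignore_initial_segment LIMSEQ_power_zero) auto
      then show ?thesis using 4 by (simp add: t_def[abs_def])
    qed (use m0 vanish in \<open>auto simp: t_def[abs_def]\<close>)
  next
    have "norm (t m s) \<le> B * (real m0)\<^sup>2 * (1 / (real m)\<^sup>2)" for m s
    proof (cases "m < m0")
      case True
      then have "t m s = 0" using vanish[of m] by (cases "m = 0") (auto simp: t_def)
      then show ?thesis using B[of 0] by auto
    next
      case False
      then have "(real m0 / real m) ^ (s + 2) \<le> (real m0 / real m) ^ 2"
        using m0 by (intro power_decreasing) auto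
      then have "\<bar>g m\<bar> * (real m0 / real m) ^ (s + 2) \<le> B * (real m0 / real m) ^ 2"
        using B[of m] order_trans[OF abs_ge_zero B] by (intro mult_mono) auto
      then show ?thesis by (simp add: t_def abs_mult power_divide)
    qed
    then show "\<forall>\<^sub>F (m, s) in at_top \<times>\<^sub>F sequentially. norm (t m s) \<le> B * (real m0)\<^sup>2 * (1 / (real m)\<^sup>2)"
      by (intro always_eventually) auto
    show "summable (\<lambda>m. B * (real m0)\<^sup>2 * (1 / (real m)\<^sup>2))"
      by (intro summable_mult summable_inverse_squares)
  qed simp
  moreover have "(\<Sum>m. if m = m0 then g m0 else 0) = g m0"
    using sums_single[of m0 "\<lambda>_. g m0"] by (simp add: sums_iff)
  moreover have "(\<Sum>m. t m s) = real m0 ^ (s + 2) * (\<Sum>m. g m / real m ^ (s + 2))" for s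
  proof -
    have "t m s = real m0 ^ (s + 2) * (g m / real m ^ (s + 2))" for m
      by (simp add: t_def power_divide)
    moreover have "summable (\<lambda>m. g m / real m ^ (s + 2))"
      using summable_dirichlet[of g B s] B by simp
    ultimately show ?thesis by (simp only: suminf_mult)
  qed
  ultimately show ?thesis by simp
qed

lemma dirichlet_eventually_nonzero:
  fixes g :: "nat \<Rightarrow> real"
  assumes "\<And>n. \<bar>g n\<bar> \<le> B" "g 1 \<noteq> 0"
  shows "\<forall>\<^sub>F s in sequentially. (\<Sum>m. g m / real m ^ (s + 2)) \<noteq> 0"
proof -
  have "(\<lambda>s. \<Sum>m. g m / real m ^ (s + 2)) \<longlonglongrightarrow> g 1"
    using dirichlet_leading_coeff[of g B 1] assms(1) by simp
  then show ?thesis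
    by (rule tendsto_imp_eventually_ne) (rule assms(2))
qed

text \<open>Vanishing for infinitely many s is assumed, since the sign obtained for each s may
  change with s.\<close>

lemma dirichlet_uniqueness:
  fixes g :: "nat \<Rightarrow> real"
  assumes B: "\<And>n. \<bar>g n\<bar> \<le> B" and zero: "\<exists>\<^sub>F s in sequentially. (\<Sum>m. g m / real m ^ (s + 2)) = 0"
    and "m \<ge> 1"
  shows "g m = 0"
  using \<open>m \<ge> 1\<close>
proof (induction m rule: less_induct)
  case (less m)
  have "(\<lambda>s. real m ^ (s + 2) * (\<Sum>k. g k / real k ^ (s + 2))) \<longlonglongrightarrow> g m"
    using less by (intro dirichlet_leading_coeff[OF B]) auto
  show ?case
  proof (rule ccontr)
    assume "g m \<noteq> 0"
    then have "\<forall>\<^sub>F s in sequentially. real m ^ (s + 2) * (\<Sum>k. g k / real k ^ (s + 2)) \<noteq> 0"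
      using tendsto_imp_eventually_ne[OF \<open>(\<lambda>s. _ s) \<longlonglongrightarrow> g m\<close>] by blast
    then have "\<forall>\<^sub>F s in sequentially. (\<Sum>k. g k / real k ^ (s + 2)) \<noteq> 0"
      by (rule eventually_mono) auto
    then show False using zero by (simp add: frequently_def)
  qed
qed

section \<open>Residue classes containing many primes\<close>

definition heavy :: "nat \<Rightarrow> nat \<Rightarrow> bool" where
  "heavy N a \<longleftrightarrow> \<not> summable (\<lambda>p. if prime p \<and> p mod N = a mod N then 1 / real p else 0)"

lemma heavy_cong: "a mod N = b mod N \<Longrightarrow> heavy N a \<longleftrightarrow> heavy N b"
  by (simp add: heavy_def)

text \<open>The bound p > Y lets the sets move off to infinity, so that sieving by them has no
  effect in the limit.\<close>

lemma heavy_large_finite_set: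
  assumes "heavy N a"
  shows "\<exists>S. finite S \<and> (\<forall>p\<in>S. prime p \<and> p mod N = a mod N \<and> p > Y) \<and> (\<Sum>p\<in>S. 1 / real p) \<ge> T"
proof (rule ccontr)
  assume contra: "\<not> ?thesis"
  define t where "t p = (if prime p \<and> p mod N = a mod N then 1 / real p else 0)" for p
  have "summable t"
  proof (rule summableI_nonneg_bounded)
    fix n
    define S where "S = {p. p < n \<and> prime p \<and> p mod N = a mod N \<and> p > Y}"
    have "finite S" by (simp add: S_def)
    then have "\<not> (\<Sum>p\<in>S. 1 / real p) \<ge> T"
      using contra unfolding S_def by blast
    then have S: "(\<Sum>p\<in>S. 1 / real p) \<le> T" by simp
    have "(\<Sum>p<n. t p) \<le> (\<Sum>p\<in>{..Y} \<union> S. t p)"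
    proof -
      have "(\<Sum>p<n. t p) = (\<Sum>p\<in>{..<n} \<inter> ({..Y} \<union> S). t p)"
        by (rule sum.mono_neutral_right) (auto simp: t_def S_def)
      also have "\<dots> \<le> (\<Sum>p\<in>{..Y} \<union> S. t p)"
        by (rule sum_mono2) (use \<open>finite S\<close> in \<open>auto simp: t_def\<close>)
      finally show ?thesis .
    qed
    also have "\<dots> = (\<Sum>p\<le>Y. t p) + (\<Sum>p\<in>S. t p)"
      by (rule sum.union_disjoint) (use \<open>finite S\<close> in \<open>auto simp: S_def\<close>)
    also have "(\<Sum>p\<in>S. t p) = (\<Sum>p\<in>S. 1 / real p)"
      by (rule sum.cong) (auto simp: t_def S_def)
    finally show "(\<Sum>p<n. t p) \<le> (\<Sum>p\<le>Y. t p) + T" using S by linarith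
  qed (simp add: t_def)
  with assms show False by (simp add: heavy_def t_def[abs_def])
qed

text \<open>Units lift from N to N * K. Adding N times the primes that divide K but not u works: a
  prime divisor of K outside N divides exactly one of the two summands.\<close>

lemma coprime_lift:
  fixes u N K :: nat
  assumes "coprime u N" "K \<ge> 1"
  shows "\<exists>v. v mod N = u mod N \<and> coprime v (N * K)"
proof -
  define P where "P = {p. prime p \<and> p dvd K \<and> \<not> p dvd u}"
  have "finite P" unfolding P_def using assms(2) by (intro finite_subset[OF _ finite_divisors_nat]) auto
  define v where "v = u + N * \<Prod>P"
  have "coprime v (N * K)"
  proof (rule ccontr)
    assume "\<not> coprime v (N * K)"
    then have "gcd v (N * K) \<noteq> 1" using coprime_iff_gcd_eq_1 by metis
    then obtain p where "prime p" "p dvd gcd v (N * K)" using prime_factor_nat[of "gcd v (N * K)"] by blast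
    then have p: "prime p" "p dvd v" "p dvd N * K" by auto
    show False
    proof (cases "p dvd N")
      case True
      then have "p dvd u" using p(2) unfolding v_def by (metis dvd_add_left_iff dvd_mult2)
      with True assms(1) p(1) show False using coprime_common_divisor not_prime_unit by blast
    next
      case False
      then have pK: "p dvd K" using p by (simp add: prime_dvd_mult_iff)
      show False
      proof (cases "p dvd u")
        case True
        then have "p dvd N * \<Prod>P" using p(2) unfolding v_def by (simp add: dvd_add_right_iff)
        then have "p dvd \<Prod>P" using False p(1) by (simp add: prime_dvd_mult_iff)
        then obtain q where "q \<in> P" "p dvd q"
          using p(1) \<open>finite P\<close> by (auto simp: prime_dvd_prod_iff)
        then have "q = p" using p(1) primes_dvd_imp_eq[of p q] by (auto simp: P_def)
        with \<open>q \<in> P\<close> True show False by (simp add: P_def)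
      next
        case False
        with pK p(1) have "p \<in> P" by (simp add: P_def)
        then have "p dvd \<Prod>P" using \<open>finite P\<close> by (rule dvd_prodI[rotated])
        then have "p dvd u" using p(2) unfolding v_def by (metis dvd_add_left_iff dvd_mult)
        with False show False ..
      qed
    qed
  qed
  then show ?thesis by (intro exI[of _ v]) (simp add: v_def)
qed

text \<open>Write the terms divisible by q as q m. Since q is invertible modulo M, all m lie in one
  residue class, so the quotients m div M are distinct, and they are at most J. This saves a factor
  q over the whole progression.\<close>

lemma sum_inverse_progression_dvd:
  fixes v M q J :: nat
  assumes v: "v < M" and q: "q \<ge> 1" "coprime q M"
  shows "(\<Sum>j\<in>{j\<in>{1..J}. q dvd v + M * j}. 1 / real (v + M * j)) \<le>
    1 / real q * (1 + (\<Sum>i=1..J. 1 / real i) / real M)"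
proof -
  have "M > 0" using v by simp
  define A where "A = {j\<in>{1..J}. q dvd v + M * j}"
  define m where "m j = (v + M * j) div q" for j
  \<comment> \<open>The quotient i bounds 1/m by 1/(M i), except for i = 0, where only m \<ge> 1 is
    known.\<close>
  define w where "w i = (if i = 0 then 1 else 1 / real (M * i))" for i :: nat
  have qm: "v + M * j = q * m j" if "j \<in> A" for j
    using that by (auto simp: A_def m_def)
  have m_pos: "m j \<ge> 1" if "j \<in> A" for j
  proof (rule ccontr)
    assume "\<not> m j \<ge> 1"
    then have "m j = 0" by simp
    then have "M * j = 0" using qm[OF that] by simp
    then show False using \<open>M > 0\<close> that by (auto simp: A_def)
  qed
  have inj: "inj_on (\<lambda>j. m j div M) A"
  proof (rule inj_onI)
    fix x y assume xy: "x \<in> A" "y \<in> A" "m x div M = m y div M"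
    have "[q * m x = q * m y] (mod M)"
      unfolding qm[OF xy(1), symmetric] qm[OF xy(2), symmetric] by (simp add: cong_def)
    then have "[m x = m y] (mod M)"
      using q(2) by (simp add: cong_mult_lcancel_nat)
    then have "m x = m y"
      using xy(3) unfolding cong_def by (metis mult_div_mod_eq)
    then have "M * x = M * y"
      using qm[OF xy(1)] qm[OF xy(2)] by (metis add_left_cancel)
    then show "x = y" using \<open>M > 0\<close> by simp
  qed
  have img: "(\<lambda>j. m j div M) ` A \<subseteq> {0..J}"
  proof
    fix i assume "i \<in> (\<lambda>j. m j div M) ` A"
    then obtain j where j: "j \<in> A" "i = m j div M" by blast
    have "m j \<le> v + M * j" unfolding m_def by simp
    then have "i \<le> (v + M * j) div M" using j by (simp add: div_le_mono)
    also have "\<dots> = j" using v by simp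
    finally show "i \<in> {0..J}" using j by (simp add: A_def)
  qed
  have "(\<Sum>j\<in>A. 1 / real (v + M * j)) \<le> (\<Sum>j\<in>A. 1 / real q * w (m j div M))"
  proof (rule sum_mono)
    fix j assume j: "j \<in> A"
    have "1 / real (m j) \<le> w (m j div M)"
    proof (cases "m j div M = 0")
      case True
      then show ?thesis using m_pos[OF j] by (simp add: w_def)
    next
      case False
      have "M * (m j div M) \<le> m j" by simp
      then have "real (M * (m j div M)) \<le> real (m j)" by (simp only: of_nat_le_iff)
      then show ?thesis
        using False \<open>M > 0\<close> by (simp only: w_def if_False) (intro frac_le, auto)
    qed
    then have "1 / real q * (1 / real (m j)) \<le> 1 / real q * w (m j div M)"
      by (intro mult_left_mono) auto
    then show "1 / real (v + M * j) \<le> 1 / real q * w (m j div M)"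
      unfolding qm[OF j] by simp
  qed
  also have "\<dots> = 1 / real q * (\<Sum>i\<in>(\<lambda>j. m j div M) ` A. w i)"
    by (simp add: sum.reindex[OF inj] sum_distrib_left)
  also have "\<dots> \<le> 1 / real q * (\<Sum>i=0..J. w i)"
    using img by (intro mult_left_mono sum_mono2) (auto simp: w_def)
  also have "(\<Sum>i=0..J. w i) = 1 + (\<Sum>i=1..J. 1 / real i) / real M"
  proof -
    have "(\<Sum>i=0..J. w i) = w 0 + (\<Sum>i=1..J. w i)"
      by (simp add: sum.atLeast_Suc_atMost)
    also have "(\<Sum>i=1..J. w i) = (\<Sum>i=1..J. 1 / real i / real M)"
      by (intro sum.cong) (auto simp: w_def)
    finally show ?thesis by (simp add: w_def sum_divide_distrib)
  qed
  finally show ?thesis unfolding A_def .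
qed

lemma summable_light_primes:
  assumes "N \<ge> 1"
  shows "summable (\<lambda>p. if prime p \<and> \<not> heavy N p then 1 / real p else 0)"
proof -
  define t where "t a p = (if prime p \<and> p mod N = a mod N \<and> \<not> heavy N a then 1 / real p else 0)" for a p
  have "summable (t a)" for a
    by (cases "heavy N a") (auto simp: t_def[abs_def] heavy_def)
  then have "summable (\<lambda>p. \<Sum>a<N. t a p)"
    by (intro summable_sum) auto
  moreover have "(\<Sum>a<N. t a p) = (if prime p \<and> \<not> heavy N p then 1 / real p else 0)" for p
  proof -
    have "(\<Sum>a<N. t a p) = (\<Sum>a<N. if a = p mod N then (if prime p \<and> \<not> heavy N p then 1 / real p else 0) else 0)"
    proof (rule sum.cong)
      fix a assume "a \<in> {..<N}"
      then have "a mod N = a" by simp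
      then show "t a p = (if a = p mod N then (if prime p \<and> \<not> heavy N p then 1 / real p else 0) else 0)"
        using heavy_cong[of "p mod N" N p] by (auto simp: t_def)
    qed simp
    then show ?thesis using assms by (simp add: sum.delta)
  qed
  ultimately show ?thesis by simp
qed

text \<open>The light primes have a convergent sum of reciprocals, so after sieving out finitely many
  of them they are too sparse to meet every term of an arithmetic progression, measured with
  logarithmic weights. This replaces Dirichlet's theorem on primes in progressions.\<close>

lemma coprime_residue_heavy_representative:
  fixes u N :: nat
  assumes "N \<ge> 1" "coprime u N"
  shows "\<exists>n\<ge>1. n mod N = u mod N \<and> (\<forall>p. prime p \<and> p dvd n \<longrightarrow> heavy N p)"
proof (rule ccontr)
  assume contra: "\<not> ?thesis"
  define t where "t p = (if prime p \<and> \<not> heavy N p then 1 / real p else 0)" for p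
  have "summable t"
    unfolding t_def[abs_def] by (rule summable_light_primes[OF assms(1)])
  then obtain Y where Y: "norm (\<Sum>i. t (i + Y)) < 1 / 2"
    using suminf_exist_split[of "1 / 2" t] by (metis half_gt_zero_iff order_refl zero_less_one)
  \<comment> \<open>All small primes are put into the modulus. Terms coprime to it have prime
    factors at least Y only, and the light primes from Y on have reciprocal sum below 1/2.\<close>
  define K where "K = \<Prod>{q. prime q \<and> q < Y}"
  have "K \<ge> 1" unfolding K_def by (rule prod_ge_1) (auto dest: prime_ge_1_nat)
  define M where "M = N * K"
  have "M > 0" using assms(1) \<open>K \<ge> 1\<close> by (simp add: M_def)
  obtain v' where v': "v' mod N = u mod N" "coprime v' M"
    using coprime_lift[OF assms(2) \<open>K \<ge> 1\<close>] M_def by blast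
  define v where "v = v' mod M"
  have v: "v < M" "v mod N = u mod N" "coprime v M"
  proof -
    show "v < M" using \<open>M > 0\<close> by (simp add: v_def)
    show "v mod N = u mod N" using v'(1) by (simp add: v_def M_def mod_mod_cancel)
    show "coprime v M" using v'(2) \<open>M > 0\<close> by (simp add: v_def coprime_mod_left_iff)
  qed
  have big: "\<exists>q. prime q \<and> \<not> heavy N q \<and> q dvd v + M * j \<and> q \<ge> Y \<and> coprime q M" if "j \<ge> 1" for j
  proof -
    have "v + M * j \<ge> 1" using \<open>M > 0\<close> that by (simp add: Suc_le_eq)
    moreover have "(v + M * j) mod N = u mod N"
      using v(2) unfolding M_def by (metis mod_mult_self2 mult.assoc)
    ultimately obtain q where q: "prime q" "q dvd v + M * j" "\<not> heavy N q"
      using contra by blast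
    have "coprime ((v + M * j) mod M) M" using v(1,3) by simp
    then have "coprime (v + M * j) M"
      using \<open>M > 0\<close> coprime_mod_left_iff[of M "v + M * j"] by simp
    then have co: "coprime q M" using q(2) by (metis coprime_divisors dvd_refl)
    have "q \<ge> Y"
    proof (rule ccontr)
      assume "\<not> q \<ge> Y"
      then have "q dvd K" unfolding K_def using q(1) by (intro dvd_prodI) auto
      then have "q dvd M" by (simp add: M_def)
      with co q(1) show False by (meson coprime_common_divisor dvd_refl not_prime_unit)
    qed
    with q co show ?thesis by blast
  qed
  \<comment> \<open>If every term had a light prime factor, counting terms by these factors would
    bound the sum of the 1/(v + M j) by half of 1 + h J / M. That sum is at least (h J - 1) / M
    because v + M j \<le> M (j + 1). So h J \<le> M + 2, against the divergence of the harmonic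
    series.\<close>
  define h where "h J = (\<Sum>i=1..J. 1 / real i)" for J
  have bounded: "h J \<le> real M + 2" for J
  proof -
    define n where "n j = v + M * j" for j
    define Q where "Q = {q. prime q \<and> \<not> heavy N q \<and> q \<ge> Y \<and> coprime q M \<and> q \<le> n J}"
    have "finite Q" by (simp add: Q_def)
    have "(\<Sum>j=1..J. 1 / real (n j)) \<le> (\<Sum>j=1..J. \<Sum>q\<in>{q\<in>Q. q dvd n j}. 1 / real (n j))"
    proof (rule sum_mono)
      fix j assume j: "j \<in> {1..J}"
      then obtain q where q: "prime q" "\<not> heavy N q" "q dvd n j" "q \<ge> Y" "coprime q M"
        using big[of j] by (auto simp: n_def)
      have "n j > 0" using j \<open>M > 0\<close> by (simp add: n_def)
      then have "q \<le> n j" using q by (simp add: dvd_imp_le)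
      also have "\<dots> \<le> n J" using j by (simp add: n_def)
      finally have "q \<in> {q\<in>Q. q dvd n j}" using q by (simp add: Q_def)
      then have "1 \<le> card {q\<in>Q. q dvd n j}"
        using \<open>finite Q\<close> by (metis (no_types, lifting) One_nat_def Suc_leI card_gt_0_iff empty_iff finite_Collect_conjI finite_subset mem_Collect_eq subsetI)
      then have "1 / real (n j) \<le> real (card {q\<in>Q. q dvd n j}) * (1 / real (n j))"
        by (simp add: divide_right_mono)
      then show "1 / real (n j) \<le> (\<Sum>q\<in>{q\<in>Q. q dvd n j}. 1 / real (n j))" by simp
    qed
    also have "\<dots> = (\<Sum>q\<in>Q. \<Sum>j\<in>{j\<in>{1..J}. q dvd n j}. 1 / real (n j))"
      using \<open>finite Q\<close> by (intro sum.swap_restrict) auto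
    also have "\<dots> \<le> (\<Sum>q\<in>Q. 1 / real q * (1 + h J / real M))"
    proof (rule sum_mono)
      fix q assume "q \<in> Q"
      then show "(\<Sum>j\<in>{j\<in>{1..J}. q dvd n j}. 1 / real (n j)) \<le> 1 / real q * (1 + h J / real M)"
        unfolding n_def h_def
        by (intro sum_inverse_progression_dvd v(1)) (auto simp: Q_def dest: prime_ge_1_nat)
    qed
    also have "\<dots> = (\<Sum>q\<in>Q. 1 / real q) * (1 + h J / real M)"
      by (simp add: sum_distrib_right)
    also have "\<dots> \<le> 1 / 2 * (1 + h J / real M)"
    proof (rule mult_right_mono)
      have "(\<Sum>q\<in>Q. 1 / real q) = (\<Sum>q\<in>Q. t q)"
        by (rule sum.cong) (auto simp: Q_def t_def)
      also have "\<dots> = (\<Sum>i\<in>(\<lambda>q. q - Y) ` Q. t (i + Y))"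
        by (subst sum.reindex) (auto simp: inj_on_def Q_def)
      also have "\<dots> \<le> (\<Sum>i. t (i + Y))"
        using \<open>finite Q\<close> \<open>summable t\<close>
        by (intro sum_le_suminf summable_ignore_initial_segment) (simp_all, simp add: t_def)
      also have "\<dots> \<le> 1 / 2" using Y by simp
      finally show "(\<Sum>q\<in>Q. 1 / real q) \<le> 1 / 2" .
      show "0 \<le> 1 + h J / real M" by (auto simp: h_def intro!: add_nonneg_nonneg divide_nonneg_nonneg sum_nonneg)
    qed
    finally have upper: "(\<Sum>j=1..J. 1 / real (n j)) \<le> 1 / 2 * (1 + h J / real M)" .
    have "(h J - 1) / real M \<le> (\<Sum>j=1..J. 1 / real (n j))"
    proof -
      have "h J \<le> h (Suc J)" by (simp add: h_def)
      also have "h (Suc J) = 1 + (\<Sum>j=1..J. 1 / real (Suc j))"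
        unfolding h_def by (subst sum.atLeast_Suc_atMost) (simp_all only: sum.atLeast_Suc_atMost_Suc_shift One_nat_def, simp_all)
      finally have "(h J - 1) / real M \<le> (\<Sum>j=1..J. 1 / real (Suc j)) / real M"
        by (intro divide_right_mono) auto
      also have "\<dots> = (\<Sum>j=1..J. 1 / real (M * Suc j))"
        by (simp add: sum_divide_distrib algebra_simps)
      also have "\<dots> \<le> (\<Sum>j=1..J. 1 / real (n j))"
      proof (rule sum_mono)
        fix j assume "j \<in> {1..J}"
        then have "n j > 0" "n j \<le> M * Suc j" using \<open>M > 0\<close> v(1) by (auto simp: n_def)
        then show "1 / real (M * Suc j) \<le> 1 / real (n j)"
          by (intro frac_le) (auto simp del: of_nat_mult mult_Suc_right)
      qed
      finally show ?thesis .
    qed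
    then have "(h J - 1) / real M \<le> 1 / 2 * (1 + h J / real M)" using upper by linarith
    then have "real M * ((h J - 1) / real M) \<le> real M * (1 / 2 * (1 + h J / real M))"
      by (rule mult_left_mono) simp
    then have "h J - 1 \<le> 1 / 2 * (real M + h J)"
      using \<open>M > 0\<close> by (simp add: distrib_left)
    then show ?thesis by (simp add: field_simps)
  qed
  have "summable (\<lambda>n. 1 / real n)"
  proof (rule bounded_imp_summable)
    fix J
    have "(\<Sum>i\<le>J. 1 / real i) = h J"
      unfolding h_def by (rule sum.mono_neutral_right) (auto simp: not_le)
    then show "(\<Sum>i\<le>J. 1 / real i) \<le> real M + 2" using bounded by simp
  qed simp
  then show False
    using not_summable_harmonic[where 'a = real] by (simp add: inverse_eq_divide)
qed

section \<open>Periodic functions without multiplicative zeros\<close>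

definition eval_nonvanishing :: "(nat \<Rightarrow> real) \<Rightarrow> bool" where
  "eval_nonvanishing f \<longleftrightarrow> (\<forall>\<Lambda>. \<Lambda> 1 = 1 \<longrightarrow> (\<forall>m n. m \<ge> 1 \<longrightarrow> n \<ge> 1 \<longrightarrow> \<Lambda> (m * n) = \<Lambda> m * \<Lambda> n) \<longrightarrow>
     summable (\<lambda>n. (norm (\<Lambda> n))\<^sup>2) \<longrightarrow> (\<Sum>n. \<Lambda> n * of_real (f n) / of_nat n) \<noteq> (0 :: complex))"

lemma eval_nonvanishing_compl_mult:
  assumes "eval_nonvanishing f" "finite S" "\<forall>p\<in>S. prime p" "\<And>p. p \<in> S \<Longrightarrow> norm (z p) < 1"
    and "\<And>p. prime p \<Longrightarrow> p \<notin> S \<Longrightarrow> norm (z p) \<le> 1 / real p"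
  shows "(\<Sum>n. compl_mult z n * of_real (f n) / of_nat n) \<noteq> 0"
  using assms(1) compl_mult_mult[of _ _ z] summable_compl_mult_square[of S z] assms(2-)
  unfolding eval_nonvanishing_def by auto

section \<open>Eigenfunctions under multiplication by a residue class\<close>

definition unity_root :: "nat \<Rightarrow> nat \<Rightarrow> complex" where
  "unity_root r j = cis (2 * pi * real j / real r)"

lemma norm_unity_root [simp]: "norm (unity_root r j) = 1"
  by (simp add: unity_root_def)

lemma unity_root_power: "r \<ge> 1 \<Longrightarrow> unity_root r j ^ r = 1"
proof -
  assume "r \<ge> 1"
  then have "real r * (2 * pi * real j / real r) = 2 * pi * real j" by simp
  then have "unity_root r j ^ r = cis (2 * pi * real j)"
    by (simp only: unity_root_def Complex.DeMoivre)
  then show ?thesis by (simp add: cis_multiple_2pi)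
qed

lemma sum_unity_roots:
  assumes "k < r"
  shows "(\<Sum>j<r. cnj (unity_root r j) ^ k) = (if k = 0 then of_nat r else 0)"
proof (cases "k = 0")
  case False
  define z where "z = cnj (unity_root r k)"
  have eq: "cnj (unity_root r j) ^ k = z ^ j" for j
  proof -
    have "real k * - (2 * pi * real j / real r) = real j * - (2 * pi * real k / real r)" by simp
    then show ?thesis
      unfolding z_def unity_root_def cis_cnj Complex.DeMoivre by (simp only:)
  qed
  have "z ^ r = 1"
    using unity_root_power[of r k] assms by (simp add: z_def flip: complex_cnj_power)
  moreover have "z \<noteq> 1"
  proof
    assume "z = 1"
    then have "unity_root r k = 1" by (metis z_def complex_cnj_cnj complex_cnj_one)
    then have "cos (2 * pi * real k / real r) = 1"
      unfolding unity_root_def by (metis cis.simps(1) one_complex.simps(1))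
    then obtain i :: int where "2 * pi * real k / real r = of_int i * 2 * pi"
      using cos_one_2pi_int by blast
    then have "real k = of_int i * real r" using assms by (simp add: field_simps)
    then have "int k = i * int r" by (metis of_int_eq_iff of_int_mult of_int_of_nat_eq)
    then have "int r dvd int k" by simp
    then have "r dvd k" by simp
    then show False using assms False by (auto dest: dvd_imp_le)
  qed
  ultimately have "(\<Sum>j<r. z ^ j) = 0" by (simp add: sum_gp_strict)
  then show ?thesis using False by (simp only: eq) simp
qed simp

text \<open>A discrete Fourier transform along the orbit of n under a. For a^r = 1 modulo a period
  of f, it is the projection of f onto the eigenspace of n -> a n with eigenvalue
  \<open>unity_root r j\<close>.\<close>

definition eigenpart :: "nat \<Rightarrow> nat \<Rightarrow> (nat \<Rightarrow> real) \<Rightarrow> nat \<Rightarrow> nat \<Rightarrow> complex" where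
  "eigenpart a r f j n = (\<Sum>k<r. cnj (unity_root r j) ^ k * of_real (f (a ^ k * n))) / of_nat r"

lemma eigenpart_sum:
  assumes "r \<ge> 1"
  shows "(\<Sum>j<r. eigenpart a r f j n) = of_real (f n)"
proof -
  have "(\<Sum>j<r. eigenpart a r f j n) =
      (\<Sum>k<r. \<Sum>j<r. cnj (unity_root r j) ^ k * of_real (f (a ^ k * n))) / of_nat r"
    unfolding eigenpart_def by (subst sum.swap) (simp add: sum_divide_distrib)
  also have "\<dots> = (\<Sum>k<r. (if k = 0 then of_nat r * of_real (f n) else 0)) / of_nat r"
    by (intro arg_cong2[of _ _ _ _ "(/)"] sum.cong refl)
       (simp add: sum_unity_roots flip: sum_distrib_right)
  also have "\<dots> = of_real (f n)" using assms by (simp add: sum.delta)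
  finally show ?thesis .
qed

lemma eigenpart_bound:
  assumes "r \<ge> 1" "\<And>n. \<bar>f n\<bar> \<le> B"
  shows "norm (eigenpart a r f j n) \<le> B"
proof -
  have "norm (\<Sum>k<r. cnj (unity_root r j) ^ k * of_real (f (a ^ k * n))) \<le> (\<Sum>k<r. B)"
    using assms(2) by (intro sum_norm_le) (simp add: norm_mult norm_power)
  then show ?thesis using assms(1) by (simp add: eigenpart_def norm_divide field_simps)
qed

text \<open>Multiplying n by p shifts the index k by one; the sum is cyclic, since f and the roots
  of unity both return after r steps.\<close>

lemma eigenpart_mult:
  assumes r: "r \<ge> 1" and per: "\<And>m n. m mod N = n mod N \<Longrightarrow> f m = f n"
    and ar: "[a ^ r = 1] (mod N)" and p: "p mod N = a mod N"
  shows "eigenpart a r f j (p * n) = unity_root r j * eigenpart a r f j n"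
proof -
  let ?w = "unity_root r j"
  define g where "g k = cnj ?w ^ k * complex_of_real (f (a ^ k * n))" for k
  have w: "?w * cnj ?w = 1" by (simp add: complex_norm_square[symmetric])
  have "a ^ r * n mod N = n mod N"
    using ar by (metis cong_def cong_scalar_right mult_1)
  then have "f (a ^ r * n) = f n" by (rule per)
  moreover have "cnj ?w ^ r = 1" using unity_root_power[OF r, of j] by (simp flip: complex_cnj_power)
  ultimately have "g r = g 0" by (simp add: g_def)
  moreover have "g 0 + (\<Sum>k<r. g (Suc k)) = (\<Sum>k<r. g k) + g r"
    by (metis sum.lessThan_Suc sum.lessThan_Suc_shift)
  ultimately have shift: "(\<Sum>k<r. g (Suc k)) = (\<Sum>k<r. g k)" by simp
  have fk: "f (a ^ k * (p * n)) = f (a ^ Suc k * n)" for k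
  proof (rule per)
    have "[a ^ k * (p * n) = a ^ k * (a * n)] (mod N)"
      using p by (intro cong_mult cong_refl) (simp add: cong_def)
    then have "a ^ k * (p * n) mod N = a ^ k * (a * n) mod N"
      by (simp only: cong_def)
    moreover have "a ^ k * (a * n) = a ^ Suc k * n" by (simp add: mult_ac)
    ultimately show "a ^ k * (p * n) mod N = a ^ Suc k * n mod N" by (simp only:)
  qed
  have "cnj ?w ^ k * of_real (f (a ^ k * (p * n))) = ?w * g (Suc k)" for k
  proof -
    have "?w * cnj ?w ^ Suc k = (?w * cnj ?w) * cnj ?w ^ k" by simp
    also have "\<dots> = cnj ?w ^ k" by (simp only: w) simp
    finally show ?thesis unfolding g_def fk by (simp only: mult.assoc[symmetric])
  qed
  then have "eigenpart a r f j (p * n) = (\<Sum>k<r. ?w * g (Suc k)) / of_nat r"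
    unfolding eigenpart_def by (simp only:)
  also have "\<dots> = ?w * eigenpart a r f j n"
    unfolding eigenpart_def sum_distrib_left[symmetric] shift by (simp add: g_def)
  finally show ?thesis .
qed

text \<open>\<open>D n j\<close> is the Dirichlet series of the j-th eigenpart sieved by
  \<open>S n\<close>. Multiplied by the Euler factors belonging to the values t/T and summed over j,
  it is the functional of f at a completely multiplicative function, hence nonzero. This is the
  hypothesis of \<open>exponential_sum_zero_free_limit\<close>.\<close>

lemma heavy_class_dirichlet_ratio:
  fixes f :: "nat \<Rightarrow> real"
  assumes N: "N \<ge> 1" and per: "\<And>m n. m mod N = n mod N \<Longrightarrow> f m = f n" and B: "\<And>n. \<bar>f n\<bar> \<le> B"
    and nv: "eval_nonvanishing f" and a: "coprime a N" "heavy N a"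
    and H1: "(\<Sum>m. f m / real m ^ (s + 2)) \<noteq> 0"
  shows "\<exists>e\<in>{1, -1}. (\<Sum>m. f (a * m) / real m ^ (s + 2)) = e * (\<Sum>m. f m / real m ^ (s + 2))"
proof -
  define r where "r = totient N"
  have r: "r \<ge> 1" using N by (simp add: r_def Suc_le_eq)
  have ar: "[a ^ r = 1] (mod N)" unfolding r_def by (rule euler_theorem[OF a(1)])
  define \<omega> where "\<omega> j = unity_root r j" for j
  define F where "F j n = eigenpart a r f j n" for j n
  have F_sum: "(\<Sum>j<r. F j n) = of_real (f n)" for n
    unfolding F_def by (rule eigenpart_sum[OF r])
  have F_bound: "norm (F j n) \<le> B" for j n
    unfolding F_def by (rule eigenpart_bound[OF r B])
  have F_mult: "F j (p * n) = \<omega> j * F j n" if "p mod N = a mod N" for j p n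
    unfolding F_def \<omega>_def by (rule eigenpart_mult[OF r per ar that])
  have F_pow: "F j (a ^ k * n) = \<omega> j ^ k * F j n" for j k n
    by (induction k arbitrary: n) (simp_all add: F_mult mult.assoc mult.left_commute)
  have "\<forall>n. \<exists>S. finite S \<and> (\<forall>p\<in>S. prime p \<and> p mod N = a mod N \<and> p > n) \<and>
      (\<Sum>p\<in>S. 1 / real p) \<ge> real n + 1"
    using heavy_large_finite_set[OF a(2)] by blast
  from choice[OF this] obtain S where S':
      "\<forall>n. finite (S n) \<and> (\<forall>p\<in>S n. prime p \<and> p mod N = a mod N \<and> p > n) \<and>
      (\<Sum>p\<in>S n. 1 / real p) \<ge> real n + 1"
    by blast
  then have S: "\<And>n. finite (S n)" "\<And>n p. p \<in> S n \<Longrightarrow> prime p \<and> p mod N = a mod N \<and> p > n"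
      "\<And>n. (\<Sum>p\<in>S n. 1 / real p) \<ge> real n + 1"
    by blast+
  define T where "T n = (\<Sum>p\<in>S n. 1 / real p)" for n
  have T: "T n \<ge> real n + 1" for n using S(3) by (simp add: T_def)
  define C where "C j = (\<Sum>m. F j m / of_nat m ^ (s + 2))" for j
  define D where "D n j = (\<Sum>m. if \<exists>p\<in>S n. p dvd m then 0 else F j m / of_nat m ^ (s + 2))" for n j
  have D_lim: "(\<lambda>n. D n j) \<longlonglongrightarrow> C j" for j
    unfolding D_def C_def
  proof (rule tannerys_theorem[THEN conjunct2, THEN conjunct2])
    fix m
    have "\<forall>\<^sub>F n in sequentially. (if \<exists>p\<in>S n. p dvd m then 0 else F j m / of_nat m ^ (s + 2)) = F j m / of_nat m ^ (s + 2)"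
      using eventually_ge_at_top[of m]
    proof eventually_elim
      case (elim n)
      show ?case
      proof (cases "m = 0")
        case False
        then have "\<not> p dvd m" if "p \<in> S n" for p
          using S(2)[OF that] elim by (auto dest: dvd_imp_le)
        then show ?thesis by auto
      qed simp
    qed
    then show "(\<lambda>n. if \<exists>p\<in>S n. p dvd m then 0 else F j m / of_nat m ^ (s + 2)) \<longlonglongrightarrow> F j m / of_nat m ^ (s + 2)"
      by (rule tendsto_eventually)
  next
    have "norm (if \<exists>p\<in>S n. p dvd m then 0 else F j m / of_nat m ^ (s + 2)) \<le> B * (1 / (real m)\<^sup>2)" for m n
      using norm_dirichlet_term_le[of "F j" B m s, OF F_bound] order_trans[OF norm_ge_zero F_bound[of j 0]]
      by (auto simp del: power_Suc)
    then show "\<forall>\<^sub>F (m, n) in at_top \<times>\<^sub>F sequentially.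
        norm (if \<exists>p\<in>S n. p dvd m then 0 else F j m / of_nat m ^ (s + 2)) \<le> B * (1 / (real m)\<^sup>2)"
      by (intro always_eventually) auto
    show "summable (\<lambda>m. B * (1 / (real m)\<^sup>2))"
      by (intro summable_mult summable_inverse_squares)
  qed simp
  have C_pow: "(\<Sum>j<r. C j * \<omega> j ^ k) = of_real (\<Sum>m. f (a ^ k * m) / real m ^ (s + 2))" for k
  proof -
    have "C j * \<omega> j ^ k = (\<Sum>m. F j (a ^ k * m) / of_nat m ^ (s + 2))" for j
    proof -
      have "F j (a ^ k * m) / of_nat m ^ (s + 2) = \<omega> j ^ k * (F j m / of_nat m ^ (s + 2))" for m
        by (simp only: F_pow times_divide_eq_right)
      then show ?thesis
        unfolding C_def using summable_dirichlet[of "F j" B s, OF F_bound]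
        by (simp only: suminf_mult mult.commute)
    qed
    then have "(\<Sum>j<r. C j * \<omega> j ^ k) = (\<Sum>j<r. \<Sum>m. F j (a ^ k * m) / of_nat m ^ (s + 2))"
      by (simp only:)
    also have "\<dots> = (\<Sum>m. \<Sum>j<r. F j (a ^ k * m) / of_nat m ^ (s + 2))"
      by (rule suminf_sum[symmetric]) (rule summable_dirichlet[OF F_bound])
    also have "\<dots> = (\<Sum>m. of_real (f (a ^ k * m) / real m ^ (s + 2)))"
      by (simp only: sum_divide_distrib[symmetric] F_sum of_real_divide of_real_power of_real_of_nat_eq)
    also have "\<dots> = of_real (\<Sum>m. f (a ^ k * m) / real m ^ (s + 2))"
    proof (rule suminf_of_real[symmetric])
      show "summable (\<lambda>m. f (a ^ k * m) / real m ^ (s + 2))"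
        using summable_dirichlet[of "\<lambda>m. f (a ^ k * m)" B s] B by simp
    qed
    finally show ?thesis .
  qed
  have "\<exists>c \<mu>. \<forall>k. (\<Sum>j<r. C j * \<omega> j ^ k) = c * \<mu> ^ k"
  proof (rule exponential_sum_zero_free_limit[where S = S and T = T and D = D])
    show "finite (S n)" for n by (rule S)
    show "p \<ge> 1" if "p \<in> S n" for n p using S(2)[OF that] prime_ge_1_nat by auto
    show "T n = (\<Sum>p\<in>S n. 1 / real p)" for n by (simp add: T_def)
    show "T n \<ge> real n" for n using T[of n] by simp
    show "norm (\<omega> j) = 1" for j by (simp add: \<omega>_def)
    show "(\<lambda>n. D n j) \<longlonglongrightarrow> C j" for j by (rule D_lim)
    show "(\<Sum>j<r. C j) \<noteq> 0" using C_pow[of 0] H1 by simp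
    fix n and t :: complex assume t: "norm t < T n"
    have Tpos: "T n > 0" using T[of n] by simp
    \<comment> \<open>|z p| < 1 on \<open>S n\<close> amounts to |t| < T. Off \<open>S n\<close>,
      the exponent s + 1 and the weight 1/m of the functional make up the exponent s + 2.\<close>
    define z where "z p = (if p \<in> S n then t / of_real (T n) else 1 / of_nat p ^ (s + 1))" for p
    have zS: "norm (z p) < 1" if "p \<in> S n" for p
      using that t Tpos by (simp add: z_def norm_divide)
    have zn: "norm (z p) \<le> 1 / real p" if "prime p" "p \<notin> S n" for p
    proof -
      have "real p ^ 1 \<le> real p ^ (s + 1)"
        using prime_ge_1_nat[OF that(1)] by (intro power_increasing) auto
      then have "1 / real p ^ (s + 1) \<le> 1 / real p"
        using prime_gt_0_nat[OF that(1)] by (intro frac_le) auto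
      then show ?thesis
        using that(2) unfolding z_def by (simp only: if_False norm_divide norm_power norm_of_nat norm_one)
    qed
    have prS: "\<forall>p\<in>S n. prime p" using S(2) by blast
    define u where "u j m = compl_mult z m * F j m / of_nat m" for j m
    have su: "summable (\<lambda>m. norm (u j m))" for j
      unfolding u_def
      by (rule summable_mult_compl_mult[OF summable_compl_mult_square[OF S(1) prS zS zn] F_bound])
    have uS: "(\<Sum>m. u j m) = D n j * (\<Prod>p\<in>S n. 1 / (1 - \<omega> j * t / of_real (T n * real p)))" for j
    proof -
      have up: "u j (p * m) = \<omega> j * t / of_real (T n * real p) * u j m" if "p \<in> S n" for p m
      proof (cases "m = 0")
        case False
        have "prime p" "p mod N = a mod N" using S(2)[OF that] by auto
        then have "compl_mult z (p * m) = z p * compl_mult z m"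
          using False prime_ge_1_nat[of p] by (simp add: compl_mult_mult compl_mult_prime)
        then show ?thesis
          using F_mult[OF \<open>p mod N = a mod N\<close>, of j m] that by (simp add: u_def z_def mult_ac)
      qed (simp add: u_def)
      have "(\<Sum>m. if \<exists>p\<in>S n. p dvd m then 0 else u j m) =
          (\<Prod>p\<in>S n. 1 - \<omega> j * t / of_real (T n * real p)) * (\<Sum>m. u j m)"
        by (rule suminf_coprime_sieve[OF S(1) prS su up])
      moreover have "(if \<exists>p\<in>S n. p dvd m then 0 else u j m) =
          (if \<exists>p\<in>S n. p dvd m then 0 else F j m / of_nat m ^ (s + 2))" for m
      proof (cases "(\<exists>p\<in>S n. p dvd m) \<or> m = 0")
        case False
        then have "compl_mult z m = 1 / of_nat m ^ (s + 1)"
          by (intro compl_mult_eq_power) (auto simp: z_def)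
        then show ?thesis by (simp add: u_def)
      qed (auto simp: u_def)
      ultimately have "D n j = (\<Prod>p\<in>S n. 1 - \<omega> j * t / of_real (T n * real p)) * (\<Sum>m. u j m)"
        unfolding D_def by simp
      moreover have "(\<Prod>p\<in>S n. 1 - \<omega> j * t / of_real (T n * real p)) \<noteq> 0"
      proof -
        have "1 - \<omega> j * t / of_real (T n * real p) \<noteq> 0" if "p \<in> S n" for p
        proof -
          have p1: "real p \<ge> 1" using S(2)[OF that] prime_ge_1_nat[of p] by simp
          have "norm (\<omega> j * t / of_real (T n * real p)) = norm t / (T n * real p)"
            unfolding norm_divide norm_mult norm_of_real using Tpos by (simp add: \<omega>_def)
          also have "\<dots> < 1"
          proof -
            have "T n * 1 \<le> T n * real p" using p1 Tpos by (intro mult_left_mono) auto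
            then have "norm t < T n * real p" "0 < T n * real p" using t Tpos by linarith+
            then show ?thesis by (simp only: divide_less_eq_1_pos)
          qed
          finally show ?thesis by auto
        qed
        then show ?thesis unfolding prod_zero_iff[OF S(1)] by blast
      qed
      ultimately show ?thesis by (simp add: prod_dividef)
    qed
    have "(\<Sum>j<r. D n j * (\<Prod>p\<in>S n. 1 / (1 - \<omega> j * t / of_real (T n * real p)))) = (\<Sum>j<r. \<Sum>m. u j m)"
      by (simp only: uS)
    also have "\<dots> = (\<Sum>m. \<Sum>j<r. u j m)"
      using su by (intro suminf_sum[symmetric]) (rule summable_norm_cancel)
    also have "\<dots> = (\<Sum>m. compl_mult z m * of_real (f m) / of_nat m)"
      unfolding u_def by (simp only: sum_divide_distrib[symmetric] sum_distrib_left[symmetric] F_sum)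
    also have "\<dots> \<noteq> 0"
      by (rule eval_nonvanishing_compl_mult[OF nv S(1) prS zS zn])
    finally show "(\<Sum>j<r. D n j * (\<Prod>p\<in>S n. 1 / (1 - \<omega> j * t / of_real (T n * real p)))) \<noteq> 0" .
  qed
  then obtain c \<mu> where c: "\<And>k. (\<Sum>j<r. C j * \<omega> j ^ k) = c * \<mu> ^ k" by blast
  define H where "H k = (\<Sum>m. f (a ^ k * m) / real m ^ (s + 2))" for k
  have H: "complex_of_real (H k) = c * \<mu> ^ k" for k
    using c[of k] C_pow[of k] by (simp add: H_def)
  have H0: "H 0 \<noteq> 0" using H1 by (simp add: H_def)
  then have c0: "c = of_real (H 0)" "c \<noteq> 0" using H[of 0] by auto
  have "H r = H 0"
  proof -
    have "f (a ^ r * m) = f m" for m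
      using ar by (intro per) (metis cong_def cong_scalar_right mult_1)
    then show ?thesis by (simp add: H_def)
  qed
  \<comment> \<open>As a root of unity \<mu> has modulus 1, and as the quotient H 1 / H 0 it is
    real.\<close>
  then have "\<mu> ^ r = 1" using H[of r] c0 by simp
  then have "norm \<mu> ^ r = 1" by (metis norm_one norm_power)
  then have norm1: "norm \<mu> = 1"
    using r by (metis norm_ge_zero power_eq_1_iff not_one_le_zero real_norm_def abs_norm_cancel)
  have \<mu>: "\<mu> = of_real (H 1 / H 0)" using H[of 1] c0 by (simp add: field_simps)
  then have "\<bar>H 1 / H 0\<bar> = 1" using norm1 by (metis norm_of_real)
  then have "H 1 / H 0 = 1 \<or> H 1 / H 0 = -1" by linarith
  then have "H 1 = 1 * H 0 \<or> H 1 = (-1) * H 0" using H0 by (auto simp: field_simps)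
  then show ?thesis by (auto simp: H_def)
qed

lemma heavy_class_sign:
  fixes f :: "nat \<Rightarrow> real"
  assumes N: "N \<ge> 1" and per: "\<And>m n. m mod N = n mod N \<Longrightarrow> f m = f n" and B: "\<And>n. \<bar>f n\<bar> \<le> B"
    and f1: "f 1 \<noteq> 0" and nv: "eval_nonvanishing f" and a: "coprime a N" "heavy N a"
  shows "\<exists>e\<in>{1, -1}. \<forall>m\<ge>1. f (a * m) = e * f m"
proof -
  define L where "L g s = (\<Sum>m. g m / real m ^ (s + 2))" for g :: "nat \<Rightarrow> real" and s :: nat
  have "\<forall>\<^sub>F s in sequentially. L f s \<noteq> 0"
    unfolding L_def by (rule dirichlet_eventually_nonzero[where g = f, OF B f1])
  then have "\<forall>\<^sub>F s in sequentially. L (\<lambda>m. f (a * m)) s = L f s \<or> L (\<lambda>m. f (a * m)) s = - L f s"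
  proof eventually_elim
    case (elim s)
    then show ?case
      using heavy_class_dirichlet_ratio[OF N per B nv a, of s] unfolding L_def by auto
  qed
  then have "\<exists>\<^sub>F s in sequentially. L (\<lambda>m. f (a * m)) s = L f s \<or> L (\<lambda>m. f (a * m)) s = - L f s"
    by (intro eventually_frequently) auto
  \<comment> \<open>The sign may depend on s, but one of the two occurs for infinitely many
    s.\<close>
  then obtain e where e: "e \<in> {1, -1}" "\<exists>\<^sub>F s in sequentially. L (\<lambda>m. f (a * m)) s = e * L f s"
    unfolding frequently_disj_iff by fastforce
  have e1: "\<bar>e\<bar> = 1" using e(1) by auto
  have "f (a * m) - e * f m = 0" if "m \<ge> 1" for m
  proof (rule dirichlet_uniqueness[where g = "\<lambda>m. f (a * m) - e * f m" and B = "2 * B"])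
    show "\<bar>f (a * n) - e * f n\<bar> \<le> 2 * B" for n
    proof -
      have "\<bar>e * f n\<bar> = \<bar>f n\<bar>" using e1 by (simp add: abs_mult)
      then show ?thesis using B[of "a * n"] B[of n] by linarith
    qed
    have "L (\<lambda>m. f (a * m) - e * f m) s = L (\<lambda>m. f (a * m)) s - e * L f s" for s
    proof -
      have s1: "summable (\<lambda>m. f (a * m) / real m ^ (s + 2))" "summable (\<lambda>m. f m / real m ^ (s + 2))"
        using summable_dirichlet[of "\<lambda>m. f (a * m)" B s] summable_dirichlet[of f B s] B by auto
      then show ?thesis
        unfolding L_def diff_divide_distrib times_divide_eq_right[symmetric]
        by (simp only: suminf_diff[symmetric] suminf_mult[symmetric] summable_mult)
    qed
    then show "\<exists>\<^sub>F s in sequentially. (\<Sum>m. (f (a * m) - e * f m) / real m ^ (s + 2)) = 0"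
      using e(2) unfolding L_def by simp
  qed (rule that)
  then show ?thesis using e(1) by auto
qed

text \<open>Modulo N, u is a product of primes in heavy classes, and the signs multiply along this
  factorisation.\<close>

lemma eval_nonvanishing_unit_sign:
  fixes f :: "nat \<Rightarrow> real"
  assumes N: "N \<ge> 1" and per: "\<And>m n. m mod N = n mod N \<Longrightarrow> f m = f n" and B: "\<And>n. \<bar>f n\<bar> \<le> B"
    and f1: "f 1 \<noteq> 0" and nv: "eval_nonvanishing f" and u: "coprime u N"
  shows "\<exists>e\<in>{1, -1}. \<forall>m\<ge>1. f (u * m) = e * f m"
proof -
  obtain n where n: "n \<ge> 1" "n mod N = u mod N" "\<And>p. prime p \<Longrightarrow> p dvd n \<Longrightarrow> heavy N p"
    using coprime_residue_heavy_representative[OF N u] by blast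
  have "coprime n N"
    using n(2) u N by (metis coprime_mod_left_iff not_one_le_zero)
  have "\<exists>e\<in>{1, -1}. \<forall>m\<ge>1. f (n * m) = e * f m"
    using n(1,3) \<open>coprime n N\<close>
  proof (induction n rule: prime_divisors_induct)
    case (unit x)
    then show ?case by auto
  next
    case (factor p x)
    have px: "x \<ge> 1" "p \<ge> 1" using factor by (auto simp: Suc_le_eq)
    have co: "coprime p N" "coprime x N" using factor.prems(3) by auto
    obtain e where e: "e \<in> {1, -1}" "\<forall>m\<ge>1. f (x * m) = e * f m"
      using factor px co by (metis dvd_mult)
    obtain d where d: "d \<in> {1, -1}" "\<forall>m\<ge>1. f (p * m) = d * f m"
      using heavy_class_sign[OF N per B f1 nv co(1)] factor by (metis dvd_triv_left)
    have "f (p * x * m) = d * e * f m" if "m \<ge> 1" for m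
    proof -
      have "f (p * (x * m)) = d * f (x * m)" using d(2) px that by (simp add: Suc_le_eq)
      then show ?thesis using e(2) that by (simp add: mult.assoc)
    qed
    moreover have "d * e \<in> {1, -1}" using d(1) e(1) by auto
    ultimately show ?case by blast
  qed simp
  moreover have "f (n * m) = f (u * m)" for m
    using n(2) by (intro per) (metis mod_mult_left_eq)
  ultimately show ?thesis by simp
qed

section \<open>Indicator functions of intervals\<close>

lemma indicator_interval_measurable: "(indicator {\<alpha><..<\<beta>} :: real \<Rightarrow> real) \<in> borel_measurable borel"
  by measurable

lemma indicator_interval_bound: "\<bar>indicator {\<alpha><..<\<beta>} x :: real\<bar> \<le> 1"
  by (simp add: indicator_def)

lemma sine_coeff_indicator':
  assumes "0 \<le> \<alpha>" "\<alpha> < \<beta>" "\<beta> \<le> 1"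
  shows "sine_coeff (indicator {\<alpha><..<\<beta>}) n =
    sqrt 2 / pi * ((cos (real n * pi * \<alpha>) - cos (real n * pi * \<beta>)) / real n)"
  using sine_coeff_indicator[OF assms, of n] by (cases "n = 0") auto

lemma C_class_imp_eval_nonvanishing:
  assumes ab: "0 \<le> \<alpha>" "\<alpha> < \<beta>" "\<beta> \<le> 1" and C: "indicator {\<alpha><..<\<beta>} \<in> C_class"
  shows "eval_nonvanishing (\<lambda>n. cos (real n * pi * \<alpha>) - cos (real n * pi * \<beta>))"
  unfolding eval_nonvanishing_def
proof (intro allI impI)
  fix \<Lambda> :: "nat \<Rightarrow> complex"
  assume \<Lambda>: "\<Lambda> 1 = 1" "\<forall>m n. m \<ge> 1 \<longrightarrow> n \<ge> 1 \<longrightarrow> \<Lambda> (m * n) = \<Lambda> m * \<Lambda> n" "summable (\<lambda>n. (norm (\<Lambda> n))\<^sup>2)"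
  define f where "f n = cos (real n * pi * \<alpha>) - cos (real n * pi * \<beta>)" for n
  define a where "a = sine_coeff (indicator {\<alpha><..<\<beta>})"
  have a: "a n = sqrt 2 / pi * (f n / real n)" for n
    unfolding a_def f_def by (rule sine_coeff_indicator'[OF ab])
  have L2: "(indicator {\<alpha><..<\<beta>} :: real \<Rightarrow> real) \<in> L2"
    by (rule L2_bounded[OF measurable_unit_iv_borel[OF indicator_interval_measurable] indicator_interval_bound])
  have "(\<Sum>n. \<Lambda> n * of_real (a n)) \<noteq> 0"
  proof (rule dil_approx_evaluation_nonzero)
    show "dil_approx a (unit_seq 1)"
      unfolding a_def by (rule C_class_imp_approx_unit[OF indicator_interval_measurable indicator_interval_bound C])
    show "a 0 = 0" by (simp add: a_def)
    show "summable (\<lambda>n. (a n)\<^sup>2)"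
      using sine_parseval[OF L2] by (auto simp: a_def sums_iff)
  qed (use \<Lambda> in auto)
  moreover have "(\<Sum>n. \<Lambda> n * of_real (a n)) = of_real (sqrt 2 / pi) * (\<Sum>n. \<Lambda> n * of_real (f n) / of_nat n)"
  proof -
    have "norm (of_real (f n) :: complex) \<le> 2" for n
    proof -
      have "\<bar>f n\<bar> \<le> 2"
        unfolding f_def using cos_le_one cos_ge_minus_one by (smt (verit))
      then show ?thesis by simp
    qed
    then have "summable (\<lambda>n. \<Lambda> n * of_real (f n) / of_nat n)"
      by (intro summable_norm_cancel[OF summable_mult_compl_mult[OF \<Lambda>(3)]])
    moreover have "\<Lambda> n * of_real (a n) = of_real (sqrt 2 / pi) * (\<Lambda> n * of_real (f n) / of_nat n)" for n
      by (simp add: a)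
    ultimately show ?thesis by (simp only: suminf_mult)
  qed
  ultimately show "(\<Sum>n. \<Lambda> n * of_real (cos (real n * pi * \<alpha>) - cos (real n * pi * \<beta>)) / of_nat n) \<noteq> 0"
    unfolding f_def[symmetric] by auto
qed

text \<open>The integer argument can be reduced modulo 2q, which makes the identities for f a check
  over one period.\<close>

definition cosq :: "nat \<Rightarrow> nat \<Rightarrow> real" where
  "cosq q j = cos (real j * pi / real q)"

lemma cosq_mod:
  assumes "q \<ge> 1"
  shows "cosq q (j mod (2 * q)) = cosq q j"
proof -
  have "real j = real (j mod (2 * q)) + real (2 * q) * real (j div (2 * q))"
    by (metis mod_mult_div_eq of_nat_add of_nat_mult)
  then have "real j * pi / real q = real (j mod (2 * q)) * pi / real q + 2 * real (j div (2 * q)) * pi"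
    using assms by (simp add: field_simps)
  then show ?thesis
    unfolding cosq_def by (simp add: cos_add)
qed

lemma cosq_mod_eq:
  assumes "q \<ge> 1" "2 * q dvd L" "m mod L = n mod L"
  shows "cosq q (m * k) = cosq q (n * k)"
proof -
  have "[m = n] (mod (2 * q))"
    using assms(2,3) by (metis cong_def cong_dvd_modulus_nat)
  then have "m * k mod (2 * q) = n * k mod (2 * q)"
    by (metis cong_def cong_scalar_right)
  then show ?thesis using cosq_mod[OF assms(1)] by metis
qed

lemma cosq_reflect: "q \<ge> 1 \<Longrightarrow> j \<le> 2 * q \<Longrightarrow> cosq q (2 * q - j) = cosq q j"
proof -
  assume q: "q \<ge> 1" "j \<le> 2 * q"
  then have "real (2 * q - j) * pi / real q = 2 * pi - real j * pi / real q"
    by (simp add: of_nat_diff field_simps)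
  then show ?thesis unfolding cosq_def by (simp only: cos_diff) simp
qed

lemma cosq_supplement: "q \<ge> 1 \<Longrightarrow> j \<le> q \<Longrightarrow> cosq q (q - j) = - cosq q j"
proof -
  assume q: "q \<ge> 1" "j \<le> q"
  then have "real (q - j) * pi / real q = pi - real j * pi / real q"
    by (simp add: of_nat_diff field_simps)
  then show ?thesis unfolding cosq_def by (simp only: cos_diff) simp
qed

lemma cosq_0: "cosq q 0 = 1"
  by (simp add: cosq_def)

lemma cosq_eq: "cos (real n * pi * (real k / real q)) = cosq q (n * k)"
  by (simp add: cosq_def mult_ac)

lemma cosq_strict_antimono:
  assumes "k < l" "l \<le> q"
  shows "cosq q l < cosq q k"
proof -
  have "real k * pi / real q < real l * pi / real q" "real l * pi / real q \<le> pi"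
    using assms by (auto simp: field_simps)
  then show ?thesis unfolding cosq_def using assms by (intro cos_monotone_0_pi) auto
qed

section \<open>Cosine values at multiples of pi/q\<close>

lemma cosq_table_2:
  "cosq 2 0 = 1" "cosq 2 (Suc 0) = 0" "cosq 2 2 = -1" "cosq 2 3 = 0"
  using cosq_reflect[of 2 1] cosq_supplement[of 2 0] cosq_supplement[of 2 1]
  by (simp_all add: cosq_0)

lemma cosq_table_3:
  "cosq 3 0 = 1" "cosq 3 (Suc 0) = 1/2" "cosq 3 2 = -1/2" "cosq 3 3 = -1" "cosq 3 4 = -1/2" "cosq 3 5 = 1/2"
proof -
  have "cosq 3 (Suc 0) = 1/2" by (simp add: cosq_def cos_60)
  then show "cosq 3 0 = 1" "cosq 3 (Suc 0) = 1/2" "cosq 3 2 = -1/2" "cosq 3 3 = -1" "cosq 3 4 = -1/2" "cosq 3 5 = 1/2"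
    using cosq_reflect[of 3 1] cosq_reflect[of 3 2] cosq_supplement[of 3 0] cosq_supplement[of 3 1]
    by (simp_all add: cosq_0)
qed

text \<open>The value cos (pi/4) stays symbolic, as do the irrational cosines for q = 5 and q = 6:
  the identities to be checked are linear in them, so the symmetries of the cosine suffice.\<close>

lemma cosq_table_4:
  "cosq 4 0 = 1" "cosq 4 2 = 0" "cosq 4 3 = - cosq 4 (Suc 0)" "cosq 4 4 = -1" "cosq 4 5 = - cosq 4 (Suc 0)"
  "cosq 4 6 = 0" "cosq 4 7 = cosq 4 (Suc 0)"
  using cosq_reflect[of 4 1] cosq_reflect[of 4 2] cosq_reflect[of 4 3]
    cosq_supplement[of 4 0] cosq_supplement[of 4 1] cosq_supplement[of 4 2]
  by (simp_all add: cosq_0)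

lemma cosq_table_5:
  "cosq 5 0 = 1" "cosq 5 3 = - cosq 5 2" "cosq 5 4 = - cosq 5 (Suc 0)" "cosq 5 5 = -1"
  "cosq 5 6 = - cosq 5 (Suc 0)" "cosq 5 7 = - cosq 5 2" "cosq 5 8 = cosq 5 2" "cosq 5 9 = cosq 5 (Suc 0)"
  using cosq_reflect[of 5 1] cosq_reflect[of 5 2] cosq_reflect[of 5 3] cosq_reflect[of 5 4]
    cosq_supplement[of 5 0] cosq_supplement[of 5 1] cosq_supplement[of 5 2]
  by (simp_all add: cosq_0)

lemma cosq_table_6:
  "cosq 6 0 = 1" "cosq 6 2 = 1/2" "cosq 6 3 = 0" "cosq 6 4 = -1/2" "cosq 6 5 = - cosq 6 (Suc 0)" "cosq 6 6 = -1"
  "cosq 6 7 = - cosq 6 (Suc 0)" "cosq 6 8 = -1/2" "cosq 6 9 = 0" "cosq 6 10 = 1/2" "cosq 6 11 = cosq 6 (Suc 0)"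
proof -
  have "cosq 6 2 = 1/2" by (simp add: cosq_def cos_60)
  then show "cosq 6 0 = 1" "cosq 6 2 = 1/2" "cosq 6 3 = 0" "cosq 6 4 = -1/2" "cosq 6 5 = - cosq 6 (Suc 0)" "cosq 6 6 = -1"
    "cosq 6 7 = - cosq 6 (Suc 0)" "cosq 6 8 = -1/2" "cosq 6 9 = 0" "cosq 6 10 = 1/2" "cosq 6 11 = cosq 6 (Suc 0)"
    using cosq_reflect[of 6 1] cosq_reflect[of 6 2] cosq_reflect[of 6 3] cosq_reflect[of 6 4] cosq_reflect[of 6 5]
      cosq_supplement[of 6 0] cosq_supplement[of 6 1] cosq_supplement[of 6 2] cosq_supplement[of 6 3]
    by (simp_all add: cosq_0)
qed

section \<open>The ten intervals\<close>

text \<open>A periodic function encoded by one period, so that complete multiplicativity is a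
  computation.\<close>

definition table_fun :: "int list \<Rightarrow> nat \<Rightarrow> real" where
  "table_fun xs n = of_int (xs ! (n mod length xs))"

definition table_mult :: "int list \<Rightarrow> bool" where
  "table_mult xs \<longleftrightarrow> length xs \<ge> 2 \<and> xs ! 1 = 1 \<and> list_all (\<lambda>x. \<bar>x\<bar> \<le> 1) xs \<and>
    list_all (\<lambda>i. list_all (\<lambda>j. xs ! (i * j mod length xs) = xs ! i * xs ! j) [0..<length xs]) [0..<length xs]"

lemma table_fun_mult:
  assumes "table_mult xs"
  shows "table_fun xs (m * n) = table_fun xs m * table_fun xs n"
proof -
  let ?L = "length xs"
  have "?L > 0" using assms by (auto simp: table_mult_def)
  have "xs ! ((m mod ?L) * (n mod ?L) mod ?L) = xs ! (m mod ?L) * xs ! (n mod ?L)"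
    using assms \<open>?L > 0\<close> unfolding table_mult_def list_all_iff by (meson atLeastLessThan_iff le0 mod_less_divisor set_upt[THEN equalityD2, THEN subsetD])
  then show ?thesis unfolding table_fun_def by (simp add: mod_mult_eq)
qed

lemma table_fun_bound:
  assumes "table_mult xs"
  shows "\<bar>table_fun xs n\<bar> \<le> 1"
proof -
  have "n mod length xs < length xs" using assms by (intro mod_less_divisor) (auto simp: table_mult_def)
  then have "\<bar>xs ! (n mod length xs)\<bar> \<le> 1"
    using assms unfolding table_mult_def list_all_length by blast
  then show ?thesis unfolding table_fun_def by linarith
qed

lemma table_fun_mod_eq: "length xs dvd L \<Longrightarrow> m mod L = n mod L \<Longrightarrow> table_fun xs m = table_fun xs n"
  unfolding table_fun_def by (metis mod_mod_cancel)

text \<open>The factor p in \<open>e * real p\<close> comes from clearing denominators: at n = p i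
  the dilated term is \<xi> i / i = p \<xi> i / n. L is a common period of both sides, since n ->
  \<xi> (n div p) on the multiples of p has period p times that of \<xi>.\<close>

lemma C_class_of_character:
  fixes k l q p L :: nat and xs :: "int list" and e :: real
  assumes q: "k < l" "l \<le> q" and p: "p \<ge> 2" and e: "\<bar>e\<bar> \<le> 1" and xs: "table_mult xs"
    and L: "2 * q dvd L" "p * length xs dvd L" "L > 0"
    and table: "list_all (\<lambda>r. cosq q (r * k mod (2 * q)) - cosq q (r * l mod (2 * q)) =
      (cosq q k - cosq q l) *
      (table_fun xs r - e * real p * (if p dvd r then table_fun xs (r div p) else 0))) [0..<L]"
  shows "indicator {real k / real q<..<real l / real q} \<in> C_class"
proof -
  let ?\<phi> = "indicator {real k / real q<..<real l / real q} :: real \<Rightarrow> real"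
  define K where "K = cosq q k - cosq q l"
  have K: "K > 0" using cosq_strict_antimono[OF q] by (simp add: K_def)
  have q1: "q \<ge> 1" using q by simp
  have bounds: "0 \<le> real k / real q" "real k / real q < real l / real q" "real l / real q \<le> 1"
    using q by (auto simp: divide_strict_right_mono)
  define R where "R n = table_fun xs n - e * real p * (if p dvd n then table_fun xs (n div p) else 0)" for n
  have lenL: "length xs dvd L" and pL: "p dvd L" using L(2) by (auto dest: dvd_mult_right dvd_mult_left)
  have R_mod: "R (n mod L) = R n" for n
  proof -
    have "table_fun xs (n mod L) = table_fun xs n"
      using lenL by (intro table_fun_mod_eq[of xs L]) auto
    moreover have "p dvd n mod L \<longleftrightarrow> p dvd n" using pL by (simp add: dvd_mod_iff)
    moreover have "table_fun xs (n mod L div p) = table_fun xs (n div p)"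
    proof -
      have "(n div p) mod length xs = (n mod (p * length xs)) div p" for n
        using p by (simp add: mod_mult2_eq)
      moreover have "(n mod L) mod (p * length xs) = n mod (p * length xs)"
        using L(2) by (simp add: mod_mod_cancel)
      ultimately have "(n mod L div p) mod length xs = (n div p) mod length xs"
        by (simp only:)
      then show ?thesis by (simp add: table_fun_def)
    qed
    ultimately show ?thesis by (simp add: R_def)
  qed
  have f: "cos (real n * pi * (real k / real q)) - cos (real n * pi * (real l / real q)) = K * R n" for n
  proof -
    have "cosq q (n * k) - cosq q (n * l) = cosq q ((n mod L) * k) - cosq q ((n mod L) * l)"
      using cosq_mod_eq[OF q1 L(1), of n "n mod L"] by simp
    also have "\<dots> = cosq q ((n mod L) * k mod (2 * q)) - cosq q ((n mod L) * l mod (2 * q))"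
      by (simp only: cosq_mod[OF q1])
    also have "\<dots> = K * R (n mod L)"
      using table L(3) unfolding list_all_iff K_def R_def by simp
    finally show ?thesis by (simp only: cosq_eq R_mod)
  qed
  have a: "sine_coeff ?\<phi> n = sqrt 2 / pi * K *
      (table_fun xs n / real n - e * dil p (\<lambda>n. table_fun xs n / real n) n)" for n
  proof -
    have "R n / real n = table_fun xs n / real n - e * dil p (\<lambda>n. table_fun xs n / real n) n"
    proof (cases "p dvd n")
      case True
      then obtain i where "n = p * i" by blast
      then show ?thesis using p by (cases "i = 0") (auto simp: R_def dil_def field_simps)
    qed (simp add: R_def dil_def)
    then show ?thesis
      unfolding sine_coeff_indicator'[OF bounds] f
      by (simp only: times_divide_eq_right[symmetric] mult.assoc)
  qed
  show ?thesis
    unfolding C_class_iff_dil_approx[OF indicator_interval_measurable indicator_interval_bound]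
  proof
    fix f assume "f \<in> L2"
    then have "summable (\<lambda>n. (sine_coeff f n)\<^sup>2)"
      using sine_parseval by (auto simp: sums_iff)
    then show "dil_approx (sine_coeff ?\<phi>) (sine_coeff f)"
    proof (intro dil_approx_sieved_character[where \<xi> = "table_fun xs" and p = p and e = e and \<kappa> = "sqrt 2 / pi * K"])
      show "table_fun xs 1 = 1" using xs by (simp add: table_fun_def table_mult_def)
      show "table_fun xs (m * n) = table_fun xs m * table_fun xs n" for m n by (rule table_fun_mult[OF xs])
      show "\<bar>table_fun xs n\<bar> \<le> 1" for n by (rule table_fun_bound[OF xs])
      show "sqrt 2 / pi * K \<noteq> 0" using K by simp
    qed (use p e a in auto)
  qed
qed

text \<open>The principal characters modulo 2 and 3, the Legendre symbol modulo 5, and the even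
  quadratic characters modulo 8 and 12.\<close>

lemma table_mult_characters:
  "table_mult [0, 1]" "table_mult [0, 1, 1]" "table_mult [0, 1, -1, -1, 1]"
  "table_mult [0, 1, 0, -1, 0, -1, 0, 1]" "table_mult [0, 1, 0, 0, 0, -1, 0, -1, 0, 0, 0, 1]"
  by code_simp+

lemma C_class_ten_intervals:
  assumes "(\<alpha>, \<beta>) \<in> {(0, 1), (0, 1/2), (1/2, 1), (0, 2/3), (1/3, 2/3), (1/3, 1),
               (1/4, 3/4), (1/5, 3/5), (2/5, 4/5), (1/6, 5/6)}"
  shows "indicator {\<alpha><..<\<beta>} \<in> C_class"
proof -
  note [simp] = upt_rec numeral_2_eq_2[symmetric] table_fun_def cosq_table_2 cosq_table_3 cosq_table_4 cosq_table_5 cosq_table_6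
  \<comment> \<open>In each case e is read off from f p = f 1 * (\<xi> p - e p).\<close>
  have "indicator {real 0 / real 2<..<real 2 / real 2} \<in> C_class"
    by (rule C_class_of_character[where p = 2 and e = 0 and xs = "[0, 1]" and L = 4]) (simp_all add: table_mult_characters)
  moreover have "indicator {real 0 / real 2<..<real 1 / real 2} \<in> C_class"
    by (rule C_class_of_character[where p = 2 and e = "-1" and xs = "[0, 1]" and L = 4]) (simp_all add: table_mult_characters)
  moreover have "indicator {real 1 / real 2<..<real 2 / real 2} \<in> C_class"
    by (rule C_class_of_character[where p = 2 and e = 1 and xs = "[0, 1]" and L = 4]) (simp_all add: table_mult_characters)
  moreover have "indicator {real 0 / real 3<..<real 2 / real 3} \<in> C_class"
    by (rule C_class_of_character[where p = 2 and e = 0 and xs = "[0, 1, 1]" and L = 6]) (simp_all add: table_mult_characters)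
  moreover have "indicator {real 1 / real 3<..<real 2 / real 3} \<in> C_class"
    by (rule C_class_of_character[where p = 3 and e = 1 and xs = "[0, 1]" and L = 6]) (simp_all add: table_mult_characters)
  moreover have "indicator {real 1 / real 3<..<real 3 / real 3} \<in> C_class"
    by (rule C_class_of_character[where p = 2 and e = 1 and xs = "[0, 1, 1]" and L = 6]) (simp_all add: table_mult_characters)
  moreover have "indicator {real 1 / real 4<..<real 3 / real 4} \<in> C_class"
    by (rule C_class_of_character[where p = 2 and e = 0 and xs = "[0, 1, 0, -1, 0, -1, 0, 1]" and L = 16])
       (simp_all add: table_mult_characters)
  moreover have "indicator {real 1 / real 5<..<real 3 / real 5} \<in> C_class"
    by (rule C_class_of_character[where p = 2 and e = "-1" and xs = "[0, 1, -1, -1, 1]" and L = 10])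
       (simp_all add: table_mult_characters)
  moreover have "indicator {real 2 / real 5<..<real 4 / real 5} \<in> C_class"
    by (rule C_class_of_character[where p = 2 and e = 0 and xs = "[0, 1, -1, -1, 1]" and L = 10])
       (simp_all add: table_mult_characters)
  moreover have "indicator {real 1 / real 6<..<real 5 / real 6} \<in> C_class"
    by (rule C_class_of_character[where p = 2 and e = 0 and xs = "[0, 1, 0, 0, 0, -1, 0, -1, 0, 0, 0, 1]" and L = 24])
       (simp_all add: table_mult_characters)
  ultimately show ?thesis
    using assms unfolding insert_iff empty_iff prod.inject
    by (elim disjE conjE FalseE; hypsubst; simp)
qed

section \<open>Exclusion of all other intervals\<close>

text \<open>Here \<open>x = \<Lambda> 2 / 2\<close> and \<open>y = \<Lambda> 3 / 3\<close> for a \<open>\<Lambda>\<close> supported on the primes 2 and 3: the functional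
  of \<open>f\<close> is the left-hand side of the last hypothesis times \<open>f 1 * (\<Sum>n. \<Lambda> n / n)\<close>.\<close>

lemma not_C_class_of_zero:
  fixes k l q :: nat and c2 c3 c4 c6 x y :: real
  assumes q: "k < l" "l \<le> q" "2 * q dvd 12"
    and table: "list_all (\<lambda>r. cosq q (r * k mod (2 * q)) - cosq q (r * l mod (2 * q)) =
      (cosq q k - cosq q l) * (1 + c2 * of_bool (2 dvd r) + c3 * of_bool (3 dvd r) +
        c4 * of_bool (4 dvd r) + c6 * of_bool (6 dvd r))) [0..<12]"
    and xy: "\<bar>2 * x\<bar> < 1" "\<bar>3 * y\<bar> < 1" and zero: "1 + c2 * x + c3 * y + c4 * x\<^sup>2 + c6 * (x * y) = 0"
  shows "indicator {real k / real q<..<real l / real q} \<notin> C_class"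
proof
  assume C: "indicator {real k / real q<..<real l / real q} \<in> C_class"
  define K where "K = cosq q k - cosq q l"
  define R where "R n = 1 + c2 * of_bool (2 dvd n) + c3 * of_bool (3 dvd n) +
        c4 * of_bool (4 dvd n) + c6 * of_bool (6 dvd n)" for n :: nat
  have q1: "q \<ge> 1" using q by simp
  have bounds: "0 \<le> real k / real q" "real k / real q < real l / real q" "real l / real q \<le> 1"
    using q by (auto simp: divide_strict_right_mono)
  have f: "cos (real n * pi * (real k / real q)) - cos (real n * pi * (real l / real q)) = K * R n" for n
  proof -
    have "cosq q (n * k) - cosq q (n * l) = cosq q ((n mod 12) * k) - cosq q ((n mod 12) * l)"
      using cosq_mod_eq[OF q1 q(3), of n "n mod 12"] by simp
    also have "\<dots> = cosq q ((n mod 12) * k mod (2 * q)) - cosq q ((n mod 12) * l mod (2 * q))"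
      by (simp only: cosq_mod[OF q1])
    also have "\<dots> = K * R (n mod 12)"
      using table unfolding list_all_iff K_def R_def by simp
    also have "R (n mod 12) = R n"
      unfolding R_def by (simp add: dvd_mod_iff)
    finally show ?thesis by (simp only: cosq_eq)
  qed
  define z where "z p = (if p = 2 then of_real (2 * x) else if p = 3 then of_real (3 * y) else 0 :: complex)" for p :: nat
  define \<Lambda> where "\<Lambda> = compl_mult z"
  have norm_z: "norm (z p) < 1" if "p \<in> {2, 3}" for p
    using that xy unfolding z_def by (auto simp only: norm_of_real split: if_splits)
  have prS: "\<forall>p\<in>{2, 3}. prime (p :: nat)" by auto
  have z0: "norm (z p) \<le> 1 / real p" if "p \<notin> {2, 3}" for p
    using that by (simp add: z_def)
  have nz: "(\<Sum>n. \<Lambda> n * of_real (K * R n) / of_nat n) \<noteq> 0"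
    using eval_nonvanishing_compl_mult[OF C_class_imp_eval_nonvanishing[OF bounds C] _ prS norm_z z0]
    unfolding f \<Lambda>_def by simp
  have "summable (\<lambda>n. (norm (\<Lambda> n))\<^sup>2)"
    unfolding \<Lambda>_def by (rule summable_compl_mult_square[OF _ prS norm_z z0]) auto
  then have s: "summable (\<lambda>n. \<Lambda> n / of_nat n)"
    using summable_mult_compl_mult[of \<Lambda> "\<lambda>_. 1" 1] by (auto intro: summable_norm_cancel)
  define Z where "Z = (\<Sum>n. \<Lambda> n / of_nat n)"
  have dvd_sums: "(\<lambda>n. of_bool (d dvd n) * (\<Lambda> n / of_nat n)) sums (\<Lambda> d / of_nat d * Z)" if d: "d \<ge> 1" for d
  proof -
    have "(\<lambda>n. \<Lambda> d / of_nat d * (\<Lambda> n / of_nat n)) sums (\<Lambda> d / of_nat d * Z)"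
      unfolding Z_def using s by (intro sums_mult summable_sums)
    then have "dil d (\<lambda>n. \<Lambda> d / of_nat d * (\<Lambda> n / of_nat n)) sums (\<Lambda> d / of_nat d * Z)"
      using d by (simp add: dil_sums_iff)
    moreover have "dil d (\<lambda>n. \<Lambda> d / of_nat d * (\<Lambda> n / of_nat n)) = (\<lambda>n. of_bool (d dvd n) * (\<Lambda> n / of_nat n))"
    proof
      fix n
      show "dil d (\<lambda>n. \<Lambda> d / of_nat d * (\<Lambda> n / of_nat n)) n = of_bool (d dvd n) * (\<Lambda> n / of_nat n)"
      proof (cases "d dvd n")
        case True
        then obtain i where i: "n = d * i" by blast
        show ?thesis
        proof (cases "i = 0")
          case False
          then have "\<Lambda> (d * i) = \<Lambda> d * \<Lambda> i"
            unfolding \<Lambda>_def using d by (intro compl_mult_mult) auto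
          then show ?thesis using d by (simp add: i dil_def)
        qed (simp add: i dil_def)
      qed (simp add: dil_def)
    qed
    ultimately show ?thesis by simp
  qed
  have \<Lambda>2: "\<Lambda> 2 = of_real (2 * x)" and \<Lambda>3: "\<Lambda> 3 = of_real (3 * y)"
    unfolding \<Lambda>_def by (simp_all add: compl_mult_prime z_def)
  have \<Lambda>4: "\<Lambda> 4 = of_real (2 * x) * of_real (2 * x)"
    using compl_mult_mult[of 2 2 z] \<Lambda>2 unfolding \<Lambda>_def by simp
  have \<Lambda>6: "\<Lambda> 6 = of_real (2 * x) * of_real (3 * y)"
    using compl_mult_mult[of 2 3 z] \<Lambda>2 \<Lambda>3 unfolding \<Lambda>_def by simp
  let ?T = "\<lambda>c d n. complex_of_real c * (of_bool (d dvd n) * (\<Lambda> n / of_nat n))"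
  have "(\<lambda>n. of_real K * (\<Lambda> n / of_nat n + ?T c2 2 n + ?T c3 3 n + ?T c4 4 n + ?T c6 6 n)) sums
      (of_real K * (Z + of_real c2 * (\<Lambda> 2 / of_nat 2 * Z) + of_real c3 * (\<Lambda> 3 / of_nat 3 * Z) +
        of_real c4 * (\<Lambda> 4 / of_nat 4 * Z) + of_real c6 * (\<Lambda> 6 / of_nat 6 * Z)))"
    unfolding Z_def using s by (intro sums_mult sums_add dvd_sums[unfolded Z_def] summable_sums) auto
  moreover have "of_real K * (\<Lambda> n / of_nat n + ?T c2 2 n + ?T c3 3 n + ?T c4 4 n + ?T c6 6 n) =
      \<Lambda> n * of_real (K * R n) / of_nat n" for n
    by (simp add: R_def add_divide_distrib algebra_simps)
  moreover have "Z + of_real c2 * (\<Lambda> 2 / of_nat 2 * Z) + of_real c3 * (\<Lambda> 3 / of_nat 3 * Z) +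
        of_real c4 * (\<Lambda> 4 / of_nat 4 * Z) + of_real c6 * (\<Lambda> 6 / of_nat 6 * Z) =
      of_real (1 + c2 * x + c3 * y + c4 * x\<^sup>2 + c6 * (x * y)) * Z"
    unfolding \<Lambda>2 \<Lambda>3 \<Lambda>4 \<Lambda>6 by (simp add: power2_eq_square algebra_simps)
  ultimately have "(\<Sum>n. \<Lambda> n * of_real (K * R n) / of_nat n) = 0"
    by (simp only: zero sums_iff) simp
  with nz show False by simp
qed

text \<open>Here f n / f 1 depends only on gcd n 12, and the coefficients c follow from its values
  at 2, 3, 4, 6 in turn. The equation is linear in y, so a suitable x is chosen and y solved for,
  with |x| < 1/2 and |y| < 1/3. For the first three intervals, setting x = 0 or y = 0 leaves only
  zeros on the boundary |\<Lambda> 2| = 1 or |\<Lambda> 3| = 1, so both primes take part.\<close>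

lemma not_C_class_four_intervals:
  "indicator {0<..<1/3} \<notin> C_class" "indicator {1/3<..<1/2} \<notin> C_class"
  "indicator {1/2<..<2/3} \<notin> C_class" "indicator {2/3<..<1} \<notin> C_class"
proof -
  note [simp] = upt_rec numeral_2_eq_2[symmetric] cosq_table_3 cosq_table_6
  have "indicator {real 0 / real 3<..<real 1 / real 3} \<notin> C_class"
    by (rule not_C_class_of_zero[where ?c2.0 = 2 and ?c3.0 = 3 and ?c4.0 = 0 and ?c6.0 = "-6" and x = "-1/8" and y = "-1/5"])
       simp_all
  then show "indicator {0<..<1/3} \<notin> C_class" by simp
  have "indicator {real 2 / real 6<..<real 3 / real 6} \<notin> C_class"
    by (rule not_C_class_of_zero[where ?c2.0 = 0 and ?c3.0 = "-3" and ?c4.0 = "-4" and ?c6.0 = 6 and x = "-1/8" and y = "1/4"])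
       (simp_all add: power2_eq_square)
  then show "indicator {1/3<..<1/2} \<notin> C_class" by simp
  have "indicator {real 3 / real 6<..<real 4 / real 6} \<notin> C_class"
    by (rule not_C_class_of_zero[where ?c2.0 = "-2" and ?c3.0 = "-3" and ?c4.0 = 4 and ?c6.0 = 0 and x = "1/4" and y = "1/4"])
       (simp_all add: power2_eq_square)
  then show "indicator {1/2<..<2/3} \<notin> C_class" by simp
  have "indicator {real 2 / real 3<..<real 3 / real 3} \<notin> C_class"
    by (rule not_C_class_of_zero[where ?c2.0 = "-4" and ?c3.0 = 3 and ?c4.0 = 0 and ?c6.0 = 0 and x = "1/10" and y = "-1/5"])
       simp_all
  then show "indicator {2/3<..<1} \<notin> C_class" by simp
qed

section \<open>Moduli with few units and the classification of end points\<close>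

lemma coprime_of_linear_relation:
  fixes x c k m :: nat
  assumes "coprime x c" "k * x + c = m \<or> m + c = k * x"
  shows "coprime x m"
proof (rule coprimeI)
  fix d assume d: "d dvd x" "d dvd m"
  then have "d dvd k * x" by simp
  then have "d dvd c" using d assms(2) by (metis dvd_add_right_iff)
  with assms(1) d(1) show "is_unit d" by (rule coprime_common_divisor)
qed

lemma odd_coprime_of_linear_relation:
  fixes x k m t :: nat
  assumes "odd x" "k * x + 2 ^ t = m \<or> m + 2 ^ t = k * x"
  shows "coprime x m"
  by (rule coprime_of_linear_relation[OF _ assms(2)]) (simp add: assms(1))

text \<open>Every other modulus has three units in the first half of its residues.\<close>

lemma few_units_modulus:
  fixes m :: nat
  assumes m: "m \<ge> 1"
    and three: "\<And>u v w. coprime u m \<Longrightarrow> coprime v m \<Longrightarrow> coprime w m \<Longrightarrow> u < v \<Longrightarrow> v < w \<Longrightarrow> 2 * w \<le> m \<Longrightarrow> False"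
  shows "m \<in> {1, 2, 3, 4, 5, 6, 8, 10, 12}"
proof (rule ccontr)
  assume no: "m \<notin> {1, 2, 3, 4, 5, 6, 8, 10, 12}"
  have one: "coprime 1 m" by simp
  \<comment> \<open>For even m the units sought are odd numbers near m/2 or m/4 of which a small
    multiple differs from m by a power of 2: a common divisor with m is odd and divides that power.
    For odd m the units 1, 2 and (m - 1)/2 serve.\<close>
  consider k where "m = 2 * k + 1" | i where "m = 4 * i + 2" | i where "m = 8 * i + 4" | i where "m = 8 * i"
  proof (cases "odd m")
    case True
    then show thesis using that(1) by (elim oddE)
  next
    case False
    then obtain k where k: "m = 2 * k" by blast
    show thesis
    proof (cases "odd k")
      case True
      then obtain i where "k = 2 * i + 1" by (elim oddE)
      then show thesis using that(2)[of i] k by simp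
    next
      case False
      then obtain j where j: "k = 2 * j" by blast
      show thesis
      proof (cases "odd j")
        case True
        then obtain i where "j = 2 * i + 1" by (elim oddE)
        then show thesis using that(3)[of i] k j by simp
      next
        case False
        then obtain i where "j = 2 * i" by blast
        then show thesis using that(4)[of i] k j by simp
      qed
    qed
  qed
  then show False
  proof cases
    case (1 k)
    then have "k \<ge> 3" using no m by auto
    have "coprime 2 m" by (rule coprime_of_linear_relation[of 2 1 k]) (simp_all add: 1)
    moreover have "coprime k m" by (rule coprime_of_linear_relation[of k 1 2]) (simp_all add: 1)
    ultimately show False using three[of 1 2 k] one 1 \<open>k \<ge> 3\<close> by auto
  next
    case (2 i)
    then have "i \<ge> 3" using no m by auto
    have "coprime (2 * i - 1) m" using 2 \<open>i \<ge> 3\<close>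
      by (intro odd_coprime_of_linear_relation[where k = 2 and t = 2]) (simp, simp add: algebra_simps diff_mult_distrib2)
    moreover have "coprime (2 * i - 3) m" using 2 \<open>i \<ge> 3\<close>
      by (intro odd_coprime_of_linear_relation[where k = 2 and t = 3]) (simp, simp add: algebra_simps diff_mult_distrib2)
    moreover have "1 < 2 * i - 3" "2 * i - 3 < 2 * i - 1" "2 * (2 * i - 1) \<le> m"
      using 2 \<open>i \<ge> 3\<close> by linarith+
    ultimately show False using three[of 1 "2 * i - 3" "2 * i - 1"] one by blast
  next
    case (3 i)
    then have "i \<ge> 2" using no m by auto
    have "coprime (2 * i + 3) m" using 3
      by (intro odd_coprime_of_linear_relation[where k = 4 and t = 3]) (simp, simp add: algebra_simps diff_mult_distrib2)
    moreover have "coprime (4 * i + 1) m" using 3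
      by (intro odd_coprime_of_linear_relation[where k = 2 and t = 1]) (simp, simp add: algebra_simps diff_mult_distrib2)
    ultimately show False using three[of 1 "2 * i + 3" "4 * i + 1"] one 3 \<open>i \<ge> 2\<close> by auto
  next
    case (4 i)
    then have "i \<ge> 2" using no m by auto
    have "coprime (2 * i + 1) m" using 4
      by (intro odd_coprime_of_linear_relation[where k = 4 and t = 2]) (simp, simp add: algebra_simps diff_mult_distrib2)
    moreover have "coprime (4 * i - 1) m"
    proof (rule odd_coprime_of_linear_relation)
      show "odd (4 * i - 1)" using \<open>i \<ge> 2\<close> by simp
      show "2 * (4 * i - 1) + 2 ^ 1 = m \<or> m + 2 ^ 1 = 2 * (4 * i - 1)"
        unfolding 4 power_one_right using \<open>i \<ge> 2\<close> by linarith
    qed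
    moreover have "1 < 2 * i + 1" "2 * i + 1 < 4 * i - 1" "2 * (4 * i - 1) \<le> m"
      using 4 \<open>i \<ge> 2\<close> by linarith+
    ultimately show False using three[of 1 "2 * i + 1" "4 * i - 1"] one by blast
  qed
qed

text \<open>\<gamma> stands for either end point. Distinct units w in the lower half give distinct
  fractions 2w/m, all in {\<alpha>, \<beta>}, so there are at most two. Two of them determine the
  interval; a single one leaves m in {1, 2, 3, 4, 6} and five values of \<gamma>.\<close>

lemma units_in_pair_classification:
  fixes \<alpha> \<beta> \<gamma> :: real and m a :: nat
  assumes ab: "\<alpha> < \<beta>" and g: "\<gamma> = 2 * real a / real m" "coprime a m" "m \<ge> 1" "0 \<le> \<gamma>" "\<gamma> \<le> 1"
    and units: "\<And>w. coprime w m \<Longrightarrow> 2 * w \<le> m \<Longrightarrow> 2 * real w / real m \<in> {\<alpha>, \<beta>}"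
  shows "(\<alpha>, \<beta>) \<in> {(1/4, 3/4), (1/5, 3/5), (2/5, 4/5), (1/6, 5/6)} \<or> \<gamma> \<in> {0, 1/3, 1/2, 2/3, 1}"
proof -
  have "m \<in> {1, 2, 3, 4, 5, 6, 8, 10, 12}"
  proof (rule few_units_modulus[OF g(3)])
    fix u v w assume co: "coprime u m" "coprime v m" "coprime w m" and lt: "u < v" "v < w" "2 * w \<le> m"
    have "2 * real u / real m \<in> {\<alpha>, \<beta>}" "2 * real v / real m \<in> {\<alpha>, \<beta>}" "2 * real w / real m \<in> {\<alpha>, \<beta>}"
      using units[OF co(1)] units[OF co(2)] units[OF co(3)] lt by simp_all
    moreover have "2 * real u / real m < 2 * real v / real m" "2 * real v / real m < 2 * real w / real m"
      using lt g(3) by (auto intro!: divide_strict_right_mono)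
    ultimately show False by auto
  qed
  then consider "m = 5" | "m = 8" | "m = 10" | "m = 12" | "m \<in> {1, 2, 3, 4, 6}" by auto
  then show ?thesis
  proof cases
    case 1
    have "coprime 2 (5::nat)" by code_simp
    then have "2 * real 1 / real m \<in> {\<alpha>, \<beta>}" "2 * real 2 / real m \<in> {\<alpha>, \<beta>}"
      by (intro units; simp add: 1)+
    moreover have "2 * real 1 / real m = 2/5" "2 * real 2 / real m = 4/5" by (simp_all add: 1)
    ultimately have "\<alpha> = 2/5 \<and> \<beta> = 4/5" using ab by auto
    then show ?thesis by simp
  next
    case 2
    have "coprime 3 (8::nat)" by code_simp
    then have "2 * real 1 / real m \<in> {\<alpha>, \<beta>}" "2 * real 3 / real m \<in> {\<alpha>, \<beta>}"
      by (intro units; simp add: 2)+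
    moreover have "2 * real 1 / real m = 1/4" "2 * real 3 / real m = 3/4" by (simp_all add: 2)
    ultimately have "\<alpha> = 1/4 \<and> \<beta> = 3/4" using ab by auto
    then show ?thesis by simp
  next
    case 3
    have "coprime 3 (10::nat)" by code_simp
    then have "2 * real 1 / real m \<in> {\<alpha>, \<beta>}" "2 * real 3 / real m \<in> {\<alpha>, \<beta>}"
      by (intro units; simp add: 3)+
    moreover have "2 * real 1 / real m = 1/5" "2 * real 3 / real m = 3/5" by (simp_all add: 3)
    ultimately have "\<alpha> = 1/5 \<and> \<beta> = 3/5" using ab by auto
    then show ?thesis by simp
  next
    case 4
    have "coprime 5 (12::nat)" by code_simp
    then have "2 * real 1 / real m \<in> {\<alpha>, \<beta>}" "2 * real 5 / real m \<in> {\<alpha>, \<beta>}"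
      by (intro units; simp add: 4)+
    moreover have "2 * real 1 / real m = 1/6" "2 * real 5 / real m = 5/6" by (simp_all add: 4)
    ultimately have "\<alpha> = 1/6 \<and> \<beta> = 5/6" using ab by auto
    then show ?thesis by simp
  next
    case 5
    have "2 * a \<le> m"
    proof -
      have "2 * real a = \<gamma> * real m" using g(1,3) by simp
      also have "\<dots> \<le> 1 * real m" using g(5) by (intro mult_right_mono) auto
      finally have "2 * real a \<le> real m" by simp
      then show ?thesis by linarith
    qed
    then have "a \<le> 3" using 5 by auto
    then have "a = 0 \<or> a = 1 \<or> a = 2 \<or> a = 3" by auto
    moreover have "\<not> coprime 3 (6::nat)" by code_simp
    ultimately have "(m = 1 \<and> a = 0) \<or> (m = 2 \<and> a = 1) \<or> (m = 3 \<and> a = 1) \<or> (m = 4 \<and> a = 1) \<or> (m = 6 \<and> a = 1)"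
      using 5 g(2) \<open>2 * a \<le> m\<close> by auto
    then show ?thesis unfolding g(1) by (elim disjE conjE) simp_all
  qed
qed

text \<open>Halving x matches the period: for x = 2 a / m, cos (n pi x) = cos (2 pi n a / m) depends
  on n modulo m only.\<close>

lemma nonneg_rat_half_coprime:
  fixes x :: real
  assumes "x \<in> \<rat>" "x \<ge> 0"
  obtains a m :: nat where "m \<ge> 1" "x = 2 * real a / real m" "coprime a m"
proof -
  have "x / 2 \<in> \<rat>" using assms by simp
  then obtain a m :: nat where "m \<noteq> 0" "\<bar>x / 2\<bar> = real a / real m" "coprime a m"
    by (rule Rats_abs_nat_div_natE)
  then show thesis using assms by (intro that[of m a]) auto
qed

lemma cos_2pi_frac_cong:
  fixes i j m :: nat
  assumes "[i = j] (mod m)" "m \<ge> 1"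
  shows "cos (2 * pi * real i / real m) = cos (2 * pi * real j / real m)"
proof -
  have "cosq m (2 * i mod (2 * m)) = cosq m (2 * j mod (2 * m))"
    using assms(1) by (simp add: cong_def flip: mult_mod_right)
  then have "cosq m (2 * i) = cosq m (2 * j)" by (simp only: cosq_mod[OF assms(2)])
  then show ?thesis by (simp add: cosq_def mult_ac)
qed

text \<open>Comparing \<open>f u = \<plusminus> f 1\<close> and \<open>f (2 u) = \<plusminus> f 2\<close> shows that a unit \<open>u\<close> permutes the two
  numbers \<open>cos (\<pi>\<alpha>)\<close>, \<open>cos (\<pi>\<beta>)\<close>.\<close>

lemma C_class_unit_orbit:
  fixes \<alpha> \<beta> :: real and a m b l :: nat
  assumes ab: "0 \<le> \<alpha>" "\<alpha> < \<beta>" "\<beta> \<le> 1" and C: "indicator {\<alpha><..<\<beta>} \<in> C_class"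
    and \<alpha>: "m \<ge> 1" "\<alpha> = 2 * real a / real m" and \<beta>: "l \<ge> 1" "\<beta> = 2 * real b / real l"
    and u: "coprime u (m * l)"
  shows "cos (real u * pi * \<alpha>) \<in> {cos (pi * \<alpha>), cos (pi * \<beta>)}"
    and "cos (real u * pi * \<beta>) \<in> {cos (pi * \<alpha>), cos (pi * \<beta>)}"
proof -
  define f where "f n = cos (real n * pi * \<alpha>) - cos (real n * pi * \<beta>)" for n
  have nv: "eval_nonvanishing f"
    unfolding f_def[abs_def] by (rule C_class_imp_eval_nonvanishing[OF ab C])
  have per: "f i = f j" if "i mod (m * l) = j mod (m * l)" for i j
  proof -
    have ij: "[i = j] (mod (m * l))" using that by (simp add: cong_def)
    have "[i * a = j * a] (mod m)" "[i * b = j * b] (mod l)"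
      using ij by (auto intro!: cong_scalar_right elim: cong_dvd_modulus_nat)
    from cos_2pi_frac_cong[OF this(1) \<alpha>(1)] cos_2pi_frac_cong[OF this(2) \<beta>(1)]
    show ?thesis by (simp add: f_def \<alpha> \<beta> mult_ac)
  qed
  have AB: "cos (pi * \<alpha>) \<noteq> cos (pi * \<beta>)"
  proof -
    have "pi * \<beta> \<le> pi" using mult_left_mono[OF ab(3), of pi] by simp
    then have "cos (pi * \<beta>) < cos (pi * \<alpha>)" using ab by (intro cos_monotone_0_pi) auto
    then show ?thesis by simp
  qed
  have bound: "\<bar>f n\<bar> \<le> 2" for n
    using cos_le_one[of "real n * pi * \<alpha>"] cos_ge_minus_one[of "real n * pi * \<alpha>"]
      cos_le_one[of "real n * pi * \<beta>"] cos_ge_minus_one[of "real n * pi * \<beta>"]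
    unfolding f_def by linarith
  have "\<exists>e\<in>{1, -1}. \<forall>n\<ge>1. f (u * n) = e * f n"
  proof (rule eval_nonvanishing_unit_sign[where N = "m * l"])
    show "m * l \<ge> 1" using \<alpha>(1) \<beta>(1) by simp
    show "f 1 \<noteq> 0" using AB by (simp add: f_def)
  qed (fact per bound nv u)+
  then obtain e where e': "e \<in> {1, -1}" "\<forall>n\<ge>1. f (u * n) = e * f n" by blast
  then have e: "e = 1 \<or> e = -1" "\<And>n. n \<ge> 1 \<Longrightarrow> f (u * n) = e * f n" by auto
  define A where "A = cos (pi * \<alpha>)"
  define B where "B = cos (pi * \<beta>)"
  define A' where "A' = cos (real u * pi * \<alpha>)"
  define B' where "B' = cos (real u * pi * \<beta>)"
  have 1: "A' - B' = e * (A - B)"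
    using e(2)[of 1] by (simp add: f_def A_def B_def A'_def B'_def)
  have dbl: "cos (real (k * 2) * pi * \<theta>) = 2 * (cos (real k * pi * \<theta>))\<^sup>2 - 1" for k :: nat and \<theta>
    using cos_double_cos[of "real k * pi * \<theta>"] by (simp add: mult_ac)
  \<comment> \<open>By cos 2\<theta> = 2 (cos \<theta>)^2 - 1 the value at 2 carries the difference
    of squares. Dividing by the nonzero difference A - B gives A' + B' = A + B, so the pair is kept
    for e = 1 and swapped for e = -1.\<close>
  have "A'\<^sup>2 - B'\<^sup>2 = e * (A\<^sup>2 - B\<^sup>2)"
  proof -
    have "f (u * 2) = 2 * A'\<^sup>2 - 2 * B'\<^sup>2"
      by (simp add: f_def dbl A'_def B'_def del: of_nat_mult)
    moreover have "f 2 = 2 * A\<^sup>2 - 2 * B\<^sup>2"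
      using dbl[of 1 \<alpha>] dbl[of 1 \<beta>] by (simp add: f_def A_def B_def)
    ultimately have "2 * A'\<^sup>2 - 2 * B'\<^sup>2 = e * (2 * A\<^sup>2 - 2 * B\<^sup>2)"
      using e(2)[of 2] by simp
    also have "\<dots> = 2 * (e * (A\<^sup>2 - B\<^sup>2))" by (simp add: algebra_simps)
    finally show ?thesis by simp
  qed
  then have "(A' - B') * (A' + B') = e * (A - B) * (A + B)"
    by (simp add: power2_eq_square algebra_simps)
  then have 2: "A' + B' = A + B"
    using 1 e(1) AB by (auto simp: A_def B_def)
  have "A' \<in> {A, B} \<and> B' \<in> {A, B}"
    using 1 2 e(1) by auto
  then show "cos (real u * pi * \<alpha>) \<in> {cos (pi * \<alpha>), cos (pi * \<beta>)}"
    "cos (real u * pi * \<beta>) \<in> {cos (pi * \<alpha>), cos (pi * \<beta>)}"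
    by (auto simp: A_def B_def A'_def B'_def)
qed

text \<open>Since a is a unit modulo m, any unit w is u a for some u, which can be lifted to a unit
  modulo m * l. The orbit hypothesis then gives an equality of cosines on [0, pi], where the cosine
  is injective.\<close>

lemma unit_orbit_fractions:
  fixes \<alpha> \<beta> \<gamma> :: real and a m l w :: nat
  assumes ab: "0 \<le> \<alpha>" "\<alpha> \<le> 1" "0 \<le> \<beta>" "\<beta> \<le> 1" and \<gamma>: "m \<ge> 1" "\<gamma> = 2 * real a / real m" "coprime a m" and l: "l \<ge> 1"
    and orbit: "\<And>u. coprime u (m * l) \<Longrightarrow> cos (real u * pi * \<gamma>) \<in> {cos (pi * \<alpha>), cos (pi * \<beta>)}"
    and w: "coprime w m" "2 * w \<le> m"
  shows "2 * real w / real m \<in> {\<alpha>, \<beta>}"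
proof -
  obtain a' where a': "[a * a' = 1] (mod m)"
    using cong_solve_coprime_nat[OF \<gamma>(3)] by auto
  then have "coprime (a * a') m"
    using cong_imp_coprime[OF cong_sym[OF a']] by simp
  then have "coprime a' m" by simp
  with w(1) have "coprime (w * a') m" by simp
  then obtain u where u: "u mod m = (w * a') mod m" "coprime u (m * l)"
    using coprime_lift[OF _ l] by blast
  have "[u * a = w * a' * a] (mod m)"
    using u(1) by (intro cong_scalar_right) (simp add: cong_def)
  also have "w * a' * a = w * (a * a')" by simp
  also have "[w * (a * a') = w * 1] (mod m)"
    using a' by (rule cong_scalar_left)
  finally have "[u * a = w] (mod m)" by simp
  then have "cos (2 * pi * real (u * a) / real m) = cos (2 * pi * real w / real m)"
    by (rule cos_2pi_frac_cong[OF _ \<gamma>(1)])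
  moreover have "2 * pi * real (u * a) / real m = real u * pi * \<gamma>"
    by (simp add: \<gamma>(2))
  moreover have "2 * pi * real w / real m = pi * (2 * real w / real m)" by simp
  ultimately have "cos (pi * (2 * real w / real m)) \<in> {cos (pi * \<alpha>), cos (pi * \<beta>)}"
    using orbit[OF u(2)] by metis
  moreover have "0 \<le> pi * (2 * real w / real m)" "pi * (2 * real w / real m) \<le> pi"
    using w(2) \<gamma>(1) by (auto simp: mult_le_cancel_left1 field_simps)
  moreover have "0 \<le> pi * \<alpha>" "pi * \<alpha> \<le> pi" "0 \<le> pi * \<beta>" "pi * \<beta> \<le> pi"
    using ab mult_left_mono[OF ab(2), of pi] mult_left_mono[OF ab(4), of pi] by simp_all
  ultimately have "pi * (2 * real w / real m) = pi * \<alpha> \<or> pi * (2 * real w / real m) = pi * \<beta>"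
    using cos_inj_pi by blast
  then show ?thesis by (simp only: mult_cancel_left) auto
qed

theorem theorem1p8:
  fixes \<alpha> \<beta> :: real
  assumes "\<alpha> \<in> \<rat>" and "\<beta> \<in> \<rat>" and "0 \<le> \<alpha>" and "\<alpha> < \<beta>" and "\<beta> \<le> 1"
  shows "indicator {\<alpha><..<\<beta>} \<in> C_class \<longleftrightarrow>
    (\<alpha>, \<beta>) \<in> {(0, 1), (0, 1/2), (1/2, 1), (0, 2/3), (1/3, 2/3), (1/3, 1),
               (1/4, 3/4), (1/5, 3/5), (2/5, 4/5), (1/6, 5/6)}"
proof
  assume C: "indicator {\<alpha><..<\<beta>} \<in> C_class"
  have b: "0 \<le> \<beta>" "\<alpha> \<le> 1" using assms by auto
  obtain a m where \<alpha>: "m \<ge> 1" "\<alpha> = 2 * real a / real m" "coprime a m"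
    using nonneg_rat_half_coprime[OF assms(1,3)] by metis
  obtain c l where \<beta>: "l \<ge> 1" "\<beta> = 2 * real c / real l" "coprime c l"
    using nonneg_rat_half_coprime[OF assms(2) b(1)] by metis
  note orbit = C_class_unit_orbit[OF assms(3-5) C \<alpha>(1,2) \<beta>(1,2)]
  let ?special = "(\<alpha>, \<beta>) \<in> {(1/4, 3/4), (1/5, 3/5), (2/5, 4/5), (1/6, 5/6)}"
  have "?special \<or> \<alpha> \<in> {0, 1/3, 1/2, 2/3, 1}"
  proof (rule units_in_pair_classification[OF assms(4) \<alpha>(2,3,1) assms(3) b(2)])
    show "2 * real w / real m \<in> {\<alpha>, \<beta>}" if "coprime w m" "2 * w \<le> m" for w
      using unit_orbit_fractions[OF assms(3) b(2) b(1) assms(5) \<alpha> \<beta>(1) orbit(1) that] .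
  qed
  moreover have "?special \<or> \<beta> \<in> {0, 1/3, 1/2, 2/3, 1}"
  proof (rule units_in_pair_classification[OF assms(4) \<beta>(2,3,1) b(1) assms(5)])
    show "2 * real w / real l \<in> {\<alpha>, \<beta>}" if "coprime w l" "2 * w \<le> l" for w
      using unit_orbit_fractions[OF assms(3) b(2) b(1) assms(5) \<beta> \<alpha>(1) _ that] orbit(2)
      by (simp add: mult.commute)
  qed
  \<comment> \<open>The five points give ten pairs. Without these four, six remain, and the four
    special intervals complete the list.\<close>
  moreover have "(\<alpha>, \<beta>) \<notin> {(0, 1/3), (1/3, 1/2), (1/2, 2/3), (2/3, 1)}"
  proof
    assume "(\<alpha>, \<beta>) \<in> {(0, 1/3), (1/3, 1/2), (1/2, 2/3), (2/3, 1)}"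
    then have "indicator {\<alpha><..<\<beta>} \<notin> C_class"
      unfolding insert_iff empty_iff prod.inject
      by (elim disjE conjE FalseE) (simp_all only: not_C_class_four_intervals not_False_eq_True)
    with C show False by blast
  qed
  ultimately have cases: "?special \<or> (\<alpha> \<in> {0, 1/3, 1/2, 2/3, 1} \<and> \<beta> \<in> {0, 1/3, 1/2, 2/3, 1} \<and>
      (\<alpha>, \<beta>) \<notin> {(0, 1/3), (1/3, 1/2), (1/2, 2/3), (2/3, 1)})"
    by blast
  show "(\<alpha>, \<beta>) \<in> {(0, 1), (0, 1/2), (1/2, 1), (0, 2/3), (1/3, 2/3), (1/3, 1),
               (1/4, 3/4), (1/5, 3/5), (2/5, 4/5), (1/6, 5/6)}"
    using cases assms(4) unfolding insert_iff empty_iff prod.inject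
    by (elim disjE conjE FalseE; hypsubst; simp)
qed (rule C_class_ten_intervals)

end
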